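(* Suppose $(G,T)$ is a $1$-free, non-elementary GBS system. Then $\operatorname{Fix}(\phi)$ is finitely generated for all $\phi\in\operatorname{Aut}^T(G)$ if and only if one of the following occurs: \begin{enumerate} \item $\beta(G)=0$, or \item $\beta(G)=1$ and either $\Delta(G)=\{1,-1\}$ or $\Delta(G)$ is not generated by an integer. \end{enumerate}
   Context: A GBS system $(G,T)$ is a finitely generated group $G$ together with a tree $T$ and an action of $G$ on $T$ (as usual in Bass-Serre theory, by graph automorphisms without edge inversions) in which all edge and vertex stabilisers are infinite cyclic. It is non-elementary if $G$ is not isomorphic to $\mathbb{Z}$, $\mathbb{Z}^2$ or the Klein bottle group. It is $1$-free if there is no edge of $T$ whose $G$-stabiliser equals the $G$-stabiliser of one of its endpoints. $\beta(G)$ is the first Betti number $1-|V(T/G)|+|E(T/G)|$ of the quotient graph $T/G$ (for non-elementary $G$ it does not depend on the choice of $T$). The modular homomorphism $\Delta:G\to\mathbb{Q}^*$ of a non-elementary GBS group is defined as follows: given $g\in G$, take any non-trivial $x\in G$ fixing a point of $T$; there are non-zero integers $p,q$ with $gx^pg^{-1}=x^q$, and $\Delta(g):=p/q$ (this does not depend on the choices). $\Delta(G)\leq\mathbb{Q}^*$ denotes its image; "generated by an integer" means that $\Delta(G)$ is the cyclic subgroup of $\mathbb{Q}^*$ generated by some integer. $\operatorname{Aut}^T(G)$ is the subgroup of those $\phi\in\operatorname{Aut}(G)$ for which there is an isometry $f:T\to T$ with $f(gx)=\phi(g)f(x)$ for all $g\in G$, $x\in T$. $\operatorname{Fix}(\phi)=\{g\in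 G\mid\phi(g)=g\}$. *)

theory Defs
  imports
    "HOL-Algebra.Elementary_Groups"
    "HOL-Algebra.Group_Action"
    "Graph_Theory.Pair_Digraph"
    "Graph_Theory.Digraph_Component"
    "Graph_Theory.Shortest_Path"
begin

section \<open>Trees\<close>

text \<open>
  Trees are simple and may be infinite, so they are given as symmetric, loop-free, possibly infinite
  pair digraphs; an edge of the tree is a pair of mutually inverse arcs. The library predicate
  \<^const>\<open>tree\<close> forbids all directed cycles, including the back-and-forth cycle of
  length 2 along an edge, so it cannot be used for symmetric digraphs. Circuits of a symmetric
  digraph are its cycles of length at least 3. Connectedness includes non-emptiness.
\<close>

locale simplicial_tree = pair_bidirected_digraph T for T :: "'v pair_pre_digraph" +
  assumes connected: "Digraph_Component.connected (with_proj T)"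
    and no_circuit: "\<nexists>p. cycle p \<and> length p \<ge> 3"

definition undirected_edges :: "'v pair_pre_digraph \<Rightarrow> 'v set set" where
  "undirected_edges T = {{u, v} | u v. (u, v) \<in> parcs T}"

definition path_dist :: "'v pair_pre_digraph \<Rightarrow> 'v \<Rightarrow> 'v \<Rightarrow> ereal" where
  "path_dist T = wf_digraph.\<mu> (with_proj T) (\<lambda>_. 1)"

text \<open>
  Isometries are recorded by their effect on vertices. For a tree other than a line in which every
  vertex has at least two neighbours, every surjective isometry of the geometric realisation
  permutes the vertices: it permutes the branch points, and the vertices are the points at integer
  distance from a branch point.
\<close>

definition tree_isometry :: "'v pair_pre_digraph \<Rightarrow> ('v \<Rightarrow> 'v) \<Rightarrow> bool" where
  "tree_isometry T f \<longleftrightarrow> bij_betw f (pverts T) (pverts T) \<and>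
    (\<forall>u \<in> pverts T. \<forall>v \<in> pverts T. path_dist T (f u) (f v) = path_dist T u v)"


section \<open>Groups\<close>

definition finitely_generated :: "('g, 'm) monoid_scheme \<Rightarrow> 'g set \<Rightarrow> bool" where
  "finitely_generated G H \<longleftrightarrow> (\<exists>S \<subseteq> carrier G. finite S \<and> generate G S = H)"

definition infinite_cyclic :: "('g, 'm) monoid_scheme \<Rightarrow> 'g set \<Rightarrow> bool" where
  "infinite_cyclic G H \<longleftrightarrow> G\<lparr>carrier := H\<rparr> \<cong> integer_group"

text \<open>
  The fundamental group $\langle a, b \mid b a b^{-1} = a^{-1} \rangle$ of the Klein bottle is the
  semidirect product of two copies of the integers in which the generator of the second acts on the
  first by inversion; the pair $(i, j)$ stands for $a^i b^j$.
\<close>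

definition klein_bottle_group :: "(int \<times> int) monoid" where
  "klein_bottle_group =
    \<lparr>carrier = UNIV,
     monoid.mult = (\<lambda>(i, j) (k, l). (i + (if even j then k else - k), j + l)),
     one = (0, 0)\<rparr>"

lemma group_klein_bottle_group: "group klein_bottle_group"
proof (rule groupI)
  fix x assume "x \<in> carrier klein_bottle_group"
  obtain i j where "x = (i, j)" by (cases x)
  then show "\<exists>y \<in> carrier klein_bottle_group.
      y \<otimes>\<^bsub>klein_bottle_group\<^esub> x = \<one>\<^bsub>klein_bottle_group\<^esub>"
    by (intro bexI [of _ "(if even j then - i else i, - j)"]) (auto simp: klein_bottle_group_def)
qed (auto simp: klein_bottle_group_def)

definition non_elementary :: "('g, 'm) monoid_scheme \<Rightarrow> bool" where
  "non_elementary G \<longleftrightarrow> \<not> G \<cong> integer_group \<and>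
    \<not> G \<cong> integer_group \<times>\<times> integer_group \<and> \<not> G \<cong> klein_bottle_group"

definition rat_units :: "rat monoid" where
  "rat_units = \<lparr>carrier = UNIV - {0}, monoid.mult = (*), one = 1\<rparr>"

definition generated_by_integer :: "rat set \<Rightarrow> bool" where
  "generated_by_integer D \<longleftrightarrow> (\<exists>n :: int. n \<noteq> 0 \<and> D = generate rat_units {of_int n})"

definition fixed_subgroup :: "('g, 'm) monoid_scheme \<Rightarrow> ('g \<Rightarrow> 'g) \<Rightarrow> 'g set" where
  "fixed_subgroup G \<phi> = {g \<in> carrier G. \<phi> g = g}"


section \<open>Generalised Baumslag--Solitar systems\<close>

definition edge_action :: "('g \<Rightarrow> 'v \<Rightarrow> 'v) \<Rightarrow> 'g \<Rightarrow> 'v set \<Rightarrow> 'v set" where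
  "edge_action act g e = act g ` e"

text \<open>
  As inversions are excluded, the setwise stabiliser of an edge is its pointwise stabiliser.
\<close>

locale gbs_system = simplicial_tree T + group_action G "pverts T" act
  for G :: "('g, 'm) monoid_scheme" and T :: "'v pair_pre_digraph" and act :: "'g \<Rightarrow> 'v \<Rightarrow> 'v" +
  assumes finitely_generated: "finitely_generated G (carrier G)"
    and act_arc: "\<lbrakk>g \<in> carrier G; (u, v) \<in> parcs T\<rbrakk> \<Longrightarrow> (act g u, act g v) \<in> parcs T"
    and no_inversion: "\<lbrakk>g \<in> carrier G; (u, v) \<in> parcs T\<rbrakk> \<Longrightarrow> (act g u, act g v) \<noteq> (v, u)"
    and vertex_stabilizer: "v \<in> pverts T \<Longrightarrow> infinite_cyclic G (stabilizer G act v)"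
    and edge_stabilizer:
      "e \<in> undirected_edges T \<Longrightarrow> infinite_cyclic G (stabilizer G (edge_action act) e)"

definition one_free ::
  "('g, 'm) monoid_scheme \<Rightarrow> 'v pair_pre_digraph \<Rightarrow> ('g \<Rightarrow> 'v \<Rightarrow> 'v) \<Rightarrow> bool" where
  "one_free G T act \<longleftrightarrow> \<not> (\<exists>e \<in> undirected_edges T. \<exists>v \<in> e.
    stabilizer G (edge_action act) e = stabilizer G act v)"

text \<open>
  Meaningful if the quotient graph is finite, which is the case for every 1-free, non-elementary
  GBS system: the finitely generated group $G$ then acts cocompactly on a minimal subtree, and
  a vertex outside it would have the same stabiliser as the first edge on its way to the subtree.
\<close>

definition betti ::
  "('g, 'm) monoid_scheme \<Rightarrow> 'v pair_pre_digraph \<Rightarrow> ('g \<Rightarrow> 'v \<Rightarrow> 'v) \<Rightarrow> int" where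
  "betti G T act = 1 - int (card (orbits G (pverts T) act))
    + int (card (orbits G (undirected_edges T) (edge_action act)))"

text \<open>
  By absence of inversions, an element fixing a point of (the realisation of) the tree fixes a
  vertex.
\<close>

definition modular_hom ::
  "('g, 'm) monoid_scheme \<Rightarrow> 'v pair_pre_digraph \<Rightarrow> ('g \<Rightarrow> 'v \<Rightarrow> 'v) \<Rightarrow> 'g \<Rightarrow> rat" where
  "modular_hom G T act g = (THE r. \<exists>v \<in> pverts T. \<exists>x \<in> stabilizer G act v - {\<one>\<^bsub>G\<^esub>}. \<exists>p q :: int.
    p \<noteq> 0 \<and> q \<noteq> 0 \<and> g \<otimes>\<^bsub>G\<^esub> x [^]\<^bsub>G\<^esub> p \<otimes>\<^bsub>G\<^esub> inv\<^bsub>G\<^esub> g = x [^]\<^bsub>G\<^esub> q \<and>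
    r = of_int p / of_int q)"

definition modular_image ::
  "('g, 'm) monoid_scheme \<Rightarrow> 'v pair_pre_digraph \<Rightarrow> ('g \<Rightarrow> 'v \<Rightarrow> 'v) \<Rightarrow> rat set" where
  "modular_image G T act = modular_hom G T act ` carrier G"

definition tree_auto ::
  "('g, 'm) monoid_scheme \<Rightarrow> 'v pair_pre_digraph \<Rightarrow> ('g \<Rightarrow> 'v \<Rightarrow> 'v) \<Rightarrow> ('g \<Rightarrow> 'g) set" where
  "tree_auto G T act = {\<phi> \<in> auto G. \<exists>f. tree_isometry T f \<and>
    (\<forall>g \<in> carrier G. \<forall>x \<in> pverts T. f (act g x) = act (\<phi> g) (f x))}"

end

theory Submission
  imports Defs
begin

text \<open>
  Let \<open>\<phi>\<close> be realised by the isometry \<open>f\<close>, and let \<open>H\<close> be its fixed subgroup. The elements of \<open>H\<close>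
  commute with \<open>f\<close>, so \<open>H\<close> acts on the subtree \<open>Tf\<close> of vertices fixed by \<open>f\<close>.

  If \<open>Tf\<close> is empty, \<open>H\<close> permutes the vertices that \<open>f\<close> moves least. Up to powers of \<open>f\<close> there are
  finitely many of them, which makes a subgroup of finite index in \<open>H\<close> cyclic modulo a vertex
  stabiliser (\<open>finitely_generated_no_fixed_vertex\<close>). If \<open>f\<close> fixes a vertex \<open>x\<close>, then \<open>\<phi>\<close> acts on the
  infinite cyclic group \<open>Stab x\<close> by a sign, and since stabilisers are commensurable the sign is the
  same at all fixed vertices. The defect \<open>g\<^sup>-\<^sup>1 \<phi>(g)\<close> tells whether \<open>g x\<close> is fixed and to which
  \<open>H\<close>-orbit it belongs. For the sign \<open>-1\<close>, multiplying \<open>g\<close> by elements of \<open>Stab x\<close> changes the defect by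
  arbitrary even powers of the generator, so \<open>H\<close> has at most two orbits on \<open>G x \<inter> Tf\<close> and is finitely
  generated (\<open>finitely_generated_inverting\<close>).

  For the sign \<open>+1\<close>, \<open>H\<close> contains the stabilisers of all fixed vertices. As the action is 1-free,
  \<open>Tf\<close> is then a minimal \<open>H\<close>-tree, and \<open>H\<close> is finitely generated exactly if \<open>Tf / H\<close> is finite
  (\<open>finitely_generated_cofinite\<close>, \<open>finitely_generated_if_cofinite\<close>). Moreover \<open>Tf / H \<rightarrow> T / G\<close> is locally
  injective, so every \<open>H\<close>-orbit on \<open>Tf\<close> meets a given lift to \<open>T\<close> of the universal cover of \<open>T / G\<close>
  (\<open>orbit_representatives\<close>). Let \<open>S\<close> be a lift of a maximal subtree of \<open>T / G\<close>; the first Betti number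
  counts the edge orbits that miss \<open>S\<close> (\<open>betti_eq\<close>). If it is 0, the universal cover lifts to the finite
  set \<open>S\<close>. If it is 1, it lifts to the union of the \<open>t\<^sup>k S\<close> for an element \<open>t\<close> that runs once around the
  loop, and \<open>\<Delta>(G)\<close> is generated by \<open>\<Delta>(t)\<close>. An infinite quotient \<open>Tf / H\<close> forces \<open>Tf\<close> to contain a ray
  along which \<open>t\<close> or its inverse translates. The defect of \<open>t\<close> fixes that ray, so its conjugates under
  all powers of \<open>t\<close> lie in one infinite cyclic group; as conjugation multiplies exponents by
  \<open>\<Delta>(t)\<close>, either \<open>t \<in> H\<close>, or \<open>\<Delta>(t)\<close> is an integer, and if it is \<open>-1\<close> then \<open>t\<^sup>2 \<in> H\<close> (\<open>fixed_ray\<close>).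
  Elements of \<open>H\<close> that translate along the loop make \<open>Tf / H\<close> finite.

  Conversely, suppose that there is a loop with \<open>\<Delta>(t)\<close> an integer other than \<open>-1\<close>, or that there are
  two loops. Twisting along an edge orbit that misses \<open>S\<close> gives an automorphism which is the identity
  on the stabilisers of \<open>S\<close> and multiplies the corresponding \<open>t\<close> by an element \<open>z\<close> of a stabiliser
  (\<open>loop_twist\<close>). In the first case take \<open>g = t\<close>, and in the second the commutator of two loops, on
  which \<open>\<Delta>\<close> is trivial. For suitable \<open>z\<close>, the powers of \<open>g\<close> have infinitely many different defects in a
  single stabiliser, so \<open>H\<close> has infinitely many orbits on \<open>Tf\<close>.
\<close>

section \<open>Geometry of a tree\<close>

definition tdist :: "'v pair_pre_digraph \<Rightarrow> 'v \<Rightarrow> 'v \<Rightarrow> nat" where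
  "tdist T x y = (LEAST n. (x, y) \<in> parcs T ^^ n)"

text \<open>
  The neighbour of \<open>y\<close> on the geodesic from \<open>y\<close> to \<open>x\<close>. Convexity, geodesics and their behaviour under
  automorphisms are all expressed through this function; it is only meaningful for \<open>y \<noteq> x\<close>.
\<close>

definition toward :: "'v pair_pre_digraph \<Rightarrow> 'v \<Rightarrow> 'v \<Rightarrow> 'v" where
  "toward T y x = (SOME z. (y, z) \<in> parcs T \<and> tdist T z x < tdist T y x)"

context simplicial_tree
begin

lemma reachable_all: "\<lbrakk>x \<in> pverts T; y \<in> pverts T\<rbrakk> \<Longrightarrow> (x, y) \<in> (parcs T)\<^sup>*"
proof -
  assume xy: "x \<in> pverts T" "y \<in> pverts T"
  have "strongly_connected (with_proj T)"
    using symmetric_connected_imp_strongly_connected[OF pair_sym_arcs connected] .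
  then have "reachable (with_proj T) x y"
    using xy by (auto simp: strongly_connected_def)
  then have "(x, y) \<in> rtrancl_on (pverts T) (parcs T)"
    by (simp add: reachable_def)
  then show ?thesis by (rule rtrancl_on_rtranclI)
qed

lemma pverts_nonempty: "pverts T \<noteq> {}"
  using connected symmetric_connected_imp_strongly_connected[OF pair_sym_arcs connected]
  by (auto simp: strongly_connected_def)

text \<open>
  A walk from \<open>a\<close> to \<open>b\<close> that avoids their common neighbour \<open>w\<close> shortens to a path, which closes up
  through \<open>w\<close> to a circuit. All further geometry rests on this form of acyclicity.
\<close>

lemma no_detour:
  assumes a: "(w, a) \<in> parcs T" and b: "(w, b) \<in> parcs T" and ne: "a \<noteq> b"
  shows "(a, b) \<notin> {e \<in> parcs T. fst e \<noteq> w \<and> snd e \<noteq> w}\<^sup>*"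
proof
  assume "(a, b) \<in> {e \<in> parcs T. fst e \<noteq> w \<and> snd e \<noteq> w}\<^sup>*"
  then have "\<exists>p. awalk a p b \<and> w \<notin> set (awalk_verts a p)"
  proof (induction rule: converse_rtrancl_induct)
    case base
    show ?case using b pair_no_loops[OF b] in_arcsD2[OF b]
      by (intro exI[of _ "[]"]) (auto simp: awalk_Nil_iff)
  next
    case (step y z)
    then obtain p where p: "awalk z p b" "w \<notin> set (awalk_verts z p)" by blast
    then show ?case using step.hyps
      by (intro exI[of _ "(y, z) # p"]) (auto simp: awalk_Cons_iff)
  qed
  then obtain p where p: "awalk a p b" "w \<notin> set (awalk_verts a p)" by blast
  define q where "q = awalk_to_apath p"
  have q: "apath a q b" using apath_awalk_to_apath[OF p(1)] by (simp add: q_def)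
  have qs: "set q \<subseteq> set p" using awalk_to_apath_subset[OF p(1)] by (simp add: q_def)
  have aq: "awalk a q b" "distinct (awalk_verts a q)" using q by (auto simp: apath_def)
  have qne: "q \<noteq> []" using aq ne by (auto simp: awalk_Nil_iff)
  then have wq: "w \<notin> set (awalk_verts a q)"
    using p(2) qs set_awalk_verts_not_Nil[OF aq(1)] set_awalk_verts_not_Nil[OF p(1)]
    by (cases "p = []") auto
  have ba: "(b, w) \<in> parcs T" using arcs_symmetric[OF b] .
  have 1: "awalk w ((w, a) # q @ [(b, w)]) w"
    using a ba aq(1) in_arcsD1[OF a] by (auto simp: awalk_Cons_iff awalk_Nil_iff)
  have 2: "awalk_verts w ((w, a) # q @ [(b, w)]) = w # awalk_verts a q @ [w]"
    using awalk_verts_append[of a q "[(b, w)]" w] aq(1) ba 1 awlast_of_awalk[OF aq(1)]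
    by (simp add: awalk_Cons_iff)
  have "cycle ((w, a) # q @ [(b, w)])"
    unfolding cycle_def using 1 2 aq(2) wq by (intro exI[of _ w]) auto
  moreover have "length ((w, a) # q @ [(b, w)]) \<ge> 3" using qne by (cases q) auto
  ultimately show False using no_circuit by blast
qed

abbreviation (input) "d \<equiv> tdist T"
abbreviation (input) "tw \<equiv> toward T"

lemma relpow_tdist: "\<lbrakk>x \<in> pverts T; y \<in> pverts T\<rbrakk> \<Longrightarrow> (x, y) \<in> parcs T ^^ d x y"
  unfolding tdist_def using reachable_all[of x y] by (auto simp: rtrancl_power intro: LeastI)

lemma tdist_le: "(x, y) \<in> parcs T ^^ n \<Longrightarrow> d x y \<le> n"
  unfolding tdist_def by (rule Least_le)

lemma tdist_self [simp]: "d x x = 0"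
  using tdist_le[of x x 0] by simp

lemma tdist_eq_0: "\<lbrakk>x \<in> pverts T; y \<in> pverts T\<rbrakk> \<Longrightarrow> d x y = 0 \<longleftrightarrow> x = y"
  using relpow_tdist[of x y] by auto

lemma relpow_sym: "(x, y) \<in> parcs T ^^ n \<Longrightarrow> (y, x) \<in> parcs T ^^ n"
proof (induction n arbitrary: y)
  case (Suc n)
  then obtain z where "(x, z) \<in> parcs T ^^ n" "(z, y) \<in> parcs T" by auto
  then show ?case using Suc.IH arcs_symmetric relpow_Suc_I2 by metis
qed auto

lemma tdist_sym: "\<lbrakk>x \<in> pverts T; y \<in> pverts T\<rbrakk> \<Longrightarrow> d x y = d y x"
  by (meson relpow_sym relpow_tdist tdist_le le_antisym)

lemma tdist_triangle:
  "\<lbrakk>x \<in> pverts T; y \<in> pverts T; z \<in> pverts T\<rbrakk> \<Longrightarrow> d x z \<le> d x y + d y z"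
  by (rule tdist_le) (auto simp: relpow_add intro: relpow_tdist)

lemma tdist_arc: "(x, y) \<in> parcs T \<Longrightarrow> d x y = 1"
  using tdist_le[of x y 1] tdist_eq_0[of x y] in_arcsD1 in_arcsD2 pair_no_loops[of "(x,y)"]
  by (metis One_nat_def fst_conv snd_conv le_antisym le_simps(3) neq0_conv relpow_1)

lemma arc_if_tdist: "\<lbrakk>x \<in> pverts T; y \<in> pverts T; d x y = 1\<rbrakk> \<Longrightarrow> (x, y) \<in> parcs T"
  using relpow_tdist[of x y] by auto

text \<open>
  Following a shortest walk to \<open>x\<close> only meets vertices that are at most as far from \<open>x\<close> as its start.
\<close>

lemma descend:
  assumes "y \<in> pverts T" "x \<in> pverts T" "\<And>z. d z x \<le> d y x \<Longrightarrow> z \<in> pverts T \<Longrightarrow> z \<noteq> w"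
  shows "(y, x) \<in> {e \<in> parcs T. fst e \<noteq> w \<and> snd e \<noteq> w}\<^sup>*"
  using assms
proof (induction "d y x" arbitrary: y)
  case 0
  then show ?case using tdist_eq_0[of y x] by auto
next
  case (Suc n)
  have "(y, x) \<in> parcs T ^^ Suc n" using relpow_tdist[of y x] Suc by metis
  then obtain z where z: "(y, z) \<in> parcs T" "(z, x) \<in> parcs T ^^ n" by (meson relpow_Suc_E2)
  then have zV: "z \<in> pverts T" and le: "d z x \<le> n" using in_arcsD2 tdist_le by auto
  moreover have "d y x \<le> 1 + d z x"
    using tdist_triangle[of y z x] tdist_arc[OF z(1)] Suc.prems zV by auto
  ultimately have dz: "d z x = n" using Suc.hyps by linarith
  have "(z, x) \<in> {e \<in> parcs T. fst e \<noteq> w \<and> snd e \<noteq> w}\<^sup>*"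
    using Suc.hyps(1)[of z] dz zV Suc.prems Suc.hyps(2) by auto
  moreover have "y \<noteq> w" "z \<noteq> w" using Suc.prems Suc.hyps dz zV by auto
  ultimately show ?case using z(1) by (intro converse_rtrancl_into_rtrancl[of y z]) auto
qed

lemma detour_sym:
  assumes "(y, x) \<in> {e \<in> parcs T. fst e \<noteq> w \<and> snd e \<noteq> w}\<^sup>*"
  shows "(x, y) \<in> {e \<in> parcs T. fst e \<noteq> w \<and> snd e \<noteq> w}\<^sup>*"
proof -
  have "sym {e \<in> parcs T. fst e \<noteq> w \<and> snd e \<noteq> w}" using arcs_symmetric by (auto intro!: symI)
  then have "sym ({e \<in> parcs T. fst e \<noteq> w \<and> snd e \<noteq> w}\<^sup>*)" by (rule sym_rtrancl)
  then show ?thesis using assms by (rule symD)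
qed

text \<open>
  Both neighbours can reach \<open>x\<close>, and hence each other, without passing through \<open>w\<close>. Allowing equality
  for one of the distances covers also the case that two adjacent vertices are equally far from \<open>x\<close>:
  distances to a given vertex change by exactly 1 along every arc.
\<close>

lemma closer_unique:
  assumes wa: "(w, a) \<in> parcs T" and wb: "(w, b) \<in> parcs T" and x: "x \<in> pverts T"
    and le: "d a x \<le> d w x" "d b x < d w x"
  shows "a = b"
proof (rule ccontr)
  assume ne: "a \<noteq> b"
  have V: "a \<in> pverts T" "b \<in> pverts T" "w \<in> pverts T" using wa wb in_arcsD1 in_arcsD2 by auto
  have bx: "(b, x) \<in> {e \<in> parcs T. fst e \<noteq> w \<and> snd e \<noteq> w}\<^sup>*"
    using V x le by (intro descend) auto
  have ax: "(a, x) \<in> {e \<in> parcs T. fst e \<noteq> w \<and> snd e \<noteq> w}\<^sup>*"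
  proof (cases "d a x < d w x")
    case True
    then show ?thesis using V x by (intro descend) auto
  next
    case False
    \<comment> \<open>\<open>a\<close> is as far away as \<open>w\<close>: make one step toward \<open>x\<close> first.\<close>
    then have "(a, x) \<in> parcs T ^^ Suc (d a x - 1)" using le relpow_tdist[of a x] V x by auto
    then obtain z where z: "(a, z) \<in> parcs T" "(z, x) \<in> parcs T ^^ (d a x - 1)"
      by (meson relpow_Suc_E2)
    have zV: "z \<in> pverts T" using z in_arcsD2 by auto
    have lt: "d z x < d w x" using tdist_le[OF z(2)] False le by linarith
    then have "(z, x) \<in> {e \<in> parcs T. fst e \<noteq> w \<and> snd e \<noteq> w}\<^sup>*"
      using zV x by (intro descend) auto
    moreover have "a \<noteq> w" "z \<noteq> w" using pair_no_loops[OF wa] lt by auto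
    ultimately show ?thesis using z(1) by (intro converse_rtrancl_into_rtrancl[of a z]) auto
  qed
  have "(a, b) \<in> {e \<in> parcs T. fst e \<noteq> w \<and> snd e \<noteq> w}\<^sup>*"
    using ax detour_sym[OF bx] by (rule rtrancl_trans)
  then show False using no_detour[OF wa wb ne] by blast
qed

lemma toward_exists:
  assumes "y \<in> pverts T" "x \<in> pverts T" "y \<noteq> x"
  shows "\<exists>z. (y, z) \<in> parcs T \<and> d z x < d y x"
proof -
  have "d y x \<noteq> 0" using assms tdist_eq_0 by blast
  then obtain n where n: "d y x = Suc n" by (cases "d y x") auto
  then have "(y, x) \<in> parcs T ^^ Suc n" using relpow_tdist[of y x] assms by metis
  then obtain z where "(y, z) \<in> parcs T" "(z, x) \<in> parcs T ^^ n" by (meson relpow_Suc_E2)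
  then show ?thesis using tdist_le[of z x n] n by (intro exI[of _ z]) auto
qed

lemma
  assumes "y \<in> pverts T" "x \<in> pverts T" "y \<noteq> x"
  shows toward_arc: "(y, tw y x) \<in> parcs T"
    and toward_dist: "d y x = Suc (d (tw y x) x)"
proof -
  have *: "(y, tw y x) \<in> parcs T \<and> d (tw y x) x < d y x"
    unfolding toward_def using toward_exists[OF assms] by (rule someI_ex)
  then show "(y, tw y x) \<in> parcs T" by blast
  then have "d y x \<le> 1 + d (tw y x) x"
    using tdist_triangle[of y "tw y x" x] tdist_arc assms in_arcsD2 by metis
  then show "d y x = Suc (d (tw y x) x)" using * by linarith
qed

lemma toward_in_verts: "\<lbrakk>y \<in> pverts T; x \<in> pverts T; y \<noteq> x\<rbrakk> \<Longrightarrow> tw y x \<in> pverts T"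
  using toward_arc in_arcsD2 by blast

lemma toward_unique:
  "\<lbrakk>(y, z) \<in> parcs T; x \<in> pverts T; d z x \<le> d y x\<rbrakk> \<Longrightarrow> z = tw y x"
  using closer_unique[of y z "tw y x" x] toward_arc[of y x] toward_dist[of y x] in_arcsD1[of y z]
    tdist_arc[of y z] tdist_sym[of z y] in_arcsD2[of y z]
  by (cases "y = x") auto

lemma away_dist:
  assumes "(y, z) \<in> parcs T" "x \<in> pverts T" "y = x \<or> z \<noteq> tw y x"
  shows "d z x = Suc (d y x)"
proof -
  have V: "y \<in> pverts T" "z \<in> pverts T" using assms in_arcsD1 in_arcsD2 by auto
  have "d z x \<le> 1 + d y x"
    using tdist_triangle[of z y x] tdist_arc[OF assms(1)] tdist_sym[of z y] V assms by auto
  moreover have "d z x > d y x"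
    using toward_unique[OF assms(1,2)] assms(3) V assms(1) tdist_arc[OF assms(1)] tdist_sym[of z y]
    by (cases "y = x") (auto simp flip: not_le)
  ultimately show ?thesis by linarith
qed

lemma toward_of_away:
  assumes "(y, z) \<in> parcs T" "x \<in> pverts T" "y = x \<or> z \<noteq> tw y x"
  shows "tw z x = y" "z \<noteq> x"
  using toward_unique[OF arcs_symmetric[OF assms(1)] assms(2)] away_dist[OF assms]
  by auto

lemma tree_induct [consumes 2, case_names base step]:
  assumes "y \<in> pverts T" "x \<in> pverts T" "P x"
    and "\<And>y z. \<lbrakk>y \<in> pverts T; (y, z) \<in> parcs T; P y\<rbrakk> \<Longrightarrow> P z"
  shows "P y"
proof -
  have "(x, y) \<in> (parcs T)\<^sup>*" using assms reachable_all by blast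
  then show ?thesis
    by (induction rule: rtrancl_induct) (use assms in_arcsD1 in \<open>auto\<close>)
qed

lemma toward_induct [consumes 2, case_names base step]:
  assumes "y \<in> pverts T" "x \<in> pverts T" "P x"
    and "\<And>y. \<lbrakk>y \<in> pverts T; y \<noteq> x; P (tw y x)\<rbrakk> \<Longrightarrow> P y"
  shows "P y"
  using assms(1)
proof (induction "d y x" arbitrary: y)
  case 0
  then show ?case using tdist_eq_0 assms by metis
next
  case (Suc n)
  then have "y \<noteq> x" by auto
  then show ?case using Suc assms toward_in_verts toward_dist by (metis nat.inject)
qed

definition convex :: "'v set \<Rightarrow> bool" where
  "convex Y \<longleftrightarrow> Y \<subseteq> pverts T \<and> (\<forall>x \<in> Y. \<forall>y \<in> Y. y \<noteq> x \<longrightarrow> tw y x \<in> Y)"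

text \<open>
  In a tree, every walk from \<open>x\<close> to \<open>y\<close> traverses the geodesic. Stating this for walks with arcs in a
  given set \<open>R\<close> serves both to recognise subtrees and to see which arcs a connected subgraph contains.
\<close>

lemma geodesic_arc_in_walk:
  assumes R: "R \<subseteq> parcs T" and x: "x \<in> pverts T" and xy: "(x, y) \<in> R\<^sup>*" and ne: "y \<noteq> x"
  shows "(tw y x, y) \<in> R \<and> (x, tw y x) \<in> R\<^sup>*"
proof -
  \<comment> \<open>Cutting out the excursions of a walk leaves a walk that only moves away from its start.\<close>
  define R' where "R' = {(z, y) \<in> R. y \<noteq> x \<and> z = tw y x}"
  have "(x, y) \<in> R'\<^sup>*" using xy
  proof (induction rule: rtrancl_induct)
    case (step y z)
    have yz: "(y, z) \<in> parcs T" using R step by auto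
    show ?case
    proof (cases "y \<noteq> x \<and> z = tw y x")
      case True
      then show ?thesis using step.IH by (auto simp: R'_def elim: rtranclE)
    next
      case False
      then have "tw z x = y" "z \<noteq> x" using toward_of_away[of y z x] x yz by auto
      then have "(y, z) \<in> R'" using step.hyps by (auto simp: R'_def)
      then show ?thesis using step.IH by (rule rtrancl_into_rtrancl[rotated])
    qed
  qed auto
  then obtain z where "(x, z) \<in> R'\<^sup>*" "(z, y) \<in> R'" using ne by (auto elim: rtranclE)
  moreover have "R'\<^sup>* \<subseteq> R\<^sup>*" by (rule rtrancl_mono) (auto simp: R'_def)
  ultimately show ?thesis by (auto simp: R'_def)
qed

lemma convex_reachable:
  assumes R: "R \<subseteq> parcs T" "sym R" and v: "v \<in> pverts T"
  shows "convex {y. (v, y) \<in> R\<^sup>*}"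
  unfolding convex_def
proof (intro conjI ballI impI)
  show sub: "{y. (v, y) \<in> R\<^sup>*} \<subseteq> pverts T"
  proof
    fix y assume "y \<in> {y. (v, y) \<in> R\<^sup>*}"
    then show "y \<in> pverts T" using v R in_arcsD2 by (auto elim: rtranclE)
  qed
  fix x y assume xy: "x \<in> {y. (v, y) \<in> R\<^sup>*}" "y \<in> {y. (v, y) \<in> R\<^sup>*}" "y \<noteq> x"
  have "(x, v) \<in> R\<^sup>*" using xy sym_rtrancl[OF R(2)] by (auto dest: symD)
  then have "(x, y) \<in> R\<^sup>*" using xy by (auto intro: rtrancl_trans)
  then have "(x, toward T y x) \<in> R\<^sup>*" using geodesic_arc_in_walk[OF R(1)] xy sub by blast
  then show "toward T y x \<in> {y. (v, y) \<in> R\<^sup>*}" using xy by (auto intro: rtrancl_trans)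
qed

lemma convexD: "\<lbrakk>convex Y; x \<in> Y; y \<in> Y; y \<noteq> x\<rbrakk> \<Longrightarrow> tw y x \<in> Y"
  and convex_sub: "convex Y \<Longrightarrow> Y \<subseteq> pverts T"
  by (auto simp: convex_def)

lemma convex_connected:
  assumes "convex Y" "x \<in> Y" "y \<in> Y"
  shows "(x, y) \<in> (parcs T \<inter> Y \<times> Y)\<^sup>*"
proof -
  have "y \<in> Y \<longrightarrow> (x, y) \<in> (parcs T \<inter> Y \<times> Y)\<^sup>*"
    if "y \<in> pverts T" "x \<in> pverts T" for y using that
  proof (induction rule: toward_induct)
    case (step y)
    show ?case
    proof
      assume y: "y \<in> Y"
      then have t: "tw y x \<in> Y" using assms convexD step by blast
      have "(tw y x, y) \<in> parcs T \<inter> Y \<times> Y"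
        using t y toward_arc[of y x] step that arcs_symmetric assms convex_sub by blast
      then show "(x, y) \<in> (parcs T \<inter> Y \<times> Y)\<^sup>*" using step t by (meson rtrancl.rtrancl_into_rtrancl)
    qed
  qed auto
  then show ?thesis using assms convex_sub by blast
qed

lemma toward_adjacent:
  assumes "(y, z) \<in> parcs T" "w \<in> pverts T" "w \<noteq> y" "w \<noteq> z"
  shows "tw w y = tw w z"
proof -
  have *: "tw w y = tw w z" if yz: "(y, z) \<in> parcs T" "w \<noteq> y" "w \<noteq> z" "d w z = Suc (d w y)" for y z
  proof (rule toward_unique)
    have V: "y \<in> pverts T" "z \<in> pverts T" using yz in_arcsD1 in_arcsD2 by auto
    let ?a = "tw w y"
    show "(w, ?a) \<in> parcs T" using toward_arc V that assms by blast
    show "z \<in> pverts T" by fact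
    have aV: "?a \<in> pverts T" using toward_in_verts V that assms by blast
    have "d ?a z \<le> d ?a y + d y z" using tdist_triangle aV V by blast
    also have "\<dots> = d w y" using toward_dist[of w y] V assms that tdist_arc by auto
    finally show "d ?a z \<le> d w z" using that by simp
  qed
  have V: "y \<in> pverts T" "z \<in> pverts T" using assms in_arcsD1 in_arcsD2 by auto
  show ?thesis
  proof (cases "z = tw y w")
    case True
    then have "d y w = Suc (d z w)" using toward_dist V assms by metis
    then show ?thesis using *[of z y] arcs_symmetric assms tdist_sym V by metis
  next
    case False
    then have "d z w = Suc (d y w)" using away_dist[OF assms(1,2)] by blast
    then show ?thesis using *[of y z] assms tdist_sym V by metis
  qed
qed

text \<open>
  The vertices of \<open>Y\<close> are connected by arcs that do not contain \<open>w\<close>, and along such an arc the direction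
  in which \<open>w\<close> sees the vertices does not change.
\<close>

lemma toward_convex:
  assumes Y: "convex Y" and w: "w \<in> pverts T" "w \<notin> Y" and xy: "x \<in> Y" "y \<in> Y"
  shows "tw w x = tw w y"
  using convex_connected[OF Y xy]
proof (induction rule: rtrancl_induct)
  case (step y z)
  then show ?case using toward_adjacent[of y z w] w by auto
qed auto

text \<open>
  The geodesic from \<open>x\<close> to \<open>y\<close> passes through \<open>w\<close> if \<open>w\<close> sees \<open>x\<close> and \<open>y\<close> in different directions; shown by
  moving \<open>w\<close> toward \<open>x\<close>, which keeps \<open>y\<close> behind it.
\<close>

lemma tdist_branch:
  assumes "w \<in> pverts T" "x \<in> pverts T" "y \<in> pverts T" "x = w \<or> y = w \<or> tw w x \<noteq> tw w y"
  shows "d x y = d x w + d w y"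
  using assms
proof (induction "d w x" arbitrary: w)
  case 0
  then show ?case using tdist_eq_0 by auto
next
  case (Suc n)
  have wx: "w \<noteq> x" using Suc by auto
  show ?case
  proof (cases "y = w")
    case True
    then show ?thesis by simp
  next
    case False
    let ?v = "tw w x"
    have v: "?v \<in> pverts T" "(w, ?v) \<in> parcs T" using toward_in_verts toward_arc Suc.prems wx by auto
    have ne: "?v \<noteq> tw w y" using wx False Suc.prems by auto
    have dx: "d w x = Suc (d ?v x)" using toward_dist Suc.prems wx by blast
    have dy: "d ?v y = Suc (d w y)" "tw ?v y = w" "?v \<noteq> y"
      using away_dist[OF v(2)] toward_of_away[OF v(2)] ne Suc.prems by auto
    have "x = ?v \<or> y = ?v \<or> tw ?v x \<noteq> tw ?v y"
    proof (cases "x = ?v")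
      case False
      have "d ?v x = Suc (d (tw ?v x) x)" using toward_dist[of ?v x] False v Suc.prems by auto
      then show ?thesis using dx dy(2) by (metis Suc_n_not_le_n le_SucI order_refl)
    qed auto
    then have "d x y = d x ?v + d ?v y" using Suc.hyps(1)[of ?v] dx Suc.hyps(2) v Suc.prems by auto
    then show ?thesis using dx dy tdist_sym Suc.prems v by (metis add_Suc add_Suc_right)
  qed
qed

lemma arc_cases:
  assumes "(x, y) \<in> parcs T" "v \<in> pverts T"
  obtains "x \<noteq> v" "y = tw x v" | "y \<noteq> v" "x = tw y v"
  using toward_of_away[OF assms] by metis

end

subsection \<open>Isometries\<close>

lemma (in simplicial_tree) path_dist_eq_tdist:
  assumes "x \<in> pverts T" "y \<in> pverts T"
  shows "path_dist T x y = ereal (real (tdist T x y))"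
proof -
  have cost: "awalk_cost (\<lambda>_. 1) p = real (length p)" for p :: "('v \<times> 'v) list"
    by (induction p) auto
  have 1: "awalk u p v \<Longrightarrow> (u, v) \<in> parcs T ^^ length p" for u p v
  proof (induction p arbitrary: u)
    case (Cons e p)
    then show ?case
      by (cases e) (auto simp: awalk_Cons_iff simp del: relpow.simps intro: relpow_Suc_I2)
  qed (auto simp: awalk_Nil_iff)
  have 2: "(u, v) \<in> parcs T ^^ n \<Longrightarrow> v \<in> pverts T \<Longrightarrow> \<exists>p. awalk u p v \<and> length p = n" for u v n
  proof (induction n arbitrary: u)
    case (Suc n)
    then obtain z where z: "(u, z) \<in> parcs T" "(z, v) \<in> parcs T ^^ n" by (meson relpow_Suc_E2)
    then obtain p where "awalk z p v" "length p = n" using Suc by blast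
    then show ?case using z in_arcsD1 by (intro exI[of _ "(u, z) # p"]) (auto simp: awalk_Cons_iff)
  qed (auto simp: awalk_Nil_iff)
  show ?thesis unfolding path_dist_def \<mu>_def cost
  proof (rule antisym)
    obtain p where "awalk x p y" "length p = tdist T x y" using 2 relpow_tdist assms by blast
    then show "(INF p\<in>{p. awalk x p y}. ereal (real (length p))) \<le> ereal (real (tdist T x y))"
      by (intro INF_lower2[of p]) auto
    show "ereal (real (tdist T x y)) \<le> (INF p\<in>{p. awalk x p y}. ereal (real (length p)))"
      using 1 tdist_le by (intro INF_greatest) auto
  qed
qed

locale tree_automorphism = simplicial_tree T for T :: "'v pair_pre_digraph" +
  fixes f :: "'v \<Rightarrow> 'v"
  assumes bij: "bij_betw f (pverts T) (pverts T)"
    and arc: "(x, y) \<in> parcs T \<Longrightarrow> (f x, f y) \<in> parcs T"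
    and arc_rev: "\<lbrakk>x \<in> pverts T; y \<in> pverts T; (f x, f y) \<in> parcs T\<rbrakk> \<Longrightarrow> (x, y) \<in> parcs T"
begin

lemma in_verts: "x \<in> pverts T \<Longrightarrow> f x \<in> pverts T"
  using bij by (auto dest: bij_betwE)

lemma f_eq_iff: "\<lbrakk>x \<in> pverts T; y \<in> pverts T\<rbrakk> \<Longrightarrow> f x = f y \<longleftrightarrow> x = y"
  using bij by (auto simp: bij_betw_def inj_on_def)

lemma preimage: "y \<in> pverts T \<Longrightarrow> \<exists>x \<in> pverts T. f x = y"
  using bij by (metis bij_betw_imp_surj_on imageE)

lemma tdist_f:
  assumes "x \<in> pverts T" "y \<in> pverts T"
  shows "tdist T (f x) (f y) = tdist T x y"
proof -
  have 1: "(x, y) \<in> parcs T ^^ n \<Longrightarrow> (f x, f y) \<in> parcs T ^^ n" for n x y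
  proof (induction n arbitrary: y)
    case (Suc n)
    then obtain z where z: "(x, z) \<in> parcs T ^^ n" "(z, y) \<in> parcs T" by auto
    have "(f x, f z) \<in> parcs T ^^ n" "(f z, f y) \<in> parcs T" using Suc.IH z arc by blast+
    then show ?case by (rule relpow_Suc_I)
  qed simp
  have 2: "(f x, f y) \<in> parcs T ^^ n \<Longrightarrow> (x, y) \<in> parcs T ^^ n"
    if "x \<in> pverts T" "y \<in> pverts T" for n x y using that
  proof (induction n arbitrary: y)
    case (Suc n)
    then obtain z where z: "(f x, z) \<in> parcs T ^^ n" "(z, f y) \<in> parcs T" by auto
    then obtain z' where z': "z' \<in> pverts T" "f z' = z" using preimage in_arcsD1 by blast
    then show ?case using Suc z arc_rev by auto
  qed (auto simp: f_eq_iff)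
  show ?thesis
    using 1 2 assms relpow_tdist tdist_le in_verts by (meson le_antisym)
qed

lemma toward_f:
  assumes "x \<in> pverts T" "y \<in> pverts T" "y \<noteq> x"
  shows "f (toward T y x) = toward T (f y) (f x)"
proof (rule toward_unique)
  have *: "toward T y x \<in> pverts T" "(y, toward T y x) \<in> parcs T"
    using toward_in_verts toward_arc assms by auto
  then show "(f y, f (toward T y x)) \<in> parcs T" by (blast intro: arc)
  show "f x \<in> pverts T" using assms in_verts by blast
  show "tdist T (f (toward T y x)) (f x) \<le> tdist T (f y) (f x)"
    using tdist_f[of "toward T y x" x] tdist_f[of y x] * assms toward_dist[of y x] by auto
qed

lemma convex_fixed: "convex {x \<in> pverts T. f x = x}"
  unfolding convex_def using toward_f toward_in_verts by auto

end

lemma (in simplicial_tree) tree_isometry_iff: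
  "tree_isometry T f \<longleftrightarrow> tree_automorphism T f"
proof
  assume f: "tree_isometry T f"
  then have bij: "bij_betw f (pverts T) (pverts T)" by (simp add: tree_isometry_def)
  then have V: "x \<in> pverts T \<Longrightarrow> f x \<in> pverts T" for x by (auto dest: bij_betwE)
  have td: "tdist T (f x) (f y) = tdist T x y" if "x \<in> pverts T" "y \<in> pverts T" for x y
    using f that V unfolding tree_isometry_def by (auto simp: path_dist_eq_tdist)
  show "tree_automorphism T f"
  proof
    show "bij_betw f (pverts T) (pverts T)" by fact
    show "(f x, f y) \<in> parcs T" if "(x, y) \<in> parcs T" for x y
      using that td V tdist_arc arc_if_tdist in_arcsD1 in_arcsD2 by metis
    show "(x, y) \<in> parcs T" if "x \<in> pverts T" "y \<in> pverts T" "(f x, f y) \<in> parcs T" for x y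
      using that td V tdist_arc arc_if_tdist by metis
  qed
next
  assume "tree_automorphism T f"
  then interpret tree_automorphism T f .
  show "tree_isometry T f"
    unfolding tree_isometry_def using bij tdist_f in_verts by (auto simp: path_dist_eq_tdist)
qed

section \<open>Infinite cyclic stabilisers and the modular homomorphism\<close>

subsection \<open>Conjugation and infinite cyclic subgroups\<close>

context group
begin

definition conj :: "'a \<Rightarrow> 'a \<Rightarrow> 'a" where
  "conj g x = g \<otimes> x \<otimes> inv g"

lemma inv_mult_cancel [simp]:
  "\<lbrakk>a \<in> carrier G; b \<in> carrier G\<rbrakk> \<Longrightarrow> inv a \<otimes> (a \<otimes> b) = b"
  "\<lbrakk>a \<in> carrier G; b \<in> carrier G\<rbrakk> \<Longrightarrow> a \<otimes> (inv a \<otimes> b) = b"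
  by (simp_all flip: m_assoc)

lemma conj_closed [simp]: "\<lbrakk>g \<in> carrier G; x \<in> carrier G\<rbrakk> \<Longrightarrow> conj g x \<in> carrier G"
  by (simp add: conj_def)

lemma conj_mult:
  "\<lbrakk>g \<in> carrier G; x \<in> carrier G; y \<in> carrier G\<rbrakk> \<Longrightarrow> conj g (x \<otimes> y) = conj g x \<otimes> conj g y"
  by (simp add: conj_def m_assoc)

lemma conj_conj:
  "\<lbrakk>g \<in> carrier G; h \<in> carrier G; x \<in> carrier G\<rbrakk> \<Longrightarrow> conj g (conj h x) = conj (g \<otimes> h) x"
  by (simp add: conj_def m_assoc inv_mult_group)

lemma conj_one_left [simp]: "x \<in> carrier G \<Longrightarrow> conj \<one> x = x"
  by (simp add: conj_def)

lemma conj_one_right [simp]: "g \<in> carrier G \<Longrightarrow> conj g \<one> = \<one>"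
  by (simp add: conj_def)

lemma conj_inv: "\<lbrakk>g \<in> carrier G; x \<in> carrier G\<rbrakk> \<Longrightarrow> conj g (inv x) = inv (conj g x)"
  by (simp add: conj_def m_assoc inv_mult_group)

lemma conj_inv_left:
  "\<lbrakk>g \<in> carrier G; x \<in> carrier G; y \<in> carrier G\<rbrakk> \<Longrightarrow> conj (inv g) x = y \<longleftrightarrow> x = conj g y"
  by (auto simp: conj_conj)

lemma conj_eq_self: "\<lbrakk>g \<in> carrier G; x \<in> carrier G\<rbrakk> \<Longrightarrow> conj g x = x \<longleftrightarrow> g \<otimes> x = x \<otimes> g"
  unfolding conj_def by (metis inv_closed inv_solve_right m_closed)

lemma conj_hom: "g \<in> carrier G \<Longrightarrow> group_hom G G (conj g)"
  by unfold_locales (auto simp: hom_def conj_mult)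

lemma conj_pow:
  fixes n :: int
  assumes "g \<in> carrier G" "x \<in> carrier G"
  shows "conj g (x [^] n) = conj g x [^] n"
proof -
  interpret group_hom G G "conj g" by (rule conj_hom) fact
  show ?thesis using assms by (simp add: hom_int_pow)
qed

lemma infinite_cyclic_generator:
  assumes H: "subgroup H G" and cyc: "infinite_cyclic G H"
  shows "\<exists>a \<in> carrier G. H = range (\<lambda>i :: int. a [^] i) \<and> (\<forall>i :: int. a [^] i = \<one> \<longrightarrow> i = 0)"
proof -
  have gH: "group (G\<lparr>carrier := H\<rparr>)" using H subgroup.subgroup_is_group is_group by blast
  have "integer_group \<cong> G\<lparr>carrier := H\<rparr>"
    using cyc group.iso_sym[OF gH] unfolding infinite_cyclic_def by blast
  then obtain k where k: "k \<in> iso integer_group (G\<lparr>carrier := H\<rparr>)" by (auto simp: is_iso_def)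
  then interpret k: group_hom integer_group "G\<lparr>carrier := H\<rparr>" k
    using gH by (auto simp: group_hom_def group_hom_axioms_def iso_def)
  have k1: "k 1 \<in> H" using k by (auto simp: iso_def bij_betw_def)
  have kp: "k i = k 1 [^] i" for i :: int
  proof -
    have "k (1 [^]\<^bsub>integer_group\<^esub> i) = k 1 [^]\<^bsub>G\<lparr>carrier := H\<rparr>\<^esub> i" by (rule k.hom_int_pow) simp
    then show ?thesis using int_pow_consistent[OF H k1] by simp
  qed
  have inj: "inj k" and ran: "H = range k" using k by (auto simp: iso_def bij_betw_def)
  have "H = range (\<lambda>i :: int. k 1 [^] i)" unfolding ran using kp by (intro image_cong refl) blast
  moreover have "i = 0" if "k 1 [^] i = \<one>" for i :: int
    using that kp[of i] k.hom_one injD[OF inj, of i 0] by simp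
  moreover have "k 1 \<in> carrier G" using k1 subgroup.subset[OF H] by blast
  ultimately show ?thesis by blast
qed

end

locale gbs = gbs_system G T act
  for G :: "('g, 'm) monoid_scheme" (structure) and T :: "'v pair_pre_digraph" and act :: "'g \<Rightarrow> 'v \<Rightarrow> 'v"
begin

sublocale group G
  using group_hom group_hom.axioms(1) by blast

abbreviation Stab :: "'v \<Rightarrow> 'g set" where
  "Stab \<equiv> stabilizer G act"

abbreviation V :: "'v set" where
  "V \<equiv> pverts T"

lemma act_closed [simp]: "\<lbrakk>g \<in> carrier G; x \<in> V\<rbrakk> \<Longrightarrow> act g x \<in> V"
  using element_image by blast

lemma act_one [simp]: "x \<in> V \<Longrightarrow> act \<one> x = x"
  using id_eq_one by (metis restrict_apply')

lemma act_mult: "\<lbrakk>g \<in> carrier G; h \<in> carrier G; x \<in> V\<rbrakk> \<Longrightarrow> act (g \<otimes> h) x = act g (act h x)"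
  using composition_rule by blast

lemma act_inv [simp]:
  "\<lbrakk>g \<in> carrier G; x \<in> V\<rbrakk> \<Longrightarrow> act (inv g) (act g x) = x"
  "\<lbrakk>g \<in> carrier G; x \<in> V\<rbrakk> \<Longrightarrow> act g (act (inv g) x) = x"
  by (simp_all flip: act_mult)

lemma act_inv_eq: "\<lbrakk>g \<in> carrier G; x \<in> V; y \<in> V\<rbrakk> \<Longrightarrow> act (inv g) x = y \<longleftrightarrow> x = act g y"
  by auto

lemma act_eq_iff [simp]: "\<lbrakk>g \<in> carrier G; x \<in> V; y \<in> V\<rbrakk> \<Longrightarrow> act g x = act g y \<longleftrightarrow> x = y"
  by (metis act_inv(1))

lemma act_arc_iff: "\<lbrakk>g \<in> carrier G; x \<in> V; y \<in> V\<rbrakk> \<Longrightarrow> (act g x, act g y) \<in> parcs T \<longleftrightarrow> (x, y) \<in> parcs T"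
  using act_arc[of g x y] act_arc[of "inv g" "act g x" "act g y"] by auto

lemma act_automorphism: "g \<in> carrier G \<Longrightarrow> tree_automorphism T (act g)"
proof
  show "g \<in> carrier G \<Longrightarrow> bij_betw (act g) V V"
    by (simp add: bij_betw_def inj_prop surj_prop)
qed (auto simp: act_arc_iff intro: act_arc)

lemmas act_toward = tree_automorphism.toward_f[OF act_automorphism]
  and act_tdist = tree_automorphism.tdist_f[OF act_automorphism]

lemma arc_verts: "(x, y) \<in> parcs T \<Longrightarrow> x \<in> V" "(x, y) \<in> parcs T \<Longrightarrow> y \<in> V"
  using in_arcsD1 in_arcsD2 by auto

lemma Stab_iff: "g \<in> Stab x \<longleftrightarrow> g \<in> carrier G \<and> act g x = x"
  by (auto simp: stabilizer_def)

lemma Stab_closed: "g \<in> Stab x \<Longrightarrow> g \<in> carrier G"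
  by (simp add: Stab_iff)

lemma Stab_subgroup: "x \<in> V \<Longrightarrow> subgroup (Stab x) G"
  by (rule stabilizer_subgroup)

lemma conj_Stab_iff:
  "\<lbrakk>g \<in> carrier G; x \<in> V; h \<in> carrier G\<rbrakk> \<Longrightarrow> conj g h \<in> Stab (act g x) \<longleftrightarrow> h \<in> Stab x"
  by (simp add: Stab_iff conj_def act_mult)

lemma conj_inv_Stab_iff:
  "\<lbrakk>g \<in> carrier G; x \<in> V; h \<in> carrier G\<rbrakk> \<Longrightarrow> conj (inv g) h \<in> Stab x \<longleftrightarrow> h \<in> Stab (act g x)"
  using conj_Stab_iff[of "inv g" "act g x" h] by simp

text \<open>
  Setwise and pointwise stabilisers of an edge agree because there are no inversions.
\<close>

lemma edge_stabilizer_eq: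
  assumes "(x, y) \<in> parcs T"
  shows "stabilizer G (edge_action act) {x, y} = Stab x \<inter> Stab y"
  using no_inversion[OF _ assms] by (auto simp: stabilizer_def edge_action_def doubleton_eq_iff)

subsection \<open>Generators of stabilisers\<close>

definition gen :: "'v \<Rightarrow> 'g" where
  "gen x = (SOME a. a \<in> carrier G \<and> Stab x = range (\<lambda>i :: int. a [^] i) \<and>
    (\<forall>i :: int. a [^] i = \<one> \<longrightarrow> i = 0))"

lemma gen:
  assumes "x \<in> V"
  shows gen_closed [simp]: "gen x \<in> carrier G"
    and Stab_eq: "Stab x = range (\<lambda>i :: int. gen x [^] i)"
    and gen_pow_one [simp]: "gen x [^] (i :: int) = \<one> \<longleftrightarrow> i = 0"
proof -
  have *: "gen x \<in> carrier G \<and> Stab x = range (\<lambda>i :: int. gen x [^] i) \<and>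
    (\<forall>i :: int. gen x [^] i = \<one> \<longrightarrow> i = 0)"
    using someI_ex[OF infinite_cyclic_generator[OF Stab_subgroup[OF assms]
          vertex_stabilizer[OF assms], unfolded Bex_def], folded gen_def] .
  show "gen x \<in> carrier G" using * by (rule conjunct1)
  show "Stab x = range (\<lambda>i :: int. gen x [^] i)" using * by (elim conjE)
  have "\<forall>i :: int. gen x [^] i = \<one> \<longrightarrow> i = 0" using * by (elim conjE)
  then show "gen x [^] (i :: int) = \<one> \<longleftrightarrow> i = 0" using int_pow_0 by metis
qed

lemma gen_pow_eq [simp]:
  assumes "x \<in> V"
  shows "gen x [^] (i :: int) = gen x [^] j \<longleftrightarrow> i = j"
proof
  assume "gen x [^] i = gen x [^] j"
  then have "gen x [^] (i - j) = \<one>" using assms by (simp add: int_pow_diff)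
  then show "i = j" using assms by simp
qed auto

lemma gen_pow_Stab [simp]: "x \<in> V \<Longrightarrow> gen x [^] (i :: int) \<in> Stab x"
  by (simp add: Stab_eq)

lemma Stab_commute: "\<lbrakk>x \<in> V; a \<in> Stab x; b \<in> Stab x\<rbrakk> \<Longrightarrow> a \<otimes> b = b \<otimes> a"
proof -
  assume x: "x \<in> V" and "a \<in> Stab x" "b \<in> Stab x"
  then obtain i j :: int where "a = gen x [^] i" "b = gen x [^] j" using Stab_eq by auto
  then show "a \<otimes> b = b \<otimes> a" using x int_pow_mult[of "gen x"] by (metis add.commute gen_closed)
qed

lemma Stab_pow: "\<lbrakk>x \<in> V; a \<in> Stab x\<rbrakk> \<Longrightarrow> a [^] (i :: int) \<in> Stab x"
  by (auto simp: Stab_eq int_pow_pow)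

text \<open>
  Along an arc stabilisers are commensurable, since an edge stabiliser is nontrivial inside an infinite
  cyclic group. By connectedness this propagates to all pairs of vertices.
\<close>

lemma arc_common_power:
  assumes xy: "(x, y) \<in> parcs T"
  shows "\<exists>n :: int. n \<noteq> 0 \<and> gen x [^] n \<in> Stab y"
proof -
  have V: "x \<in> V" "y \<in> V" using arc_verts[OF xy] by auto
  have sub: "subgroup (Stab x \<inter> Stab y) G" using Stab_subgroup V by (intro subgroups_Inter_pair) auto
  have "{x, y} \<in> undirected_edges T" using xy by (auto simp: undirected_edges_def)
  then have "infinite_cyclic G (Stab x \<inter> Stab y)"
    using edge_stabilizer edge_stabilizer_eq[OF xy] by metis
  then obtain a where a: "a \<in> carrier G" "Stab x \<inter> Stab y = range (\<lambda>i :: int. a [^] i)"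
    "\<And>i :: int. a [^] i = \<one> \<Longrightarrow> i = 0"
    using infinite_cyclic_generator[OF sub] by blast
  have "a [^] (1 :: int) \<in> Stab x \<inter> Stab y" using a by blast
  then have aS: "a \<in> Stab x \<inter> Stab y" using a by simp
  have "a \<noteq> \<one>" using a(3)[of 1] a(1) by auto
  moreover obtain n :: int where "a = gen x [^] n" using aS Stab_eq V by auto
  ultimately show ?thesis using aS V by (intro exI[of _ n]) auto
qed

lemma common_power:
  assumes "x \<in> V" "y \<in> V"
  obtains m n :: int where "m \<noteq> 0" "n \<noteq> 0" "gen x [^] m = gen y [^] n"
proof -
  have "\<exists>(n :: int) (m :: int). n \<noteq> 0 \<and> m \<noteq> 0 \<and> gen x [^] m = gen y [^] n"
    using assms(2,1)
  proof (induction rule: tree_induct)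
    case base
    show ?case by (intro exI[of _ 1]) auto
  next
    case (step y z)
    have V: "y \<in> V" "z \<in> V" using step arc_verts by auto
    obtain n m :: int where nm: "n \<noteq> 0" "m \<noteq> 0" "gen x [^] m = gen y [^] n" using step by blast
    obtain k :: int where k: "k \<noteq> 0" "gen y [^] k \<in> Stab z" using arc_common_power step by blast
    then obtain l :: int where l: "gen y [^] k = gen z [^] l" using Stab_eq V by auto
    have "l \<noteq> 0" using l k V gen_pow_one[of y k] by auto
    have "gen x [^] (m * k) = (gen x [^] m) [^] k" using assms by (simp add: int_pow_pow)
    also have "\<dots> = (gen y [^] k) [^] n" using V by (simp add: nm(3) int_pow_pow mult.commute)
    also have "\<dots> = gen z [^] (l * n)" using V by (simp add: l int_pow_pow)
    finally show ?case using nm k \<open>l \<noteq> 0\<close> by (intro exI[of _ "l * n"] exI[of _ "m * k"]) auto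
  qed
  then show ?thesis using that by blast
qed

lemma gen_pow_common:
  assumes "x \<in> V" "y \<in> V"
  obtains n :: int where "n \<noteq> 0" "gen x [^] n \<in> Stab y"
  using common_power[OF assms] assms gen_pow_Stab by metis

subsection \<open>The modular homomorphism\<close>

abbreviation \<Delta> :: "'g \<Rightarrow> rat" where
  "\<Delta> \<equiv> modular_hom G T act"

lemma conj_gen_ex:
  assumes g: "g \<in> carrier G" and x: "x \<in> V"
  obtains p q :: int where "p \<noteq> 0" "q \<noteq> 0" "conj g (gen x [^] p) = gen x [^] q"
proof -
  have gx: "act g x \<in> V" using g x by simp
  then obtain q :: int where q: "q \<noteq> 0" "gen x [^] q \<in> Stab (act g x)" using gen_pow_common x by metis
  then have "conj (inv g) (gen x [^] q) \<in> Stab x" using g x by (simp add: conj_inv_Stab_iff)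
  then obtain p :: int where p: "conj (inv g) (gen x [^] q) = gen x [^] p" using Stab_eq x by auto
  then have c: "gen x [^] q = conj g (gen x [^] p)" using g x by (simp add: conj_inv_left)
  then have "p \<noteq> 0" using q g x by (metis conj_one_right gen_pow_one int_pow_0)
  then show ?thesis using that q c by metis
qed

text \<open>
  Independence of the choices in the modular homomorphism: \<open>x\<close> and \<open>y\<close> have a common nontrivial power,
  and conjugating one further power of it in two ways compares the ratios.
\<close>

lemma conj_ratio_unique:
  assumes g: "g \<in> carrier G" and v: "v \<in> V" "w \<in> V"
    and x: "x \<in> Stab v" "x \<noteq> \<one>" and y: "y \<in> Stab w" "y \<noteq> \<one>"
    and p: "conj g (x [^] p) = x [^] q" and q: "conj g (y [^] p') = y [^] (q' :: int)"
  shows "p * q' = p' * (q :: int)"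
proof -
  obtain a :: int where a: "x = gen v [^] a" using x Stab_eq v by auto
  obtain b :: int where b: "y = gen w [^] b" using y Stab_eq v by auto
  obtain m n :: int where mn: "m \<noteq> 0" "n \<noteq> 0" "gen v [^] m = gen w [^] n" using common_power v by blast
  have C: "x \<in> carrier G" "y \<in> carrier G" using a b v by auto
  have ab: "a \<noteq> 0" "b \<noteq> 0" using a b x y by auto
  have "x [^] (b * m) = y [^] (n * a)"
  proof -
    have "x [^] (b * m) = (gen v [^] m) [^] (a * b)" using v by (simp add: a int_pow_pow mult_ac)
    also have "\<dots> = y [^] (n * a)" using v by (simp add: b mn int_pow_pow mult_ac)
    finally show ?thesis .
  qed
  then obtain i j :: int where ij: "i \<noteq> 0" "x [^] i = y [^] j" "j \<noteq> 0" using ab mn by (metis mult_eq_0_iff)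
  have "x [^] (i * q * p') = conj g (x [^] p) [^] (i * p')" using C by (simp add: p int_pow_pow mult_ac)
  also have "\<dots> = conj g ((x [^] i) [^] (p * p'))" using C g by (simp add: int_pow_pow mult_ac flip: conj_pow)
  also have "\<dots> = conj g (y [^] p') [^] (j * p)" using C g by (simp add: ij int_pow_pow mult_ac flip: conj_pow)
  also have "\<dots> = (x [^] i) [^] (p * q')" using C by (simp add: q ij int_pow_pow mult_ac)
  also have "\<dots> = x [^] (i * p * q')" using C by (simp add: int_pow_pow mult_ac)
  finally have "gen v [^] (a * (i * q * p')) = gen v [^] (a * (i * p * q'))"
    using v by (simp add: a int_pow_pow)
  then have "a * (i * q * p') = a * (i * p * q')" using v by simp
  then show ?thesis using ab ij by (simp add: mult.commute)
qed

lemma modular_eqI: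
  assumes g: "g \<in> carrier G" and v: "v \<in> V" and x: "x \<in> Stab v" "x \<noteq> \<one>"
    and pq: "p \<noteq> 0" "q \<noteq> 0" "conj g (x [^] p) = x [^] (q :: int)"
  shows "\<Delta> g = of_int p / of_int q"
  unfolding modular_hom_def
proof (rule the_equality)
  show "\<exists>v\<in>V. \<exists>x\<in>Stab v - {\<one>}. \<exists>p' q' :: int. p' \<noteq> 0 \<and> q' \<noteq> 0 \<and>
      g \<otimes> x [^] p' \<otimes> inv g = x [^] q' \<and> of_int p / of_int q = of_int p' / (of_int q' :: rat)"
    using assms unfolding conj_def by blast
next
  fix r :: rat
  assume "\<exists>v\<in>V. \<exists>x\<in>Stab v - {\<one>}. \<exists>p q :: int. p \<noteq> 0 \<and> q \<noteq> 0 \<and>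
      g \<otimes> x [^] p \<otimes> inv g = x [^] q \<and> r = of_int p / of_int q"
  then obtain w y p' q' where y: "w \<in> V" "y \<in> Stab w" "y \<noteq> \<one>" "p' \<noteq> 0" "q' \<noteq> 0"
    "conj g (y [^] p') = y [^] (q' :: int)" "r = of_int p' / of_int q'"
    unfolding conj_def by blast
  have "p * q' = p' * q" using conj_ratio_unique[OF g v y(1) x y(2,3) pq(3) y(6)] .
  then have "of_int p * of_int q' = of_int p' * (of_int q :: rat)" by (metis of_int_mult)
  then show "r = of_int p / of_int q" using y pq by (simp add: frac_eq_eq)
qed

lemma modular_gen_eqI:
  "\<lbrakk>g \<in> carrier G; v \<in> V; p \<noteq> 0; q \<noteq> 0; conj g (gen v [^] p) = gen v [^] (q :: int)\<rbrakk>
    \<Longrightarrow> \<Delta> g = of_int p / of_int q"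
  using modular_eqI[of g v "gen v" p q] gen_pow_Stab[of v 1] gen_pow_one[of v 1] by auto

lemma modular_nonzero:
  assumes "g \<in> carrier G"
  shows "\<Delta> g \<noteq> 0"
proof -
  obtain v where v: "v \<in> V" using pverts_nonempty by blast
  obtain p q :: int where pq: "p \<noteq> 0" "q \<noteq> 0" "conj g (gen v [^] p) = gen v [^] q"
    using conj_gen_ex assms v by blast
  then show ?thesis using modular_gen_eqI[OF assms v pq] by simp
qed

lemma modular_mult:
  assumes "g \<in> carrier G" "h \<in> carrier G"
  shows "\<Delta> (g \<otimes> h) = \<Delta> g * \<Delta> h"
proof -
  obtain v where v: "v \<in> V" using pverts_nonempty by blast
  obtain p q :: int where 1: "p \<noteq> 0" "q \<noteq> 0" "conj g (gen v [^] p) = gen v [^] q"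
    using conj_gen_ex assms v by blast
  obtain p' q' :: int where 2: "p' \<noteq> 0" "q' \<noteq> 0" "conj h (gen v [^] p') = gen v [^] q'"
    using conj_gen_ex assms v by blast
  have "conj (g \<otimes> h) (gen v [^] (p' * p)) = conj g (conj h (gen v [^] p') [^] p)"
    using assms v by (simp add: conj_conj flip: conj_pow int_pow_pow)
  also have "\<dots> = conj g (gen v [^] p) [^] q'"
    using assms v by (simp add: 2 int_pow_pow mult.commute flip: conj_pow)
  also have "\<dots> = gen v [^] (q * q')" using v by (simp add: 1 int_pow_pow)
  finally have "\<Delta> (g \<otimes> h) = of_int (p' * p) / of_int (q * q')"
    using assms v 1 2 by (intro modular_gen_eqI) auto
  also have "\<dots> = \<Delta> g * \<Delta> h"
    using modular_gen_eqI[OF _ v 1] modular_gen_eqI[OF _ v 2] assms by simp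
  finally show ?thesis .
qed

lemma modular_Stab:
  assumes "v \<in> V" "g \<in> Stab v"
  shows "\<Delta> g = 1"
proof -
  have "conj g (gen v [^] (1 :: int)) = gen v [^] (1 :: int)"
    using Stab_commute[OF assms gen_pow_Stab[OF assms(1), of 1]] assms
    by (subst conj_eq_self) (simp_all add: Stab_closed)
  from modular_gen_eqI[OF _ assms(1) _ _ this] show ?thesis using assms Stab_closed by auto
qed

lemma modular_one: "\<Delta> \<one> = 1"
  using modular_mult[of \<one> \<one>] modular_nonzero[of \<one>] by simp

lemma modular_inv: "g \<in> carrier G \<Longrightarrow> \<Delta> (inv g) = inverse (\<Delta> g)"
  using modular_mult[of g "inv g"] modular_one by (simp add: field_simps modular_nonzero)

text \<open>
  Any fraction representing \<open>\<Delta> g\<close> occurs as the ratio of exponents of some power of a generator, which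
  allows exponents to be chosen with prescribed divisibility.
\<close>

lemma modular_rep:
  assumes g: "g \<in> carrier G" and v: "v \<in> V" and ab: "a \<noteq> 0" "b \<noteq> 0" "\<Delta> g = of_int a / of_int b"
  obtains K :: int where "K \<noteq> 0" "conj g (gen v [^] (a * K)) = gen v [^] (b * K)"
proof -
  obtain p q :: int where 1: "p \<noteq> 0" "q \<noteq> 0" "conj g (gen v [^] p) = gen v [^] q"
    using conj_gen_ex g v by blast
  have "of_int p / of_int q = (of_int a / of_int b :: rat)" using modular_gen_eqI[OF g v 1] ab by simp
  then have "of_int p * of_int b = (of_int a * of_int q :: rat)" using 1 ab by (simp add: frac_eq_eq)
  then have e: "p * b = a * q" by (metis of_int_eq_iff of_int_mult)
  have "conj g (gen v [^] (p * (a * b))) = gen v [^] (q * (a * b))"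
    using g v by (simp add: conj_pow 1(3) flip: int_pow_pow)
  moreover have "q * (a * b) = b * (p * b)" using e by (simp add: algebra_simps)
  moreover have "p * (a * b) = a * (p * b)" by (simp add: algebra_simps)
  ultimately show ?thesis using that[of "p * b"] 1 ab by simp
qed

end

section \<open>Finiteness of quotients\<close>

subsection \<open>Subgroups of infinite cyclic groups\<close>

lemma int_subgroup_cyclic:
  fixes I :: "int set"
  assumes "0 \<in> I" "\<And>i j. \<lbrakk>i \<in> I; j \<in> I\<rbrakk> \<Longrightarrow> i - j \<in> I"
  shows "\<exists>n \<in> I. \<forall>i \<in> I. n dvd i"
proof (cases "I \<subseteq> {0}")
  case True
  then show ?thesis using assms(1) by (intro bexI[of _ 0]) auto
next
  case False
  have neg: "- i \<in> I" if "i \<in> I" for i using assms(2)[of 0 i] assms(1) that by simp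
  have add: "i + j \<in> I" if "i \<in> I" "j \<in> I" for i j using assms(2)[of i "- j"] neg that by simp
  have "\<exists>m :: nat. 0 < m \<and> int m \<in> I"
  proof -
    obtain i where i: "i \<in> I" "i \<noteq> 0" using False by blast
    then have "int (nat \<bar>i\<bar>) \<in> I" using neg by (auto simp: abs_if)
    then show ?thesis using i by (intro exI[of _ "nat \<bar>i\<bar>"]) auto
  qed
  then obtain m :: nat where m: "0 < m" "int m \<in> I" "\<And>k :: nat. k < m \<Longrightarrow> \<not> (0 < k \<and> int k \<in> I)"
    using exists_least_iff[of "\<lambda>m :: nat. 0 < m \<and> int m \<in> I"] by blast
  have mul: "j * int m \<in> I" for j :: int
  proof (induction j rule: int_induct[of _ 0])
    case base
    then show ?case using assms by simp
  next
    case (step1 j)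
    then show ?case using add[of "j * int m" "int m"] m by (simp add: algebra_simps)
  next
    case (step2 j)
    then show ?case using assms(2)[of "j * int m" "int m"] m by (simp add: algebra_simps)
  qed
  have "int m dvd i" if i: "i \<in> I" for i
  proof -
    have "i mod int m \<in> I"
      using assms(2)[OF i mul[of "i div int m"]] by (simp add: minus_div_mult_eq_mod)
    moreover have "0 \<le> i mod int m" "i mod int m < int m" using m by simp_all
    ultimately have "i mod int m = 0"
      using m(3)[of "nat (i mod int m)"] by (cases "i mod int m = 0") (auto simp: nat_less_iff)
    then show ?thesis by (simp add: dvd_eq_mod_eq_0)
  qed
  then show ?thesis using m by blast
qed

lemma rtrancl_finite_subset:
  "(x, y) \<in> R\<^sup>* \<Longrightarrow> \<exists>R0 \<subseteq> R. finite R0 \<and> (x, y) \<in> R0\<^sup>*"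
proof (induction rule: rtrancl_induct)
  case base
  show ?case by (intro exI[of _ "{}"]) auto
next
  case (step y z)
  then obtain R0 where R0: "R0 \<subseteq> R" "finite R0" "(x, y) \<in> R0\<^sup>*" by blast
  have "(x, y) \<in> (insert (y, z) R0)\<^sup>*" using R0(3) rtrancl_mono[of R0 "insert (y, z) R0"] by blast
  then have "(x, z) \<in> (insert (y, z) R0)\<^sup>*" by (rule rtrancl_into_rtrancl) simp
  then show ?case using R0 step.hyps by (intro exI[of _ "insert (y, z) R0"]) auto
qed

context gbs
begin

lemma pow_in_subgroup: "\<lbrakk>subgroup K G; k \<in> K\<rbrakk> \<Longrightarrow> k [^] (i :: int) \<in> K"
  using subgroup_int_pow_closed by blast

lemma subgroup_Stab_generated:
  assumes x: "x \<in> V" and K: "subgroup K G" "K \<subseteq> Stab x"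
  shows "\<exists>k \<in> K. K = range (\<lambda>i :: int. k [^] i)"
proof -
  define I where "I = {i :: int. gen x [^] i \<in> K}"
  have "0 \<in> I" using subgroup.one_closed[OF K(1)] by (simp add: I_def)
  moreover have "i - j \<in> I" if "i \<in> I" "j \<in> I" for i j
    using that x subgroup.m_closed[OF K(1)] subgroup.m_inv_closed[OF K(1)]
    by (simp add: I_def int_pow_diff)
  ultimately obtain n where n: "n \<in> I" "\<And>i. i \<in> I \<Longrightarrow> n dvd i"
    using int_subgroup_cyclic[of I] by metis
  have "K = range (\<lambda>i :: int. (gen x [^] n) [^] i)"
  proof
    show "range (\<lambda>i :: int. (gen x [^] n) [^] i) \<subseteq> K" using n pow_in_subgroup[OF K(1)] by (auto simp: I_def)
    show "K \<subseteq> range (\<lambda>i :: int. (gen x [^] n) [^] i)"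
    proof
      fix k assume k: "k \<in> K"
      then obtain i :: int where i: "k = gen x [^] i" using K Stab_eq x by auto
      then have "i \<in> I" using k by (simp add: I_def)
      then obtain j where "i = n * j" using n(2) by (auto elim: dvdE)
      then show "k \<in> range (\<lambda>i :: int. (gen x [^] n) [^] i)" using i x by (auto simp: int_pow_pow)
    qed
  qed
  moreover have "gen x [^] n \<in> K" using n by (simp add: I_def)
  ultimately show ?thesis by blast
qed

lemma Stab_orbit_finite:
  assumes x: "x \<in> V" and y: "y \<in> V"
  shows "finite {act g y | g. g \<in> Stab x}"
proof -
  obtain n :: int where n: "n \<noteq> 0" "gen x [^] n \<in> Stab y" using gen_pow_common x y by blast
  have "{act g y | g. g \<in> Stab x} \<subseteq> (\<lambda>i. act (gen x [^] i) y) ` {- \<bar>n\<bar>..\<bar>n\<bar>}"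
  proof
    fix z assume "z \<in> {act g y | g. g \<in> Stab x}"
    then obtain i :: int where i: "z = act (gen x [^] i) y" using Stab_eq x by auto
    have "gen x [^] i = gen x [^] (i mod n) \<otimes> (gen x [^] n) [^] (i div n)"
      using x by (simp add: int_pow_pow flip: int_pow_mult)
    moreover have "act ((gen x [^] n) [^] (i div n)) y = y" using n y Stab_pow Stab_iff by blast
    ultimately have "z = act (gen x [^] (i mod n)) y" using i x y by (simp add: act_mult)
    moreover have "i mod n \<in> {- \<bar>n\<bar>..\<bar>n\<bar>}"
      using abs_mod_less[OF n(1), of i] by (simp add: abs_le_iff, linarith)
    ultimately show "z \<in> (\<lambda>i. act (gen x [^] i) y) ` {- \<bar>n\<bar>..\<bar>n\<bar>}" by blast
  qed
  then show ?thesis by (rule finite_subset) simp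
qed

end

locale one_free_gbs = gbs G T act
  for G :: "('g, 'm) monoid_scheme" (structure) and T :: "'v pair_pre_digraph" and act :: "'g \<Rightarrow> 'v \<Rightarrow> 'v" +
  assumes one_free: "one_free G T act"
begin

lemma Stab_not_subset:
  assumes "(x, y) \<in> parcs T"
  shows "\<not> Stab x \<subseteq> Stab y"
proof
  assume "Stab x \<subseteq> Stab y"
  then have "stabilizer G (edge_action act) {x, y} = Stab x"
    using edge_stabilizer_eq[OF assms] by blast
  moreover have "{x, y} \<in> undirected_edges T" using assms by (auto simp: undirected_edges_def)
  ultimately show False using one_free unfolding one_free_def by blast
qed

text \<open>
  Finitely many generators move a base point along finitely many arcs, and the \<open>H\<close>-translates of these
  form a cocompact \<open>H\<close>-invariant subtree of \<open>Y\<close>. Since \<open>H\<close> contains all stabilisers of vertices of \<open>Y\<close> and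
  no edge stabiliser is a whole vertex stabiliser, this subtree is all of \<open>Y\<close>.
\<close>

lemma finitely_generated_cofinite:
  assumes fg: "finitely_generated G H" and H: "subgroup H G"
    and Y: "convex Y" and inv: "\<And>h y. \<lbrakk>h \<in> H; y \<in> Y\<rbrakk> \<Longrightarrow> act h y \<in> Y"
    and stab: "\<And>y. y \<in> Y \<Longrightarrow> Stab y \<subseteq> H"
  obtains F R where "finite F" "F \<subseteq> Y" "finite R" "R \<subseteq> parcs T"
    "\<And>y. y \<in> Y \<Longrightarrow> \<exists>h \<in> H. \<exists>x \<in> F. y = act h x"
    "\<And>x y. \<lbrakk>x \<in> Y; y \<in> Y; (x, y) \<in> parcs T\<rbrakk> \<Longrightarrow> \<exists>h \<in> H. \<exists>(a, b) \<in> R. x = act h a \<and> y = act h b"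
proof (cases "Y = {}")
  case True
  then show ?thesis using that[of "{}" "{}"] by auto
next
  case False
  then obtain y0 where y0: "y0 \<in> Y" by blast
  have YV: "Y \<subseteq> V" using convex_sub Y by blast
  have HC: "H \<subseteq> carrier G" using subgroup.subset[OF H] .
  obtain S where S: "finite S" "S \<subseteq> carrier G" "generate G S = H"
    using fg unfolding finitely_generated_def by blast
  have "\<exists>R0 \<subseteq> parcs T \<inter> Y \<times> Y. finite R0 \<and> (y0, act s y0) \<in> R0\<^sup>*" if "s \<in> S" for s
  proof -
    have "s \<in> H" using generate.incl[OF that, of G] S by simp
    then have "act s y0 \<in> Y" using inv y0 by blast
    then show ?thesis by (rule rtrancl_finite_subset[OF convex_connected[OF Y y0]])
  qed
  then obtain Rs where Rs: "\<And>s. s \<in> S \<Longrightarrow> Rs s \<subseteq> parcs T \<inter> Y \<times> Y \<and> finite (Rs s) \<and> (y0, act s y0) \<in> (Rs s)\<^sup>*"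
    by metis
  define R1 where "R1 = (\<Union>s \<in> S. Rs s \<union> (Rs s)\<inverse>)"
  have R1: "finite R1" "R1 \<subseteq> parcs T \<inter> Y \<times> Y"
  proof -
    show "finite R1" using S Rs unfolding R1_def by auto
    have "Rs s \<union> (Rs s)\<inverse> \<subseteq> parcs T \<inter> Y \<times> Y" if "s \<in> S" for s
    proof -
      have *: "Rs s \<subseteq> parcs T \<inter> Y \<times> Y" using Rs that by blast
      have "(parcs T \<inter> Y \<times> Y)\<inverse> \<subseteq> parcs T \<inter> Y \<times> Y" using arcs_symmetric by auto
      then show ?thesis using * by blast
    qed
    then show "R1 \<subseteq> parcs T \<inter> Y \<times> Y" unfolding R1_def by blast
  qed
  have R1sym: "(b, a) \<in> R1" if "(a, b) \<in> R1" for a b using that unfolding R1_def by auto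
  define R where "R = {(act h a, act h b) | h a b. h \<in> H \<and> (a, b) \<in> R1}"
  have RY: "R \<subseteq> parcs T \<inter> Y \<times> Y"
  proof
    fix e assume "e \<in> R"
    then obtain h a b where e: "e = (act h a, act h b)" "h \<in> H" "(a, b) \<in> R1" unfolding R_def by blast
    then have "(a, b) \<in> parcs T" "a \<in> Y" "b \<in> Y" using R1 by auto
    then show "e \<in> parcs T \<inter> Y \<times> Y" using e HC inv act_arc by blast
  qed
  have Rsym: "sym R" unfolding R_def sym_def using R1sym by blast
  have Rinv: "(act h a, act h b) \<in> R" if hab: "h \<in> H" "(a, b) \<in> R" for h a b
  proof -
    obtain k c e where k: "k \<in> H" "(c, e) \<in> R1" "a = act k c" "b = act k e"
      using hab unfolding R_def by blast
    then have "c \<in> V" "e \<in> V" using R1 YV by auto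
    then have "act h a = act (h \<otimes> k) c" "act h b = act (h \<otimes> k) e"
      using k hab HC by (simp_all add: act_mult subset_iff)
    moreover have "h \<otimes> k \<in> H" using k that subgroup.m_closed[OF H] by blast
    ultimately show ?thesis using k unfolding R_def by blast
  qed
  have Rinv': "(act h a, act h b) \<in> R\<^sup>*" if "h \<in> H" "(a, b) \<in> R\<^sup>*" for h a b
    using that(2) by (induction rule: rtrancl_induct) (use Rinv that in \<open>auto intro: rtrancl_into_rtrancl\<close>)
  have Rsym': "(b, a) \<in> R\<^sup>*" if "(a, b) \<in> R\<^sup>*" for a b
    using that sym_rtrancl[OF Rsym] by (blast dest: symD)
  have R1R: "R1 \<subseteq> R"
  proof
    fix e assume e: "e \<in> R1"
    obtain a b where ab: "e = (a, b)" by (cases e)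
    have "a \<in> V" "b \<in> V" using e ab R1 YV by auto
    then have "e = (act \<one> a, act \<one> b)" using ab by simp
    moreover have "\<one> \<in> H" "(a, b) \<in> R1" using e ab subgroup.one_closed[OF H] by auto
    ultimately show "e \<in> R" unfolding R_def by blast
  qed
  have base: "(y0, act s y0) \<in> R\<^sup>*" if "s \<in> S" for s
  proof -
    have "Rs s \<subseteq> R" using R1R that unfolding R1_def by auto
    then show ?thesis using Rs that rtrancl_mono by blast
  qed
  have y0V: "y0 \<in> V" using y0 YV by blast
  have orbit: "(y0, act h y0) \<in> R\<^sup>*" if "h \<in> H" for h
    using that unfolding S(3)[symmetric]
  proof (induction rule: generate.induct)
    case one
    show ?case using y0V by simp
  next
    case (incl h)
    then show ?case by (rule base)
  next
    case (inv h)
    have h: "inv h \<in> H" "h \<in> carrier G" using generate.inv[OF inv, of G] inv S(2,3) by auto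
    have "(act (inv h) y0, act (inv h) (act h y0)) \<in> R\<^sup>*" by (rule Rinv'[OF h(1) base[OF inv]])
    then show ?case using Rsym' h y0V by simp
  next
    case (eng h1 h2)
    have h: "h1 \<in> H" "h2 \<in> H" using eng.hyps S(3) by simp_all
    have "(act h1 y0, act h1 (act h2 y0)) \<in> R\<^sup>*" by (rule Rinv'[OF h(1) eng.IH(2)])
    then have "(y0, act h1 (act h2 y0)) \<in> R\<^sup>*" by (rule rtrancl_trans[OF eng.IH(1)])
    then show ?case using h HC y0V by (simp add: act_mult subset_iff)
  qed
  define Z where "Z = {y. (y0, y) \<in> R\<^sup>*}"
  have ZY: "Z \<subseteq> Y"
  proof
    fix y assume "y \<in> Z"
    then have "(y0, y) \<in> R\<^sup>*" by (simp add: Z_def)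
    then show "y \<in> Y" by (induction rule: rtrancl_induct) (use y0 RY in auto)
  qed
  have RT: "R \<subseteq> parcs T" using RY by blast
  have ZR: "(x, y) \<in> R\<^sup>*" if "x \<in> Z" "y \<in> Z" for x y
    using that Rsym' rtrancl_trans unfolding Z_def by (metis mem_Collect_eq)
  have Z: "convex Z" unfolding Z_def using convex_reachable[OF RT Rsym y0V] .
  \<comment> \<open>A vertex outside the minimal subtree would have the stabiliser of the edge leading to it.\<close>
  have "Y \<subseteq> Z"
  proof (rule ccontr)
    assume "\<not> Y \<subseteq> Z"
    then obtain y where y: "y \<in> Y" "y \<notin> Z" by blast
    have yV: "y \<in> V" using y YV by blast
    have y0Z: "y0 \<in> Z" by (simp add: Z_def)
    have ne: "y \<noteq> y0" using y y0Z by blast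
    have "Stab y \<subseteq> Stab (toward T y y0)"
    proof
      fix g assume g: "g \<in> Stab y"
      have gH: "g \<in> H" "g \<in> carrier G" using g stab y Stab_iff by auto
      then have "act g y0 \<in> Z" using orbit by (simp add: Z_def)
      then have "toward T y (act g y0) = toward T y y0" using toward_convex[OF Z yV y(2)] y0Z by blast
      then have "act g (toward T y y0) = toward T y y0"
        using act_toward[of g y0 y] gH g y0V yV ne by (simp add: Stab_iff)
      then show "g \<in> Stab (toward T y y0)" using gH by (simp add: Stab_iff)
    qed
    then show False using Stab_not_subset toward_arc[OF yV y0V ne] by blast
  qed
  then have ZeqY: "Z = Y" using ZY by blast
  define F where "F = insert y0 (snd ` R1)"
  have "finite F" "F \<subseteq> Y" using R1 y0 unfolding F_def by auto
  moreover have "\<exists>h \<in> H. \<exists>x \<in> F. y = act h x" if "y \<in> Y" for y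
  proof -
    have "(y0, y) \<in> R\<^sup>*" using that ZeqY by (auto simp: Z_def)
    then show ?thesis
    proof (cases rule: rtranclE)
      case base
      then show ?thesis using subgroup.one_closed[OF H] y0V by (intro bexI[of _ \<one>] bexI[of _ y0]) (auto simp: F_def)
    next
      case (step z)
      then show ?thesis unfolding R_def F_def by force
    qed
  qed
  moreover have "\<exists>h \<in> H. \<exists>(a, b) \<in> R1. x = act h a \<and> y = act h b"
    if xy: "x \<in> Y" "y \<in> Y" "(x, y) \<in> parcs T" for x y
  proof -
    have V: "x \<in> V" "y \<in> V" using xy YV by auto
    have "(x, y) \<in> R\<^sup>*" using ZR ZeqY xy by blast
    moreover have "y \<noteq> x" using pair_no_loops[OF xy(3)] by auto
    ultimately have "(toward T y x, y) \<in> R" using geodesic_arc_in_walk[OF RT] V by blast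
    moreover have "x = toward T y x" using toward_unique[of y x x] xy V arcs_symmetric by simp
    ultimately have "(x, y) \<in> R" by simp
    then show ?thesis unfolding R_def by blast
  qed
  moreover have "R1 \<subseteq> parcs T" using R1 by blast
  ultimately show ?thesis using that[of F R1] R1(1) by blast
qed

lemma convex_verts: "convex V"
  unfolding convex_def using toward_in_verts by blast

lemma quotient_finite:
  obtains F R where "finite F" "F \<subseteq> V" "finite R" "R \<subseteq> parcs T"
    "\<And>y. y \<in> V \<Longrightarrow> \<exists>h \<in> carrier G. \<exists>x \<in> F. y = act h x"
    "\<And>x y. (x, y) \<in> parcs T \<Longrightarrow> \<exists>h \<in> carrier G. \<exists>(a, b) \<in> R. x = act h a \<and> y = act h b"
proof (rule finitely_generated_cofinite[OF finitely_generated subgroup_self convex_verts])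
  show "\<And>h y. \<lbrakk>h \<in> carrier G; y \<in> V\<rbrakk> \<Longrightarrow> act h y \<in> V" by simp
  show "\<And>y. y \<in> V \<Longrightarrow> Stab y \<subseteq> carrier G" by (auto simp: Stab_iff)
  fix F R
  assume "finite F" "F \<subseteq> V" "finite R" "R \<subseteq> parcs T"
    "\<And>y. y \<in> V \<Longrightarrow> \<exists>h \<in> carrier G. \<exists>x \<in> F. y = act h x"
    and R: "\<And>x y. \<lbrakk>x \<in> V; y \<in> V; (x, y) \<in> parcs T\<rbrakk> \<Longrightarrow>
      \<exists>h \<in> carrier G. \<exists>(a, b) \<in> R. x = act h a \<and> y = act h b"
  then show thesis using R[OF arc_verts] by (intro that[of F R])
qed

text \<open>
  There are finitely many arc orbits, and \<open>Stab x\<close> has finite orbits on neighbours because edge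
  stabilisers are nontrivial subgroups of an infinite cyclic group.
\<close>

lemma locally_finite:
  assumes x: "x \<in> V"
  shows "finite {y. (x, y) \<in> parcs T}"
proof -
  obtain F R where R: "finite R" "R \<subseteq> parcs T"
    "\<And>x y. (x, y) \<in> parcs T \<Longrightarrow> \<exists>h \<in> carrier G. \<exists>(a, b) \<in> R. x = act h a \<and> y = act h b"
    using quotient_finite by metis
  define g0 where "g0 e = (SOME g. g \<in> carrier G \<and> act g (fst e) = x)" for e :: "'v \<times> 'v"
  have "{y. (x, y) \<in> parcs T} \<subseteq> (\<Union>e \<in> {e \<in> R. g0 e \<in> carrier G}. {act k (act (g0 e) (snd e)) | k. k \<in> Stab x})"
  proof
    fix y assume "y \<in> {y. (x, y) \<in> parcs T}"
    then obtain g a b where g: "g \<in> carrier G" "(a, b) \<in> R" "x = act g a" "y = act g b" using R by blast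
    have V: "a \<in> V" "b \<in> V" using g R arc_verts by auto
    have "g0 (a, b) \<in> carrier G \<and> act (g0 (a, b)) (fst (a, b)) = x"
      unfolding g0_def by (rule someI[of _ g]) (use g in auto)
    then have g0: "g0 (a, b) \<in> carrier G" "act (g0 (a, b)) a = x" by auto
    have "act (inv (g0 (a, b))) x = a" using g0 V by auto
    then have "g \<otimes> inv (g0 (a, b)) \<in> Stab x" using g g0 V x by (simp add: Stab_iff act_mult)
    moreover have "y = act (g \<otimes> inv (g0 (a, b))) (act (g0 (a, b)) b)"
      using g g0 V by (simp add: act_mult)
    ultimately show "y \<in> (\<Union>e \<in> {e \<in> R. g0 e \<in> carrier G}. {act k (act (g0 e) (snd e)) | k. k \<in> Stab x})"
      using g g0 by force
  qed
  moreover have "finite (\<Union>e \<in> {e \<in> R. g0 e \<in> carrier G}. {act k (act (g0 e) (snd e)) | k. k \<in> Stab x})"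
  proof (rule finite_UN_I)
    show "finite {e \<in> R. g0 e \<in> carrier G}" using R by simp
    fix e assume "e \<in> {e \<in> R. g0 e \<in> carrier G}"
    then show "finite {act k (act (g0 e) (snd e)) | k. k \<in> Stab x}"
      using R arc_verts x by (intro Stab_orbit_finite) (cases e, auto)
  qed
  ultimately show ?thesis by (rule finite_subset)
qed

text \<open>
  Generators are the elements that move vertices of \<open>F\<close> into \<open>F\<close> or next to it, together with
  generators of the stabilisers of \<open>F\<close> in \<open>H\<close>; there are finitely many because \<open>T\<close> is locally finite and
  subgroups of infinite cyclic groups are cyclic.
\<close>

lemma finitely_generated_if_cofinite:
  assumes H: "subgroup H G"
    and Y: "convex Y" "Y \<noteq> {}" and inv: "\<And>h y. \<lbrakk>h \<in> H; y \<in> Y\<rbrakk> \<Longrightarrow> act h y \<in> Y"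
    and F: "finite F" "F \<subseteq> V" "\<And>y. y \<in> Y \<Longrightarrow> \<exists>h \<in> H. act h y \<in> F"
  shows "finitely_generated G H"
proof -
  have YV: "Y \<subseteq> V" using convex_sub Y by blast
  have HC: "H \<subseteq> carrier G" using subgroup.subset[OF H] .
  define F0 where "F0 = F \<inter> Y"
  have F0: "finite F0" "F0 \<subseteq> Y" "F0 \<subseteq> V" using F YV by (auto simp: F0_def)
  have F0Y: "\<exists>h \<in> H. \<exists>x \<in> F0. y = act h x" if y: "y \<in> Y" for y
  proof -
    obtain h where h: "h \<in> H" "act h y \<in> F" using F(3)[OF y] by blast
    then have "inv h \<in> H" "act h y \<in> F0" "y = act (inv h) (act h y)"
      using y inv subgroup.m_inv_closed[OF H] YV HC by (auto simp: F0_def subset_iff)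
    then show ?thesis by blast
  qed
  define F' where "F' = F0 \<union> (\<Union>x \<in> F0. {y. (x, y) \<in> parcs T})"
  have F': "finite F'" using F0 locally_finite unfolding F'_def by auto
  define c where "c x y = (SOME h. h \<in> H \<and> act h x = y)" for x y
  have c: "c x y \<in> H \<and> act (c x y) x = y" if "h \<in> H" "act h x = y" for h x y
    unfolding c_def by (rule someI[of _ h]) (use that in auto)
  define P where "P = {(x, y) \<in> F0 \<times> F'. \<exists>h \<in> H. act h x = y}"
  have "\<exists>k \<in> H \<inter> Stab x. H \<inter> Stab x = range (\<lambda>i :: int. k [^] i)" if "x \<in> F0" for x
  proof (rule subgroup_Stab_generated)
    show "x \<in> V" using that F0 by blast
    then show "subgroup (H \<inter> Stab x) G" using H Stab_subgroup by (intro subgroups_Inter_pair)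
  qed auto
  then obtain k where k: "\<And>x. x \<in> F0 \<Longrightarrow> k x \<in> H \<inter> Stab x \<and> H \<inter> Stab x = range (\<lambda>i :: int. k x [^] i)"
    using bchoice[of F0 "\<lambda>x k. k \<in> H \<inter> Stab x \<and> H \<inter> Stab x = range (\<lambda>i :: int. k [^] i)"] by blast
  define A where "A = (\<lambda>(x, y). c x y) ` P \<union> k ` F0"
  have "P \<subseteq> F0 \<times> F'" by (auto simp: P_def)
  then have "finite P" using F0 F' finite_subset by blast
  then have finA: "finite A" using F0 unfolding A_def by blast
  have "c x y \<in> H" if xy: "(x, y) \<in> P" for x y
  proof -
    obtain h where "h \<in> H" "act h x = y" using xy unfolding P_def by auto
    then show ?thesis using c by metis
  qed
  moreover have "k x \<in> H" if "x \<in> F0" for x using k[OF that] by simp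
  ultimately have AH: "A \<subseteq> H" unfolding A_def by auto
  define K where "K = generate G A"
  have KH: "K \<subseteq> H" unfolding K_def by (rule generate_subgroup_incl[OF AH H])
  have AK: "A \<subseteq> K" unfolding K_def by (auto intro: generate.incl)
  have K: "subgroup K G" unfolding K_def using AH HC by (intro generate_is_subgroup) blast
  obtain y0 where y0: "y0 \<in> F0" using Y F0Y by blast
  have y0V: "y0 \<in> V" using y0 F0 by blast
  have KC: "K \<subseteq> carrier G" using KH HC by blast
  have KF: "\<exists>h \<in> K. \<exists>x \<in> F0. y = act h x" if "y \<in> Y" for y
  proof -
    have "(y0, y) \<in> (parcs T \<inter> Y \<times> Y)\<^sup>*" using convex_connected[OF Y(1)] y0 F0 that by blast
    then show ?thesis
    proof (induction rule: rtrancl_induct)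
      case base
      show ?case using subgroup.one_closed[OF K] y0 y0V by (intro bexI[of _ \<one>] bexI[of _ y0]) auto
    next
      case (step y z)
      then obtain h x where h: "h \<in> K" "x \<in> F0" "y = act h x" by blast
      have xV: "x \<in> V" and zV: "z \<in> V" and hC: "h \<in> carrier G" using h F0 step YV KC by auto
      let ?z = "act (inv h) z"
      have hz: "act h ?z = z" using hC zV by simp
      have "(act h x, act h ?z) \<in> parcs T" using step h hz by auto
      then have "(x, ?z) \<in> parcs T" using act_arc_iff[of h x ?z] hC xV zV by simp
      then have zF: "?z \<in> F'" using h unfolding F'_def by blast
      have "inv h \<in> H" using h KH subgroup.m_inv_closed[OF H] by blast
      then have "?z \<in> Y" using step inv by blast
      then obtain g x2 where g: "g \<in> H" "x2 \<in> F0" "?z = act g x2" using F0Y by blast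
      have P: "(x2, ?z) \<in> P" using g zF unfolding P_def by auto
      then have cK: "c x2 ?z \<in> K" using AK unfolding A_def by auto
      have "act (c x2 ?z) x2 = ?z" using c[of g x2 ?z] g by simp
      then have "act (h \<otimes> c x2 ?z) x2 = z" using hz cK KC hC g F0 by (subst act_mult) auto
      then show ?case using h cK g subgroup.m_closed[OF K] by metis
    qed
  qed
  have "H \<subseteq> K"
  proof
    fix h assume h: "h \<in> H"
    then have hC: "h \<in> carrier G" using HC by blast
    have "act h y0 \<in> Y" using inv h y0 F0 by blast
    then obtain g x where g: "g \<in> K" "x \<in> F0" "act h y0 = act g x" using KF by blast
    have gC: "g \<in> carrier G" and xV: "x \<in> V" using g KC F0 by auto
    have gh: "inv g \<otimes> h \<in> H" "act (inv g \<otimes> h) y0 = x"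
      using g KH h subgroup.m_closed[OF H] subgroup.m_inv_closed[OF H] gC hC y0V xV
      by (auto simp: act_mult)
    have c': "c y0 x \<in> H" "act (c y0 x) y0 = x" using c[OF gh] by auto
    have "(y0, x) \<in> P" using gh y0 g unfolding P_def F'_def by auto
    then have cK: "c y0 x \<in> K" using AK unfolding A_def by auto
    let ?c = "c y0 x"
    have cC: "?c \<in> carrier G" using cK KC by blast
    define m where "m = inv ?c \<otimes> (inv g \<otimes> h)"
    have "act (inv ?c) x = y0" using act_inv(1)[OF cC y0V] c' by simp
    then have "m \<in> H \<inter> Stab y0"
      using gh c' cC gC hC y0V subgroup.m_closed[OF H] subgroup.m_inv_closed[OF H]
      unfolding m_def by (auto simp: Stab_iff act_mult)
    then obtain i :: int where "m = k y0 [^] i" using k y0 by blast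
    moreover have "k y0 \<in> K" using AK y0 unfolding A_def by blast
    ultimately have mK: "m \<in> K" using pow_in_subgroup[OF K] by blast
    have "h = g \<otimes> (?c \<otimes> m)" using gC cC hC unfolding m_def by simp
    then show "h \<in> K" using mK cK g subgroup.m_closed[OF K] by metis
  qed
  then have "generate G A = H" using KH unfolding K_def by blast
  then show ?thesis using finA AH HC unfolding finitely_generated_def by blast
qed

end

section \<open>Fixed subgroups of automorphisms realised on the tree\<close>

locale equivariant = one_free_gbs G T act + tree_automorphism T f
  for G :: "('g, 'm) monoid_scheme" (structure) and T :: "'v pair_pre_digraph"
    and act :: "'g \<Rightarrow> 'v \<Rightarrow> 'v" and f :: "'v \<Rightarrow> 'v" +
  fixes \<phi> :: "'g \<Rightarrow> 'g"
  assumes phi_auto: "\<phi> \<in> auto G"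
    and equivariant: "\<lbrakk>g \<in> carrier G; x \<in> pverts T\<rbrakk> \<Longrightarrow> f (act g x) = act (\<phi> g) (f x)"
begin

sublocale phi: group_hom G G \<phi>
  using phi_auto by unfold_locales (auto simp: auto_def)

lemma phi_surj:
  assumes "g \<in> carrier G"
  shows "\<exists>h \<in> carrier G. \<phi> h = g"
proof -
  have "\<phi> ` carrier G = carrier G" using phi_auto by (simp add: auto_def Bij_def bij_betw_def)
  then have "g \<in> \<phi> ` carrier G" using assms by simp
  then show ?thesis by auto
qed

abbreviation H :: "'g set" where
  "H \<equiv> fixed_subgroup G \<phi>"

abbreviation Tf :: "'v set" where
  "Tf \<equiv> {x \<in> V. f x = x}"

lemma H_iff: "g \<in> H \<longleftrightarrow> g \<in> carrier G \<and> \<phi> g = g"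
  by (simp add: fixed_subgroup_def)

lemma H_subgroup: "subgroup H G"
  by (intro subgroup.intro) (auto simp: H_iff)

lemma H_commute: "\<lbrakk>h \<in> H; x \<in> V\<rbrakk> \<Longrightarrow> f (act h x) = act h (f x)"
  by (simp add: H_iff equivariant)

lemma H_act_Tf: "\<lbrakk>h \<in> H; y \<in> Tf\<rbrakk> \<Longrightarrow> act h y \<in> Tf"
  by (auto simp: H_commute) (simp add: H_iff)

lemma phi_Stab: "\<lbrakk>x \<in> Tf; g \<in> carrier G\<rbrakk> \<Longrightarrow> \<phi> g \<in> Stab x \<longleftrightarrow> g \<in> Stab x"
  using equivariant[of g x] f_eq_iff[of "act g x" x] by (auto simp: Stab_iff)

text \<open>
  \<open>\<phi>\<close> restricts to an automorphism of the infinite cyclic group \<open>Stab x\<close>.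
\<close>

lemma phi_gen:
  assumes x: "x \<in> Tf"
  shows "\<phi> (gen x) = gen x \<or> \<phi> (gen x) = inv (gen x)"
proof -
  have V: "x \<in> V" using x by simp
  have "gen x \<in> Stab x" using gen_pow_Stab[OF V, of 1] V by simp
  then have "\<phi> (gen x) \<in> Stab x" using phi_Stab[OF x, of "gen x"] V by simp
  then obtain m :: int where m: "\<phi> (gen x) = gen x [^] m" using Stab_eq V by auto
  obtain h where h: "h \<in> carrier G" "\<phi> h = gen x" using phi_surj[of "gen x"] V by auto
  then have "h \<in> Stab x" using phi_Stab[OF x, of h] \<open>gen x \<in> Stab x\<close> by simp
  then obtain k :: int where k: "h = gen x [^] k" using Stab_eq V by auto
  have "gen x [^] (1 :: int) = gen x [^] (m * k)"
    using h k m V by (simp add: phi.hom_int_pow flip: int_pow_pow)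
  then have "1 = m * k" using V by (simp only: gen_pow_eq)
  then have "m = 1 \<or> m = -1" by (metis pos_zmult_eq_1_iff_lemma zmult_eq_1_iff)
  then show ?thesis using m V by (auto simp: int_pow_neg)
qed

text \<open>
  The defect is trivial exactly on the fixed subgroup. If \<open>x\<close> is fixed by \<open>f\<close>, it tells which vertices
  \<open>g x\<close> are fixed as well, and elements with equal defect move \<open>x\<close> into the same \<open>H\<close>-orbit.
\<close>

definition defect :: "'g \<Rightarrow> 'g" where
  "defect g = inv g \<otimes> \<phi> g"

lemma defect_closed [simp]: "g \<in> carrier G \<Longrightarrow> defect g \<in> carrier G"
  by (simp add: defect_def)

lemma defect_mult:
  "\<lbrakk>g \<in> carrier G; h \<in> carrier G\<rbrakk> \<Longrightarrow> defect (g \<otimes> h) = inv h \<otimes> defect g \<otimes> \<phi> h"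
  by (simp add: defect_def inv_mult_group m_assoc)

lemma defect_H_mult: "\<lbrakk>h \<in> H; g \<in> carrier G\<rbrakk> \<Longrightarrow> defect (h \<otimes> g) = defect g"
  by (simp add: defect_def inv_mult_group m_assoc H_iff)

lemma defect_eq_H:
  assumes "a \<in> carrier G" "b \<in> carrier G" "defect a = defect b"
  shows "b \<otimes> inv a \<in> H"
proof -
  have phi: "\<phi> g = g \<otimes> defect g" if "g \<in> carrier G" for g using that by (simp add: defect_def)
  have "\<phi> b = b \<otimes> defect a" "\<phi> a = a \<otimes> defect a" using phi[of b] phi[of a] assms by auto
  then have "\<phi> (b \<otimes> inv a) = b \<otimes> defect a \<otimes> inv (a \<otimes> defect a)" using assms by simp
  also have "\<dots> = b \<otimes> inv a" using assms by (simp add: inv_mult_group m_assoc)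
  finally show ?thesis using assms by (simp add: H_iff)
qed

lemma defect_Stab_iff:
  assumes "x \<in> Tf" "g \<in> carrier G"
  shows "defect g \<in> Stab x \<longleftrightarrow> act g x \<in> Tf"
proof -
  have "defect g \<in> Stab x \<longleftrightarrow> act (inv g) (act (\<phi> g) x) = x"
    using assms by (auto simp: Stab_iff defect_def act_mult)
  also have "\<dots> \<longleftrightarrow> act (\<phi> g) x = act g x" using assms by (subst act_inv_eq) auto
  also have "\<dots> \<longleftrightarrow> act g x \<in> Tf" using assms equivariant[of g x] by auto
  finally show ?thesis .
qed

subsection \<open>No fixed vertex\<close>

text \<open>
  Powers are taken in the group of permutations of the vertices, so that negative exponents and the
  laws of exponents are available.
\<close>

definition power_f :: "int \<Rightarrow> 'v \<Rightarrow> 'v" where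
  "power_f k = restrict f V [^]\<^bsub>BijGroup V\<^esub> k"

lemma carrier_BijGroup: "carrier (BijGroup V) = Bij V"
  by (simp add: BijGroup_def)

lemma restrict_f_Bij: "restrict f V \<in> carrier (BijGroup V)"
  unfolding carrier_BijGroup using bij by (auto simp: Bij_def cong: bij_betw_cong)

lemma power_f_Bij: "power_f k \<in> Bij V"
  unfolding power_f_def
  using group.int_pow_closed[OF group_BijGroup restrict_f_Bij, of k] by (simp only: carrier_BijGroup)

lemma power_f_verts: "x \<in> V \<Longrightarrow> power_f k x \<in> V"
  using power_f_Bij by (auto dest: Bij_imp_funcset)

lemma power_f_0 [simp]: "x \<in> V \<Longrightarrow> power_f 0 x = x"
  unfolding power_f_def int_pow_0 by (simp add: BijGroup_def)

lemma power_f_1: "x \<in> V \<Longrightarrow> power_f 1 x = f x"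
  using group.int_pow_1[OF group_BijGroup restrict_f_Bij] by (simp add: power_f_def)

lemma power_f_add:
  assumes "x \<in> V"
  shows "power_f j (power_f k x) = power_f (j + k) x"
proof -
  have "power_f (j + k) = power_f j \<otimes>\<^bsub>BijGroup V\<^esub> power_f k"
    unfolding power_f_def by (rule group.int_pow_mult[OF group_BijGroup restrict_f_Bij])
  then show ?thesis using power_f_Bij assms by (simp add: BijGroup_def compose_eq)
qed

lemma power_f_Suc: "x \<in> V \<Longrightarrow> f (power_f k x) = power_f (k + 1) x"
  using power_f_add[of x 1 k] power_f_1[of "power_f k x"] power_f_verts[of x k] by (simp add: add.commute)

lemma power_f_arc: "(x, y) \<in> parcs T \<Longrightarrow> (power_f k x, power_f k y) \<in> parcs T"
proof (induction k rule: int_induct[of _ 0])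
  case (step1 k)
  then show ?case using arc arc_verts power_f_Suc by metis
next
  case (step2 k)
  have "(f (power_f (k - 1) x), f (power_f (k - 1) y)) \<in> parcs T"
    using step2 arc_verts by (simp add: power_f_Suc)
  then show ?case using arc_rev power_f_verts arc_verts step2 by blast
qed (use arc_verts in auto)

lemma power_f_H: "\<lbrakk>h \<in> H; x \<in> V\<rbrakk> \<Longrightarrow> power_f k (act h x) = act h (power_f k x)"
proof (induction k rule: int_induct[of _ 0])
  case base
  then show ?case by (simp add: H_iff)
next
  case (step1 k)
  have "act h x \<in> V" using step1 by (simp add: H_iff)
  then have "power_f (k + 1) (act h x) = f (act h (power_f k x))" using step1 by (simp flip: power_f_Suc)
  then show ?case using step1 by (simp add: H_commute power_f_verts power_f_Suc)
next
  case (step2 k)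
  have "f (power_f (k - 1) (act h x)) = f (act h (power_f (k - 1) x))"
    using step2 by (simp add: H_commute power_f_verts power_f_Suc H_iff)
  then show ?case using step2 f_eq_iff H_iff power_f_verts by (meson act_closed)
qed

text \<open>
  If \<open>w\<close> is outside \<open>L\<close>, let \<open>a\<close> be its neighbour toward \<open>L\<close>. As \<open>w\<close> and \<open>f w\<close> are equally far from \<open>L\<close>, the
  geodesic from \<open>w\<close> to \<open>f w\<close> starts by approaching \<open>L\<close> and ends by leaving it, so it begins with \<open>w, a\<close>
  and ends with \<open>f a, f w\<close>. These arcs are different, because \<open>a\<close> is closer to \<open>L\<close> than \<open>f w\<close>. Then \<open>f\<close> moves \<open>a\<close> less than \<open>w\<close>.
\<close>

lemma minimal_displacement_in_invariant_subtree:
  assumes nofix: "Tf = {}"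
    and L: "convex L" "L \<noteq> {}" "\<And>y. y \<in> L \<Longrightarrow> f y \<in> L" "\<And>y. \<lbrakk>y \<in> V; f y \<in> L\<rbrakk> \<Longrightarrow> y \<in> L"
    and w: "w \<in> V" "\<And>u. u \<in> V \<Longrightarrow> tdist T w (f w) \<le> tdist T u (f u)"
  shows "w \<in> L"
proof (rule ccontr)
  assume wL: "w \<notin> L"
  have LV: "L \<subseteq> V" using L convex_sub by blast
  obtain y where y: "y \<in> L" "\<And>z. z \<in> L \<Longrightarrow> tdist T w y \<le> tdist T w z"
    using L(2) ex_has_least_nat[of "\<lambda>y. y \<in> L" _ "tdist T w"] by blast
  have fw: "f w \<in> V" "f w \<noteq> w" "f w \<notin> L" using w nofix in_verts L(4) wL by auto
  have yV: "y \<in> V" "f y \<in> V" "f y \<in> L" "w \<noteq> y" using y LV in_verts L(3) wL by auto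
  have far: "tdist T w y \<le> tdist T (f w) z" if z: "z \<in> L" for z
  proof -
    obtain z' where z': "z' \<in> V" "f z' = z" using preimage z LV by blast
    then have "z' \<in> L" using L(4) z by blast
    then show ?thesis using y(2) tdist_f[of w z'] z' w by auto
  qed
  have dwfw: "tdist T w (f w) \<noteq> 0" using tdist_eq_0[of w "f w"] fw w by auto
  let ?a = "toward T w y"
  have aV: "?a \<in> V" "(w, ?a) \<in> parcs T" using toward_in_verts toward_arc w yV by auto
  have a_fy: "toward T w (f y) = ?a" using toward_convex[OF L(1) w(1) wL] yV y by blast
  have a_fw: "toward T w (f w) = ?a"
  proof (rule ccontr)
    assume "toward T w (f w) \<noteq> ?a"
    then have "tdist T (f w) (f y) = tdist T (f w) w + tdist T w (f y)"
      using tdist_branch[of w "f w" "f y"] a_fy w fw yV by auto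
    then show False using tdist_f[of w y] tdist_sym[of w "f w"] y(2)[of "f y"] w yV fw dwfw by simp
  qed
  have fa: "toward T (f w) w = f ?a"
  proof (rule ccontr)
    assume ne: "toward T (f w) w \<noteq> f ?a"
    have "f ?a = toward T (f w) (f y)" using toward_f w yV by blast
    also have "\<dots> = toward T (f w) y" using toward_convex[OF L(1) fw(1,3)] yV y by blast
    finally have "tdist T w y = tdist T w (f w) + tdist T (f w) y"
      using tdist_branch[of "f w" w y] ne w fw yV by auto
    then show False using far[OF y(1)] dwfw by simp
  qed
  have da: "tdist T w y = Suc (tdist T ?a y)" using toward_dist w yV by blast
  have ne: "?a \<noteq> f w" using far[OF y(1)] da by auto
  have 1: "tdist T w (f w) = Suc (tdist T ?a (f w))" using toward_dist[of w "f w"] a_fw w fw by auto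
  have "toward T (f w) ?a = toward T (f w) w"
    using toward_adjacent[of w ?a "f w"] aV ne fw by auto
  then have "tdist T (f w) ?a = Suc (tdist T (f ?a) ?a)"
    using toward_dist[of "f w" ?a] fa ne fw aV by auto
  then have "tdist T ?a (f ?a) < tdist T w (f w)"
    using 1 tdist_sym aV fw in_verts by (metis Suc_lessD lessI)
  then show False using w(2)[OF aV(1)] by simp
qed

text \<open>
  Let \<open>v\<close> be a vertex of minimal displacement, and \<open>L\<close> the union of the translates under powers of \<open>f\<close> of a
  walk from \<open>v\<close> to \<open>f v\<close>. An element \<open>h\<close> of \<open>H\<close> preserves displacement, so \<open>h v\<close> lies in \<open>L\<close>, that is, it is
  the image under a power of \<open>f\<close> of one of finitely many vertices. Those \<open>h\<close> with \<open>h v = f\<^sup>k v\<close> for some \<open>k\<close>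
  form a subgroup of finite index. As \<open>H\<close> commutes with \<open>f\<close>, the exponents \<open>k\<close> form a subgroup of the
  integers, and those \<open>h\<close> with \<open>k = 0\<close> lie in \<open>Stab v\<close>. This treats translations along an axis and
  inversions of an edge alike.
\<close>

lemma finitely_generated_no_fixed_vertex:
  assumes nofix: "Tf = {}"
  shows "finitely_generated G H"
proof -
  obtain v where v: "v \<in> V" "\<And>u. u \<in> V \<Longrightarrow> tdist T v (f v) \<le> tdist T u (f u)"
    using pverts_nonempty ex_has_least_nat[of "\<lambda>y. y \<in> V" _ "\<lambda>v. tdist T v (f v)"] by blast
  have fv: "f v \<in> V" using v in_verts by blast
  obtain R0 where R0: "R0 \<subseteq> parcs T" "finite R0" "(v, f v) \<in> R0\<^sup>*"
    using rtrancl_finite_subset[OF reachable_all[OF v(1) fv]] by blast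
  define R1 where "R1 = R0 \<union> R0\<inverse>"
  have R1: "R1 \<subseteq> parcs T" "finite R1" "sym R1" "R0 \<subseteq> R1"
    using R0 arcs_symmetric unfolding R1_def by (auto intro: symI)
  have R1V: "a \<in> V" "b \<in> V" if "(a, b) \<in> R1" for a b using that R1 arc_verts by auto
  define R where "R = {(power_f k a, power_f k b) | k a b. (a, b) \<in> R1}"
  have R: "R \<subseteq> parcs T" using R1 power_f_arc unfolding R_def by blast
  have symR: "sym R" using R1(3) unfolding R_def sym_def by blast
  have R1R: "R1 \<subseteq> R"
  proof
    fix e assume "e \<in> R1"
    moreover obtain a b where "e = (a, b)" by (cases e)
    ultimately have "(a, b) \<in> R1" "e = (power_f 0 a, power_f 0 b)" using R1V by auto
    then show "e \<in> R" unfolding R_def by blast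
  qed
  have R_power: "(power_f k x, power_f k y) \<in> R\<^sup>*" if "(x, y) \<in> R\<^sup>*" for k x y
    using that
  proof (induction rule: rtrancl_induct)
    case (step y z)
    then obtain j a b where "(a, b) \<in> R1" "y = power_f j a" "z = power_f j b" unfolding R_def by blast
    then have "(a, b) \<in> R1" "power_f k y = power_f (k + j) a" "power_f k z = power_f (k + j) b"
      using R1V by (auto simp: power_f_add)
    then have "(power_f k y, power_f k z) \<in> R" unfolding R_def by blast
    then show ?case using step.IH by (rule rtrancl_into_rtrancl[rotated])
  qed auto
  have symR': "(b, a) \<in> R\<^sup>*" if "(a, b) \<in> R\<^sup>*" for a b
    using that sym_rtrancl[OF symR] by (blast dest: symD)
  define L where "L = {y. (v, y) \<in> R\<^sup>*}"
  have L: "convex L" unfolding L_def using convex_reachable[OF R symR v(1)] .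
  have vL: "v \<in> L" by (simp add: L_def)
  have up: "(v, power_f 1 v) \<in> R\<^sup>*"
    using R0 R1 R1R rtrancl_mono[of R0 R] v by (auto simp: power_f_1)
  then have down: "(v, power_f (- 1) v) \<in> R\<^sup>*"
    using symR'[OF R_power[of v "power_f 1 v" "- 1"]] v by (simp add: power_f_add)
  have L1: "f y \<in> L" if "y \<in> L" for y
    using that R_power[of v y 1] rtrancl_trans[OF up] convex_sub[OF L] power_f_1[of y]
    by (auto simp: L_def)
  have L2: "y \<in> L" if "y \<in> V" "f y \<in> L" for y
    using that R_power[of v "f y" "- 1"] rtrancl_trans[OF down] power_f_add[of y "- 1" 1] power_f_1[of y]
    by (auto simp: L_def)
  define P where "P = insert v (snd ` R1)"
  have P: "finite P" "P \<subseteq> V" using R1 R1V v by (auto simp: P_def)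
  have LP: "\<exists>p \<in> P. \<exists>k. x = power_f k p" if "x \<in> L" for x
  proof -
    have "(v, x) \<in> R\<^sup>*" using that by (simp add: L_def)
    then show ?thesis
    proof (cases rule: rtranclE)
      case base
      then show ?thesis using v by (intro bexI[of _ v] exI[of _ 0]) (auto simp: P_def)
    next
      case (step z)
      then show ?thesis unfolding R_def P_def by force
    qed
  qed
  have HC: "H \<subseteq> carrier G" using subgroup.subset[OF H_subgroup] .
  have hvP: "\<exists>p \<in> P. \<exists>k. act h v = power_f k p" if h: "h \<in> H" for h
  proof -
    have hC: "h \<in> carrier G" using h HC by blast
    have "tdist T (act h v) (f (act h v)) = tdist T v (f v)"
      using H_commute[OF h v(1)] act_tdist[OF hC v(1) fv] by simp
    then have "act h v \<in> L"
      using minimal_displacement_in_invariant_subtree[OF nofix L _ L1 L2, of "act h v"] v hC vL by auto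
    then show ?thesis by (rule LP)
  qed
  define rel where "rel h k \<longleftrightarrow> h \<in> H \<and> act h v = power_f k v" for h k
  have relC: "h \<in> carrier G" if "rel h k" for h k using that HC unfolding rel_def by blast
  have rel_mult: "rel (h \<otimes> h') (k + k')" if hk: "rel h k" "rel h' k'" for h h' k k'
  proof -
    have "act (h \<otimes> h') v = power_f k' (act h v)"
      using hk relC[OF hk(1)] relC[OF hk(2)] v power_f_H[of h v k'] by (simp add: rel_def act_mult)
    also have "\<dots> = power_f (k + k') v" using hk v by (simp add: rel_def power_f_add add.commute)
    finally show ?thesis using hk subgroup.m_closed[OF H_subgroup] unfolding rel_def by blast
  qed
  have rel_inv: "rel (inv h) (- k)" if hk: "rel h k" for h k
  proof -
    have iH: "inv h \<in> H" using hk subgroup.m_inv_closed[OF H_subgroup] unfolding rel_def by blast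
    have "power_f k (act (inv h) v) = v"
      using hk relC[OF hk] power_f_H[OF iH v(1), of k] act_inv(1)[OF relC[OF hk] v(1)] by (simp add: rel_def)
    then have "power_f (- k) v = act (inv h) v"
      using power_f_add[of "act (inv h) v" "- k" k] relC[OF hk] v by simp
    then show ?thesis using iH unfolding rel_def by simp
  qed
  have rel_0: "h \<in> Stab v" if "rel h 0" for h
    using that relC[OF that] v by (simp add: rel_def Stab_iff)
  have rel_one: "rel \<one> 0"
    using subgroup.one_closed[OF H_subgroup] v unfolding rel_def by auto
  have rel_pow: "rel (h [^] j) (j * k)" if hk: "rel h k" for h k and j :: int
  proof (induction j rule: int_induct[of _ 0])
    case base
    then show ?case using rel_one by simp
  next
    case (step1 j)
    then show ?case using rel_mult[OF step1(2) hk] relC[OF hk] int_pow_mult[of h j 1] by (simp add: algebra_simps)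
  next
    case (step2 j)
    then show ?case using rel_mult[OF step2(2) rel_inv[OF hk]] relC[OF hk] int_pow_diff[of h j 1]
      by (simp add: algebra_simps)
  qed
  define I where "I = {k. \<exists>h. rel h k}"
  have "0 \<in> I" using rel_one unfolding I_def by blast
  moreover have "i - j \<in> I" if ij: "i \<in> I" "j \<in> I" for i j
  proof -
    obtain a b where "rel a i" "rel b j" using ij unfolding I_def by blast
    then have "rel (a \<otimes> inv b) (i - j)" using rel_mult rel_inv by fastforce
    then show ?thesis unfolding I_def by blast
  qed
  ultimately obtain k0 where k0: "k0 \<in> I" "\<And>i. i \<in> I \<Longrightarrow> k0 dvd i" using int_subgroup_cyclic[of I] by metis
  obtain h0 where h0: "rel h0 k0" using k0 unfolding I_def by blast
  obtain s where s: "s \<in> H \<inter> Stab v" "H \<inter> Stab v = range (\<lambda>i :: int. s [^] i)"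
    using subgroup_Stab_generated[OF v(1), of "H \<inter> Stab v"]
      subgroups_Inter_pair[OF H_subgroup Stab_subgroup[OF v(1)]] by blast
  define c where "c p = (SOME h. h \<in> H \<and> (\<exists>k. act h v = power_f k p))" for p
  define P' where "P' = {p \<in> P. \<exists>h \<in> H. \<exists>k. act h v = power_f k p}"
  have c: "c p \<in> H \<and> (\<exists>k. act (c p) v = power_f k p)" if p: "p \<in> P'" for p
    unfolding c_def by (rule someI_ex) (use p P'_def in blast)
  define A where "A = insert h0 (insert s (c ` P'))"
  have h0H: "h0 \<in> H" using h0 unfolding rel_def by blast
  have AH: "A \<subseteq> H" using c s h0H unfolding A_def by blast
  have finA: "finite A" using P unfolding A_def P'_def by simp
  have AC: "A \<subseteq> carrier G" using AH HC by blast
  have KH: "generate G A \<subseteq> H" by (rule generate_subgroup_incl[OF AH H_subgroup])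
  have K: "subgroup (generate G A) G" by (rule generate_is_subgroup[OF AC])
  have AK: "a \<in> generate G A" if "a \<in> A" for a using that by (rule generate.incl)
  have "H \<subseteq> generate G A"
  proof
    fix h assume h: "h \<in> H"
    obtain p k where p: "p \<in> P" "act h v = power_f k p" using hvP[OF h] by blast
    then have pP: "p \<in> P'" using h unfolding P'_def by blast
    then obtain k' where k': "c p \<in> H" "act (c p) v = power_f k' p" using c by blast
    let ?g = "inv (c p) \<otimes> h"
    have C: "c p \<in> carrier G" "h \<in> carrier G" and pV: "p \<in> V" using k' h HC p P by auto
    have "power_f (k - k') (act (c p) v) = act h v" using k' p(2) pV by (simp add: power_f_add)
    then have "act h v = act (c p) (power_f (k - k') v)" using power_f_H[OF k'(1) v(1)] by simp
    then have "act ?g v = power_f (k - k') v" using C v power_f_verts by (simp add: act_mult)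
    then have rg: "rel ?g (k - k')"
      using subgroup.m_closed[OF H_subgroup subgroup.m_inv_closed[OF H_subgroup k'(1)] h]
      unfolding rel_def by blast
    then have "k0 dvd k - k'" using k0(2) unfolding I_def by blast
    then obtain j where j: "k - k' = j * k0" by (metis dvd_def mult.commute)
    have "rel (h0 [^] (- j) \<otimes> ?g) 0" using rel_mult[OF rel_pow[OF h0, of "- j"] rg] unfolding j by simp
    then have "h0 [^] (- j) \<otimes> ?g \<in> H \<inter> Stab v" using rel_0 unfolding rel_def by blast
    then obtain i :: int where i: "h0 [^] (- j) \<otimes> ?g = s [^] i" using s(2) by blast
    have "h0 \<in> carrier G" using h0H HC by blast
    then have "h = c p \<otimes> (h0 [^] j \<otimes> s [^] i)"
      using C unfolding i[symmetric] by (simp add: int_pow_neg)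
    moreover have "c p \<in> generate G A" "h0 [^] j \<in> generate G A" "s [^] i \<in> generate G A"
      using AK pow_in_subgroup[OF K] pP unfolding A_def by auto
    ultimately show "h \<in> generate G A" using subgroup.m_closed[OF K] by metis
  qed
  then show ?thesis using KH finA AC unfolding finitely_generated_def by blast
qed

subsection \<open>Inversion on the stabilisers of fixed vertices\<close>

lemma finitely_generated_if_finite_classes:
  assumes "Tf \<noteq> {}" "finite A" "\<And>y. y \<in> Tf \<Longrightarrow> \<iota> y \<in> A"
    and "\<And>y z. \<lbrakk>y \<in> Tf; z \<in> Tf; \<iota> y = \<iota> z\<rbrakk> \<Longrightarrow> \<exists>h \<in> H. act h y = z"
  shows "finitely_generated G H"
proof (rule finitely_generated_if_cofinite[OF H_subgroup convex_fixed assms(1)])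
  define F where "F = (\<lambda>a. SOME y. y \<in> Tf \<and> \<iota> y = a) ` (\<iota> ` Tf)"
  have sel: "(SOME y. y \<in> Tf \<and> \<iota> y = \<iota> x) \<in> Tf \<and> \<iota> (SOME y. y \<in> Tf \<and> \<iota> y = \<iota> x) = \<iota> x" if "x \<in> Tf" for x
    by (rule someI[of _ x]) (use that in auto)
  have "finite (\<iota> ` Tf)" using assms(2,3) finite_subset[of "\<iota> ` Tf" A] by blast
  then show "finite F" unfolding F_def by blast
  show "F \<subseteq> V" using sel unfolding F_def by blast
  show "\<exists>h \<in> H. act h y \<in> F" if y: "y \<in> Tf" for y
  proof -
    define z where "z = (SOME z. z \<in> Tf \<and> \<iota> z = \<iota> y)"
    have z: "z \<in> Tf" "\<iota> y = \<iota> z" using sel[OF y] by (auto simp: z_def)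
    have "z \<in> F" using y unfolding F_def z_def by blast
    then show ?thesis using assms(4)[OF y z] by blast
  qed
qed (use H_act_Tf in auto)

text \<open>
  If \<open>h\<close> is the \<open>j\<close>-th power of the generator of \<open>Stab x\<close>, then multiplying \<open>g\<close> by \<open>h\<close> shifts the exponent of
  the defect by \<open>-2j\<close>. Hence its parity classifies the \<open>H\<close>-orbits of fixed vertices in the orbit of \<open>x\<close>.
\<close>

lemma finitely_generated_inverting:
  assumes nonempty: "Tf \<noteq> {}" and inverting: "\<And>x. x \<in> Tf \<Longrightarrow> \<phi> (gen x) = inv (gen x)"
  shows "finitely_generated G H"
proof -
  obtain F R where F: "finite F" "F \<subseteq> V" "\<And>y. y \<in> V \<Longrightarrow> \<exists>h \<in> carrier G. \<exists>x \<in> F. y = act h x"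
    using quotient_finite by metis
  define b where "b x = (SOME y. y \<in> Tf \<and> (\<exists>g \<in> carrier G. y = act g x))" for x
  define Q where "Q y x k i \<longleftrightarrow> x \<in> F \<and> b x \<in> Tf \<and> k \<in> carrier G \<and> y = act k (b x) \<and>
    defect k = gen (b x) [^] (i :: int)" for y x k i
  have "\<exists>x k i. Q y x k i" if y: "y \<in> Tf" for y
  proof -
    obtain g x where g: "g \<in> carrier G" "x \<in> F" "y = act g x" using F(3)[of y] y by blast
    have "b x \<in> Tf \<and> (\<exists>g \<in> carrier G. b x = act g x)"
      unfolding b_def by (rule someI[of _ y]) (use g y in auto)
    then obtain g' where g': "b x \<in> Tf" "g' \<in> carrier G" "b x = act g' x" by blast
    let ?k = "g \<otimes> inv g'"
    have xV: "x \<in> V" using g F by blast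
    have k: "?k \<in> carrier G" "y = act ?k (b x)" using g g' xV by (auto simp: act_mult)
    then have "defect ?k \<in> Stab (b x)" using defect_Stab_iff[OF g'(1)] y by blast
    then obtain i :: int where "defect ?k = gen (b x) [^] i" using Stab_eq g' by auto
    then show ?thesis using k g g' unfolding Q_def by blast
  qed
  then obtain X k i where XQ: "\<And>y. y \<in> Tf \<Longrightarrow> Q y (X y) (k y) (i y)" by metis
  then have X: "X y \<in> F \<and> b (X y) \<in> Tf \<and> k y \<in> carrier G \<and>
      y = act (k y) (b (X y)) \<and> defect (k y) = gen (b (X y)) [^] (i y :: int)" if "y \<in> Tf" for y
    using that unfolding Q_def by blast
  show ?thesis
  proof (rule finitely_generated_if_finite_classes[OF nonempty])
    show "finite (F \<times> (UNIV :: bool set))" using F by simp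
    show "(X y, even (i y)) \<in> F \<times> UNIV" if "y \<in> Tf" for y using X that by auto
    fix y z assume y: "y \<in> Tf" and z: "z \<in> Tf" and eq: "(X y, even (i y)) = (X z, even (i z))"
    let ?x = "b (X y)"
    have x: "?x \<in> Tf" "?x \<in> V" using X[OF y] by auto
    have k: "k y \<in> carrier G" "k z \<in> carrier G" using X y z by auto
    have "even (i y - i z)" using eq by auto
    then obtain j where j: "i y - i z = 2 * j" by blast
    let ?h = "gen ?x [^] j"
    have h: "?h \<in> Stab ?x" "?h \<in> carrier G" using x by auto
    have "\<phi> ?h = gen ?x [^] (- j)"
      using inverting[OF x(1)] x by (simp add: phi.hom_int_pow int_pow_inv int_pow_neg)
    then have "defect (k y \<otimes> ?h) = inv ?h \<otimes> gen ?x [^] i y \<otimes> gen ?x [^] (- j)"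
      using X[OF y] k h by (simp add: defect_mult)
    also have "inv ?h = gen ?x [^] (- j)" using x by (simp add: int_pow_neg)
    also have "gen ?x [^] (- j) \<otimes> gen ?x [^] i y \<otimes> gen ?x [^] (- j) = gen ?x [^] (- j + i y - j)"
      using x by (simp flip: int_pow_mult)
    also have "- j + i y - j = i z" using j by simp
    also have "gen ?x [^] i z = defect (k z)" using X[OF z] eq by simp
    finally have "k z \<otimes> inv (k y \<otimes> ?h) \<in> H" using defect_eq_H k h by simp
    moreover have "act (k z \<otimes> inv (k y \<otimes> ?h)) y = z"
    proof -
      have "y = act (k y \<otimes> ?h) ?x" using X[OF y] h k x by (simp add: act_mult Stab_iff)
      then have "act (inv (k y \<otimes> ?h)) y = ?x" using k h x act_inv(1)[of "k y \<otimes> ?h" ?x] by simp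
      then show ?thesis using X[OF z] k h y eq by (simp add: act_mult)
    qed
    ultimately show "\<exists>h \<in> H. act h y = z" by blast
  qed
qed

subsection \<open>Trivial action on the stabilisers of fixed vertices\<close>

text \<open>
  The sign by which \<open>\<phi>\<close> acts on a stabiliser can be read off on a nontrivial element common to the
  stabilisers of two fixed vertices.
\<close>

lemma Stab_Tf_subset_H:
  assumes x: "x \<in> Tf" "\<phi> (gen x) = gen x" and y: "y \<in> Tf"
  shows "Stab y \<subseteq> H"
proof -
  have V: "x \<in> V" "y \<in> V" using x y by auto
  have "\<phi> (gen y) = gen y"
  proof (rule ccontr)
    assume "\<phi> (gen y) \<noteq> gen y"
    then have iy: "\<phi> (gen y) = gen y [^] (- 1 :: int)" using phi_gen[OF y] V by (simp add: int_pow_neg)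
    obtain m n :: int where mn: "m \<noteq> 0" "n \<noteq> 0" "gen x [^] m = gen y [^] n" using common_power V by blast
    have "gen x [^] m = \<phi> (gen x [^] m)" using x V by (simp add: phi.hom_int_pow)
    then have "gen y [^] n = \<phi> (gen x [^] m)" by (simp only: mn(3))
    also have "\<phi> (gen x [^] m) = \<phi> (gen y) [^] n"
      unfolding mn(3) using V by (simp only: phi.hom_int_pow gen_closed)
    also have "\<dots> = gen y [^] (- n)" unfolding iy using V by (simp add: int_pow_pow)
    finally show False using V mn by simp
  qed
  then show ?thesis using V by (auto simp: Stab_eq H_iff phi.hom_int_pow)
qed

text \<open>
  Since \<open>\<phi>\<close> is the identity on the abelian group \<open>Stab x\<close>, the defect of \<open>g\<close> only depends on the \<open>H\<close>-orbit of
  \<open>g x\<close>. Infinitely many defects thus yield infinitely many \<open>H\<close>-orbits on \<open>Tf\<close>.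
\<close>

lemma not_finitely_generated_if_many_defects:
  fixes g :: "nat \<Rightarrow> 'g"
  assumes x: "x \<in> Tf" "\<phi> (gen x) = gen x"
    and g: "\<And>k. g k \<in> carrier G" "\<And>k. defect (g k) \<in> Stab x" "inj (\<lambda>k. defect (g k))"
  shows "\<not> finitely_generated G H"
proof
  assume fg: "finitely_generated G H"
  obtain F where F: "finite F" "F \<subseteq> Tf" "\<And>y. y \<in> Tf \<Longrightarrow> \<exists>h \<in> H. \<exists>x \<in> F. y = act h x"
    by (rule finitely_generated_cofinite[OF fg H_subgroup convex_fixed H_act_Tf Stab_Tf_subset_H[OF x]]) auto
  have xV: "x \<in> V" using x by simp
  have "\<forall>k. \<exists>h y. h \<in> H \<and> y \<in> F \<and> act (g k) x = act h y"
  proof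
    fix k
    have "act (g k) x \<in> Tf" using g(1,2)[of k] defect_Stab_iff[OF x(1), of "g k"] by simp
    then show "\<exists>h y. h \<in> H \<and> y \<in> F \<and> act (g k) x = act h y" using F(3) by blast
  qed
  then obtain h y where hy: "\<And>k. h k \<in> H \<and> y k \<in> F \<and> act (g k) x = act (h k) (y k)" by metis
  have "\<not> inj y" using finite_subset[of "range y" F] F(1) hy finite_imageD[of y UNIV] by auto
  then obtain k l where kl: "k \<noteq> l" "y k = y l" by (auto simp: inj_def)
  let ?e = "h k \<otimes> inv (h l)"
  have hC: "h k \<in> carrier G" "h l \<in> carrier G" using hy H_iff by blast+
  have eH: "?e \<in> H" using hy H_subgroup by (meson subgroup.m_closed subgroup.m_inv_closed)
  have yV: "y l \<in> V" using hy F(2) by blast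
  define a where "a = inv (?e \<otimes> g l) \<otimes> g k"
  have aC: "a \<in> carrier G" using hC g by (simp add: a_def)
  have "act (?e \<otimes> g l) x = act (h k) (act (inv (h l)) (act (h l) (y l)))"
    using hC g xV hy[of l] yV by (simp add: act_mult)
  also have "\<dots> = act (g k) x" using hC yV hy[of k] kl by simp
  finally have "a \<in> Stab x" using hC g xV aC unfolding a_def by (simp add: Stab_iff act_mult act_inv_eq)
  then have aH: "\<phi> a = a" using Stab_Tf_subset_H[OF x x(1)] H_iff by blast
  have "g k = (?e \<otimes> g l) \<otimes> a" using hC g unfolding a_def by simp
  then have "defect (g k) = inv a \<otimes> defect (?e \<otimes> g l) \<otimes> a"
    using hC g aC by (simp only: defect_mult m_closed inv_closed aH)
  also have "\<dots> = inv a \<otimes> (defect (g l) \<otimes> a)" using eH g aC by (simp add: defect_H_mult m_assoc)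
  also have "\<dots> = inv a \<otimes> (a \<otimes> defect (g l))" using Stab_commute[OF xV g(2)[of l] \<open>a \<in> Stab x\<close>] by simp
  also have "\<dots> = defect (g l)" using aC g by simp
  finally show False using kl injD[OF g(3)] by blast
qed

end

section \<open>A fundamental subtree and the first Betti number\<close>

context one_free_gbs
begin

text \<open>
  The hypothesis on \<open>X\<close> says that arcs of \<open>Y\<close> can be rotated into \<open>X\<close> around their initial vertex. As \<open>H\<close>
  contains the rotations, the geodesic from \<open>v0\<close> to \<open>y\<close> can be folded into \<open>X\<close> arc by arc.
\<close>

lemma orbit_representatives:
  assumes Y: "convex Y" "v0 \<in> Y" and inv: "\<And>h y. \<lbrakk>h \<in> H; y \<in> Y\<rbrakk> \<Longrightarrow> act h y \<in> Y"
    and H: "subgroup H G" and stab: "\<And>y. y \<in> Y \<Longrightarrow> Stab y \<subseteq> H"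
    and X: "v0 \<in> X" "\<And>x y. \<lbrakk>x \<in> X; x \<in> Y; y \<in> Y; (x, y) \<in> parcs T\<rbrakk> \<Longrightarrow> \<exists>k \<in> Stab x. act k y \<in> X"
    and y: "y \<in> Y"
  shows "\<exists>h \<in> H. act h y \<in> X"
proof -
  have YV: "Y \<subseteq> V" using convex_sub Y by blast
  have "y \<in> V" "v0 \<in> V" using YV y Y by auto
  then have "y \<in> Y \<longrightarrow> (\<exists>h \<in> H. act h y \<in> X)"
  proof (induction rule: toward_induct)
    case base
    show ?case using X(1) subgroup.one_closed[OF H] YV Y by (auto intro!: bexI[of _ \<one>])
  next
    case (step y)
    show ?case
    proof
      assume y: "y \<in> Y"
      let ?z = "toward T y v0"
      have z: "?z \<in> Y" "(?z, y) \<in> parcs T"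
        using convexD[OF Y(1) Y(2) y] step toward_arc[of y v0] YV Y arcs_symmetric by auto
      obtain h where h: "h \<in> H" "act h ?z \<in> X" using step z by blast
      have hC: "h \<in> carrier G" using h subgroup.subset[OF H] by blast
      obtain k where k: "k \<in> Stab (act h ?z)" "act k (act h y) \<in> X"
        using X(2)[OF h(2), of "act h y"] inv[OF h(1)] z y act_arc[OF hC] by blast
      then have kC: "k \<in> carrier G" "k \<in> H" using stab inv h z Stab_closed by blast+
      have "act (k \<otimes> h) y \<in> X" using k kC hC y YV by (simp add: act_mult subset_iff)
      then show "\<exists>h \<in> H. act h y \<in> X" using subgroup.m_closed[OF H kC(2) h(1)] by blast
    qed
  qed
  then show ?thesis using y by blast
qed

abbreviation edge_orbit :: "'v set \<Rightarrow> 'v set set" where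
  "edge_orbit e \<equiv> orbit G (edge_action act) e"

lemma edge_orbit_iff:
  assumes "e \<subseteq> V" "e' \<subseteq> V"
  shows "edge_orbit e = edge_orbit e' \<longleftrightarrow> (\<exists>g \<in> carrier G. e' = act g ` e)"
proof -
  have self: "e \<in> edge_orbit e" if "e \<subseteq> V" for e
  proof -
    have "act \<one> ` e = e" using that by (auto simp: subset_iff image_iff)
    then show ?thesis unfolding orbit_def edge_action_def by force
  qed
  have comp: "act g ` act h ` e = act (g \<otimes> h) ` e" if "e \<subseteq> V" "g \<in> carrier G" "h \<in> carrier G" for e g h
    unfolding image_image using that by (intro image_cong refl) (auto simp: act_mult)
  have sub: "edge_orbit (act g ` e) \<subseteq> edge_orbit e" if "e \<subseteq> V" "g \<in> carrier G" for e g
  proof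
    fix x assume "x \<in> edge_orbit (act g ` e)"
    then obtain h where h: "h \<in> carrier G" "x = act h ` act g ` e"
      unfolding orbit_def edge_action_def by blast
    then have "x = act (h \<otimes> g) ` e" "h \<otimes> g \<in> carrier G" using comp[OF that(1) h(1) that(2)] that by auto
    then show "x \<in> edge_orbit e" unfolding orbit_def edge_action_def by blast
  qed
  show ?thesis
  proof
    assume "edge_orbit e = edge_orbit e'"
    then have "e' \<in> edge_orbit e" using self assms by blast
    then show "\<exists>g \<in> carrier G. e' = act g ` e" by (auto simp: orbit_def edge_action_def)
  next
    assume "\<exists>g \<in> carrier G. e' = act g ` e"
    then obtain g where g: "g \<in> carrier G" "e' = act g ` e" by blast
    have "act (inv g) ` e' = e"
    proof -
      have "act (inv g) ` e' = act (inv g \<otimes> g) ` e" using g comp[of e "inv g" g] assms by simp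
      also have "\<dots> = e" using g assms by (auto simp: subset_iff image_iff)
      finally show ?thesis .
    qed
    then show "edge_orbit e = edge_orbit e'" using sub[of e g] sub[of e' "inv g"] g assms by auto
  qed
qed

lemma edge_orbit_pair:
  assumes "x \<in> V" "y \<in> V" "x' \<in> V" "y' \<in> V"
  shows "edge_orbit {x, y} = edge_orbit {x', y'} \<longleftrightarrow>
    (\<exists>g \<in> carrier G. (act g x = x' \<and> act g y = y') \<or> (act g x = y' \<and> act g y = x'))"
  using edge_orbit_iff[of "{x, y}" "{x', y'}"] assms by (auto simp: doubleton_eq_iff)

end

locale fundamental_subtree = one_free_gbs G T act
  for G :: "('g, 'm) monoid_scheme" (structure) and T :: "'v pair_pre_digraph"
    and act :: "'g \<Rightarrow> 'v \<Rightarrow> 'v" +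
  fixes v0 :: 'v and S :: "'v set"
  assumes S_finite: "finite S" and S_verts: "S \<subseteq> V" and v0_S: "v0 \<in> S"
    and S_closed: "\<lbrakk>s \<in> S; s \<noteq> v0\<rbrakk> \<Longrightarrow> toward T s v0 \<in> S"
    and S_unique: "\<lbrakk>g \<in> carrier G; s \<in> S; act g s \<in> S\<rbrakk> \<Longrightarrow> act g s = s"
    and S_covers: "y \<in> V \<Longrightarrow> \<exists>g \<in> carrier G. act g y \<in> S"

text \<open>
  A subtree containing \<open>v0\<close> that meets every orbit at most once, with as many vertices as possible. If it
  missed an orbit, it could be enlarged by a neighbour, since \<open>T\<close> is connected.
\<close>

lemma (in one_free_gbs) fundamental_subtree_exists:
  assumes v0: "v0 \<in> V"
  shows "\<exists>S. fundamental_subtree G T act v0 S"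
proof -
  obtain F where F: "finite F" "F \<subseteq> V" "\<And>y. y \<in> V \<Longrightarrow> \<exists>h \<in> carrier G. \<exists>x \<in> F. y = act h x"
    by (rule quotient_finite) auto
  define P where "P S \<longleftrightarrow> finite S \<and> S \<subseteq> V \<and> v0 \<in> S \<and> (\<forall>s \<in> S. s \<noteq> v0 \<longrightarrow> toward T s v0 \<in> S) \<and>
    (\<forall>g \<in> carrier G. \<forall>s \<in> S. act g s \<in> S \<longrightarrow> act g s = s)" for S
  have "card S \<le> card F" if S: "P S" for S
  proof -
    define r where "r s = (SOME x. x \<in> F \<and> (\<exists>h \<in> carrier G. s = act h x))" for s
    have r: "r s \<in> F \<and> (\<exists>h \<in> carrier G. s = act h (r s))" if s: "s \<in> S" for s
    proof -
      have "s \<in> V" using s S unfolding P_def by blast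
      then have "\<exists>x. x \<in> F \<and> (\<exists>h \<in> carrier G. s = act h x)" using F(3) by blast
      then show ?thesis unfolding r_def by (rule someI_ex)
    qed
    have "inj_on r S"
    proof (rule inj_onI)
      fix s s' assume s: "s \<in> S" "s' \<in> S" "r s = r s'"
      obtain h where h1: "h \<in> carrier G" "s = act h (r s)" using r[OF s(1)] by blast
      obtain h' where h2: "h' \<in> carrier G" "s' = act h' (r s')" using r[OF s(2)] by blast
      note h = h1 h2[folded s(3)]
      have rV: "r s \<in> V" using r[OF s(1)] F(2) by blast
      have sV: "s \<in> V" using S s unfolding P_def by blast
      have "act (inv h) s = r s" using act_inv(1)[OF h(1) rV] unfolding h(2)[symmetric] .
      then have "act (h' \<otimes> inv h) s = act h' (r s)" using h(1,3) sV by (simp add: act_mult)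
      then have e: "act (h' \<otimes> inv h) s = s'" unfolding h(4)[symmetric] .
      moreover have "act (h' \<otimes> inv h) s = s"
        using S s(1,2) h(1,3) unfolding P_def by (metis e inv_closed m_closed)
      ultimately show "s = s'" by simp
    qed
    then show ?thesis using r F(1) by (intro card_inj_on_le[of r]) auto
  qed
  moreover have "P {v0}" using v0 by (auto simp: P_def)
  ultimately obtain S where S: "P S" "\<And>S'. P S' \<Longrightarrow> card S' \<le> card S"
    using ex_has_greatest_nat[of P "{v0}" card "Suc (card F)"] le_imp_less_Suc by blast
  have SV: "finite S" "S \<subseteq> V" "v0 \<in> S" "\<And>s. \<lbrakk>s \<in> S; s \<noteq> v0\<rbrakk> \<Longrightarrow> toward T s v0 \<in> S"
    "\<And>g s. \<lbrakk>g \<in> carrier G; s \<in> S; act g s \<in> S\<rbrakk> \<Longrightarrow> act g s = s"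
    using S(1) unfolding P_def by auto
  have "\<exists>g \<in> carrier G. act g y \<in> S" if "y \<in> V" for y
    using that v0
  proof (induction rule: tree_induct)
    case base
    show ?case using SV v0 by (intro bexI[of _ \<one>]) auto
  next
    case (step y z)
    have zV: "z \<in> V" using step arc_verts by blast
    obtain g where g: "g \<in> carrier G" "act g y \<in> S" using step by blast
    show ?case
    proof (rule ccontr)
      assume no: "\<not> (\<exists>g \<in> carrier G. act g z \<in> S)"
      let ?z = "act g z"
      have z: "?z \<notin> S" "?z \<in> V" "(act g y, ?z) \<in> parcs T" using no g step act_arc zV by auto
      have tz: "toward T ?z v0 = act g y"
        using z(3) v0 by (rule arc_cases) (use SV g z in auto)
      have "P (insert ?z S)"
        unfolding P_def
      proof (intro conjI ballI impI)
        show "finite (insert ?z S)" "insert ?z S \<subseteq> V" "v0 \<in> insert ?z S" using SV z by auto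
        show "toward T s v0 \<in> insert ?z S" if "s \<in> insert ?z S" "s \<noteq> v0" for s
          using that SV(4) tz g by auto
        fix h s assume h: "h \<in> carrier G" and s: "s \<in> insert ?z S" and hs: "act h s \<in> insert ?z S"
        consider "s \<in> S" "act h s \<in> S" | "s = ?z" "act h s \<in> S" | "s \<in> S" "act h s = ?z"
          | "s = ?z" "act h s = ?z" using s hs by blast
        then show "act h s = s"
        proof cases
          case 2
          then have "act (h \<otimes> g) z \<in> S" using h g zV by (simp add: act_mult)
          then show ?thesis using no h g by blast
        next
          case 3
          then have "s = act (inv h) ?z" using h SV by (metis act_inv(1) subsetD)
          then have "act (inv h \<otimes> g) z \<in> S" using h g zV 3 by (simp add: act_mult)
          then show ?thesis using no h g by blast
        qed (use SV h in auto)
      qed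
      then have "card (insert ?z S) \<le> card S" by (rule S(2))
      then show False using SV z by simp
    qed
  qed
  with SV have "fundamental_subtree G T act v0 S" by unfold_locales
  then show ?thesis by (rule exI)
qed

context fundamental_subtree
begin

lemma S_V [simp]: "s \<in> S \<Longrightarrow> s \<in> V"
  using S_verts by blast

lemma v0_V [simp]: "v0 \<in> V"
  using v0_S by simp

text \<open>
  The arcs in the orbit of an arc of the fundamental subtree.
\<close>

definition inner :: "'v \<Rightarrow> 'v \<Rightarrow> bool" where
  "inner x y \<longleftrightarrow> (\<exists>g \<in> carrier G. act g x \<in> S \<and> act g y \<in> S)"

lemma inner_lift: "\<lbrakk>s \<in> S; inner s y\<rbrakk> \<Longrightarrow> \<exists>k \<in> Stab s. act k y \<in> S"
  unfolding inner_def using S_unique by (auto simp: Stab_iff)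

lemma inner_act: "\<lbrakk>g \<in> carrier G; x \<in> V; y \<in> V\<rbrakk> \<Longrightarrow> inner (act g x) (act g y) \<longleftrightarrow> inner x y"
proof
  assume g: "g \<in> carrier G" "x \<in> V" "y \<in> V"
  {
    assume "inner x y"
    then obtain h where h: "h \<in> carrier G" "act h x \<in> S" "act h y \<in> S" unfolding inner_def by blast
    then show "inner (act g x) (act g y)"
      using g unfolding inner_def by (intro bexI[of _ "h \<otimes> inv g"]) (auto simp: act_mult)
  next
    assume "inner (act g x) (act g y)"
    then obtain h where h: "h \<in> carrier G" "act h (act g x) \<in> S" "act h (act g y) \<in> S"
      unfolding inner_def by blast
    then show "inner x y" using g unfolding inner_def by (intro bexI[of _ "h \<otimes> g"]) (auto simp: act_mult)
  }
qed

lemma S_induct [consumes 1, case_names base step]: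
  assumes "s \<in> S" "P v0" "\<And>s. \<lbrakk>s \<in> S; s \<noteq> v0; toward T s v0 \<in> S; P (toward T s v0)\<rbrakk> \<Longrightarrow> P s"
  shows "P s"
proof -
  have "s \<in> V" using assms by simp
  from this v0_V have "s \<in> S \<longrightarrow> P s"
    by (induction rule: toward_induct) (use assms S_closed in auto)
  then show ?thesis using assms by blast
qed

definition extra_orbits :: "'v set set set" where
  "extra_orbits = {edge_orbit {x, y} | x y. (x, y) \<in> parcs T \<and> \<not> inner x y}"

lemma inner_edge_orbit:
  assumes "x \<in> V" "y \<in> V" "x' \<in> V" "y' \<in> V" "edge_orbit {x, y} = edge_orbit {x', y'}"
  shows "inner x y \<longleftrightarrow> inner x' y'"
proof -
  obtain g where g: "g \<in> carrier G" "(act g x = x' \<and> act g y = y') \<or> (act g x = y' \<and> act g y = x')"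
    using edge_orbit_pair[OF assms(1-4)] assms(5) by blast
  moreover have "inner x' y' \<longleftrightarrow> inner y' x'" by (auto simp: inner_def)
  ultimately show ?thesis using inner_act[OF g(1) assms(1,2)] by auto
qed

text \<open>
  The edges of \<open>S\<close> correspond to the vertices of \<open>S\<close> other than \<open>v0\<close>, and no two of them are in the same
  orbit. So the edge orbits that miss \<open>S\<close> account for the excess of edges over vertices in \<open>T / G\<close>.
\<close>

lemma betti_eq: "betti G T act = int (card extra_orbits)" and finite_extra_orbits: "finite extra_orbits"
proof -
  have vo: "orbits G V act = orbit G act ` S"
  proof -
    have "orbit G act y \<in> orbit G act ` S" if y: "y \<in> V" for y
    proof -
      obtain g where g: "g \<in> carrier G" "act g y \<in> S" using S_covers y by blast
      have "orbit G act (act g y) = orbit G act y"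
      proof -
        have "orbit G act (act g y) \<subseteq> orbit G act y" if "g \<in> carrier G" "y \<in> V" for g y
        proof
          fix x assume "x \<in> orbit G act (act g y)"
          then obtain h where "h \<in> carrier G" "x = act h (act g y)" unfolding orbit_def by blast
          then have "x = act (h \<otimes> g) y" "h \<otimes> g \<in> carrier G" using that by (auto simp: act_mult)
          then show "x \<in> orbit G act y" unfolding orbit_def by blast
        qed
        from this[OF g(1) y] this[of "inv g" "act g y"] show ?thesis using g y by auto
      qed
      then show ?thesis using g by blast
    qed
    then show ?thesis unfolding orbits_def by auto
  qed
  have "inj_on (orbit G act) S"
  proof (rule inj_onI)
    fix s s' assume s: "s \<in> S" "s' \<in> S" "orbit G act s = orbit G act s'"
    then have "s' \<in> orbit G act s" using orbit_refl by simp
    then obtain g where g: "g \<in> carrier G" "act g s = s'" by (auto simp: orbit_def)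
    have "act g s = s" using S_unique[OF g(1) s(1)] g s by simp
    then show "s = s'" using g by simp
  qed
  then have card_v: "card (orbits G V act) = card S" using vo card_image by metis
  define I where "I = (\<lambda>s. edge_orbit {s, toward T s v0}) ` (S - {v0})"
  have tw: "toward T s v0 \<in> S" "(s, toward T s v0) \<in> parcs T" if "s \<in> S - {v0}" for s
    using that S_closed toward_arc[of s v0] by auto
  have "inj_on (\<lambda>s. edge_orbit {s, toward T s v0}) (S - {v0})"
  proof (rule inj_onI)
    fix s s' assume s: "s \<in> S - {v0}" "s' \<in> S - {v0}"
      and eq: "edge_orbit {s, toward T s v0} = edge_orbit {s', toward T s' v0}"
    have inS: "s \<in> S" "s' \<in> S" "toward T s v0 \<in> S" "toward T s' v0 \<in> S" using s tw by auto
    obtain g where g: "g \<in> carrier G"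
      "(act g s = s' \<and> act g (toward T s v0) = toward T s' v0) \<or> (act g s = toward T s' v0 \<and> act g (toward T s v0) = s')"
      using edge_orbit_pair[of s "toward T s v0" s' "toward T s' v0"] eq inS by auto
    then have "s = s' \<or> (s = toward T s' v0 \<and> toward T s v0 = s')" using S_unique[OF g(1)] inS by metis
    moreover have "tdist T s v0 = Suc (tdist T (toward T s v0) v0)" "tdist T s' v0 = Suc (tdist T (toward T s' v0) v0)"
      using toward_dist[of s v0] toward_dist[of s' v0] s by auto
    ultimately show "s = s'" by auto
  qed
  then have card_I: "card I = card S - 1" using v0_S S_finite unfolding I_def by (simp add: card_image)
  have inner_I: "edge_orbit {x, y} \<in> I" if xy: "(x, y) \<in> parcs T" "inner x y" for x y
  proof -
    obtain g where g: "g \<in> carrier G" "act g x \<in> S" "act g y \<in> S" using xy unfolding inner_def by blast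
    have V: "x \<in> V" "y \<in> V" using arc_verts xy by auto
    have arc: "(act g x, act g y) \<in> parcs T" using g xy act_arc by blast
    have eo: "edge_orbit {x, y} = edge_orbit {act g x, act g y}" using V g by (subst edge_orbit_pair) auto
    show ?thesis using arc v0_V
    proof (cases rule: arc_cases)
      case 1
      then show ?thesis unfolding I_def eo using g by (intro image_eqI[of _ _ "act g x"]) auto
    next
      case 2
      then show ?thesis unfolding I_def eo using g by (intro image_eqI[of _ _ "act g y"]) (auto simp: insert_commute)
    qed
  qed
  have orb: "orbits G (undirected_edges T) (edge_action act) = I \<union> extra_orbits"
  proof
    show "orbits G (undirected_edges T) (edge_action act) \<subseteq> I \<union> extra_orbits"
      using inner_I unfolding orbits_def undirected_edges_def extra_orbits_def by blast
    show "I \<union> extra_orbits \<subseteq> orbits G (undirected_edges T) (edge_action act)"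
      using tw unfolding orbits_def undirected_edges_def extra_orbits_def I_def by blast
  qed
  have disj: "I \<inter> extra_orbits = {}"
  proof (rule ccontr)
    assume "I \<inter> extra_orbits \<noteq> {}"
    then obtain s x y where s: "s \<in> S - {v0}" "edge_orbit {s, toward T s v0} = edge_orbit {x, y}"
      "(x, y) \<in> parcs T" "\<not> inner x y" unfolding I_def extra_orbits_def by blast
    have "inner s (toward T s v0)" using tw[OF s(1)] s(1) unfolding inner_def by (intro bexI[of _ \<one>]) auto
    moreover have "s \<in> V" "toward T s v0 \<in> V" using s tw by auto
    ultimately show False using inner_edge_orbit s arc_verts by blast
  qed
  have fin: "finite (orbits G (undirected_edges T) (edge_action act))"
  proof -
    obtain R where R: "finite R" "R \<subseteq> parcs T"
      "\<And>x y. (x, y) \<in> parcs T \<Longrightarrow> \<exists>h \<in> carrier G. \<exists>(a, b) \<in> R. x = act h a \<and> y = act h b"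
      by (rule quotient_finite) auto
    have "orbits G (undirected_edges T) (edge_action act) \<subseteq> (\<lambda>(a, b). edge_orbit {a, b}) ` R"
    proof
      fix o' assume "o' \<in> orbits G (undirected_edges T) (edge_action act)"
      then obtain x y where xy: "(x, y) \<in> parcs T" "o' = edge_orbit {x, y}"
        unfolding orbits_def undirected_edges_def by blast
      then obtain h a b where h: "h \<in> carrier G" "(a, b) \<in> R" "x = act h a" "y = act h b" using R(3) by blast
      have "a \<in> V" "b \<in> V" "x \<in> V" "y \<in> V" using h R arc_verts xy by auto
      then have "edge_orbit {a, b} = edge_orbit {x, y}" using h by (subst edge_orbit_pair) auto
      then have "o' = (\<lambda>(a, b). edge_orbit {a, b}) (a, b)" using xy by simp
      then show "o' \<in> (\<lambda>(a, b). edge_orbit {a, b}) ` R" using h(2) by (rule image_eqI)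
    qed
    then show ?thesis by (rule finite_subset) (use R(1) in simp)
  qed
  then show fx: "finite extra_orbits" using orb by simp
  have "finite I" using fin orb by simp
  then have "card (orbits G (undirected_edges T) (edge_action act)) = card I + card extra_orbits"
    unfolding orb using fx disj by (intro card_Un_disjoint)
  moreover have "card S \<ge> 1" using v0_S S_finite by (metis One_nat_def Suc_leI card_gt_0_iff empty_iff)
  ultimately show "betti G T act = int (card extra_orbits)"
    unfolding betti_def card_v card_I by simp
qed

text \<open>
  An arc outside the orbit of \<open>S\<close> can be translated to start in \<open>S\<close>; its end is then in a translate of \<open>S\<close>.
  The element \<open>t\<close> performing this translation closes up a loop in \<open>T / G\<close>, like a stable letter of an
  HNN extension.
\<close>

definition loop :: "'v \<Rightarrow> 'g \<Rightarrow> 'v \<Rightarrow> bool" where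
  "loop u t u' \<longleftrightarrow> u \<in> S \<and> u' \<in> S \<and> t \<in> carrier G \<and> (u, act t u') \<in> parcs T \<and> \<not> inner u (act t u')"

lemma extra_orbit_loop:
  assumes "o' \<in> extra_orbits"
  obtains u t u' where "loop u t u'" "o' = edge_orbit {u, act t u'}"
proof -
  obtain x y where xy: "(x, y) \<in> parcs T" "\<not> inner x y" "o' = edge_orbit {x, y}"
    using assms unfolding extra_orbits_def by blast
  have V: "x \<in> V" "y \<in> V" using arc_verts xy by auto
  obtain g where g: "g \<in> carrier G" "act g x \<in> S" using S_covers V by blast
  obtain k where k: "k \<in> carrier G" "act k (act g y) \<in> S" using S_covers[of "act g y"] g V by auto
  have e: "act (inv k) (act k (act g y)) = act g y" using g k V by simp
  have "loop (act g x) (inv k) (act k (act g y))"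
    using xy g k V act_arc inner_act unfolding loop_def e by simp
  moreover have "o' = edge_orbit {act g x, act (inv k) (act k (act g y))}"
    unfolding e xy(3) using V g by (subst edge_orbit_pair) auto
  ultimately show ?thesis using that by blast
qed

lemma loop_reverse:
  assumes "loop u t u'"
  shows "loop u' (inv t) u" "edge_orbit {u', act (inv t) u} = edge_orbit {u, act t u'}"
proof -
  have l: "u \<in> S" "u' \<in> S" "t \<in> carrier G" "(u, act t u') \<in> parcs T" "\<not> inner u (act t u')"
    using assms unfolding loop_def by auto
  have eq: "edge_orbit {u', act (inv t) u} = edge_orbit {u, act t u'}"
    using l by (subst edge_orbit_pair) (auto intro!: bexI[of _ t])
  then show "edge_orbit {u', act (inv t) u} = edge_orbit {u, act t u'}" .
  have "(act (inv t) (act t u'), act (inv t) u) \<in> parcs T" using l arcs_symmetric by (intro act_arc) auto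
  moreover have "\<not> inner u' (act (inv t) u)" using inner_edge_orbit[OF _ _ _ _ eq] l by simp
  ultimately show "loop u' (inv t) u" using l unfolding loop_def by simp
qed

lemma betti_0_inner: "\<lbrakk>betti G T act = 0; (x, y) \<in> parcs T\<rbrakk> \<Longrightarrow> inner x y"
  using betti_eq finite_extra_orbits unfolding extra_orbits_def by auto

lemma betti_1_loop:
  assumes "betti G T act = 1"
  obtains u t u' where "loop u t u'"
    "\<And>x y. (x, y) \<in> parcs T \<Longrightarrow> inner x y \<or> edge_orbit {x, y} = edge_orbit {u, act t u'}"
proof -
  obtain o' where o': "extra_orbits = {o'}" using assms betti_eq by (auto simp: card_1_singleton_iff)
  obtain u t u' where u: "loop u t u'" "o' = edge_orbit {u, act t u'}" using extra_orbit_loop[of o'] o' by blast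
  have "inner x y \<or> edge_orbit {x, y} = edge_orbit {u, act t u'}" if "(x, y) \<in> parcs T" for x y
    using that o' u unfolding extra_orbits_def by blast
  then show ?thesis using that u by blast
qed

lemma betti_2_loops:
  assumes "betti G T act \<noteq> 0" "betti G T act \<noteq> 1"
  obtains u t u' w s w' where "loop u t u'" "loop w s w'" "edge_orbit {u, act t u'} \<noteq> edge_orbit {w, act s w'}"
proof -
  have "card extra_orbits \<ge> 2" using assms betti_eq by linarith
  then obtain o1 o2 where "o1 \<in> extra_orbits" "o2 \<in> extra_orbits" "o1 \<noteq> o2"
    by (auto simp: numeral_2_eq_2 card_le_Suc_iff)
  then show ?thesis using that extra_orbit_loop by metis
qed

end

section \<open>The modular image when the quotient graph has a single loop\<close>

lemma group_rat_units: "group rat_units"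
proof (rule groupI)
  fix x assume "x \<in> carrier rat_units"
  then show "\<exists>y \<in> carrier rat_units. y \<otimes>\<^bsub>rat_units\<^esub> x = \<one>\<^bsub>rat_units\<^esub>"
    by (intro bexI[of _ "inverse x"]) (auto simp: rat_units_def)
qed (auto simp: rat_units_def)

lemma generate_rat_units:
  assumes "r \<noteq> 0"
  shows "generate rat_units {r} = range (\<lambda>k :: int. r powi k)"
proof -
  interpret R: group rat_units by (rule group_rat_units)
  have rC: "r \<in> carrier rat_units" using assms by (simp add: rat_units_def)
  have npow: "r [^]\<^bsub>rat_units\<^esub> n = r ^ n" for n :: nat
    by (induction n) (auto simp: rat_units_def nat_pow_def)
  have ipow: "r [^]\<^bsub>rat_units\<^esub> k = r powi k" for k :: int
  proof -
    have "inv\<^bsub>rat_units\<^esub> x = inverse x" if "x \<noteq> 0" for x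
      using that by (intro R.inv_equality) (auto simp: rat_units_def)
    then show ?thesis using assms by (auto simp: int_pow_def2 npow power_int_def power_inverse)
  qed
  show ?thesis using R.generate_pow[OF rC] ipow by auto
qed

text \<open>
  If \<open>r = p / q\<close> in lowest terms, then every power of \<open>q\<close> divides \<open>m 0\<close>.
\<close>

lemma rat_integer_if_orbit_integral:
  fixes r :: rat and m :: "nat \<Rightarrow> int"
  assumes "m 0 \<noteq> 0" "\<And>j. of_int (m (Suc j)) = r * of_int (m j)"
  shows "r \<in> \<int>"
proof -
  obtain p q where pq: "quotient_of r = (p, q)" by (cases "quotient_of r")
  have q: "q > 0" "coprime p q" "r = of_int p / of_int q"
    using quotient_of_denom_pos[OF pq] quotient_of_coprime[OF pq] quotient_of_div[OF pq] by auto
  have step: "q * m (Suc j) = p * m j" for j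
  proof -
    have "of_int (q * m (Suc j)) = (of_int (p * m j) :: rat)"
      using assms(2)[of j] q by (simp add: field_simps)
    then show ?thesis by (simp only: of_int_eq_iff)
  qed
  have "q ^ j dvd m i" for j i
  proof (induction j arbitrary: i)
    case (Suc j)
    have "q ^ Suc j dvd q * m (Suc i)" using Suc.IH[of "Suc i"] by simp
    then have "q ^ Suc j dvd p * m i" using step[of i] by simp
    moreover have "coprime (q ^ Suc j) p" using q(2) by (simp add: coprime_commute)
    ultimately show ?case using coprime_dvd_mult_right_iff by blast
  qed simp
  then have dvd: "q ^ j dvd m 0" for j by blast
  have "q = 1"
  proof (rule ccontr)
    assume "q \<noteq> 1"
    then have "q \<ge> 2" using q by simp
    then have "2 ^ nat \<bar>m 0\<bar> \<le> q ^ nat \<bar>m 0\<bar>" by (intro power_mono) auto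
    moreover have "q ^ nat \<bar>m 0\<bar> \<le> \<bar>m 0\<bar>" using dvd_imp_le_int[OF assms(1) dvd[of "nat \<bar>m 0\<bar>"]] q(1) by simp
    moreover have "int (nat \<bar>m 0\<bar>) < 2 ^ nat \<bar>m 0\<bar>" by (metis less_exp of_nat_less_numeral_power_cancel_iff of_nat_numeral)
    ultimately show False by simp
  qed
  then show ?thesis using q by simp
qed

text \<open>
  The generators of a cyclic group of nonzero rationals are \<open>r\<close> and its inverse, except that the group
  generated by \<open>-1\<close> is \<open>{1, -1}\<close>; so this is the condition on \<open>\<Delta>(G)\<close> in terms of a generator.
\<close>

lemma powi_range_integer_condition:
  fixes r :: rat
  assumes r0: "r \<noteq> 0"
  shows "(range (\<lambda>k :: int. r powi k) = {1, -1} \<or> \<not> generated_by_integer (range (\<lambda>k :: int. r powi k)))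
    \<longleftrightarrow> \<not> ((r \<in> \<int> \<or> inverse r \<in> \<int>) \<and> r \<noteq> -1)"
proof -
  let ?D = "range (\<lambda>k :: int. r powi k)"
  have rD: "r \<in> ?D" by (rule range_eqI[of _ _ 1]) simp
  have gen: "generated_by_integer ?D \<longleftrightarrow> (\<exists>n :: int. n \<noteq> 0 \<and> ?D = range (\<lambda>k :: int. (of_int n :: rat) powi k))"
    unfolding generated_by_integer_def using generate_rat_units by (metis of_int_eq_0_iff)
  have D1: "?D = {1, -1} \<longleftrightarrow> r = -1"
  proof
    assume D: "?D = {1, -1}"
    then have "r = 1 \<or> r = -1" using rD by blast
    moreover have "r \<noteq> 1" using D by auto
    ultimately show "r = -1" by blast
  next
    assume "r = -1"
    then have "?D \<subseteq> {1, -1}" "r powi 0 = 1" "r powi 1 = -1" by (auto simp: power_int_minus_left)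
    then show "?D = {1, -1}" by (metis empty_subsetI insert_subset rangeI subset_antisym)
  qed
  have D2: "generated_by_integer ?D \<longleftrightarrow> r \<in> \<int> \<or> inverse r \<in> \<int>"
  proof
    assume "generated_by_integer ?D"
    then obtain n :: int where n: "n \<noteq> 0" "?D = range (\<lambda>k :: int. (of_int n :: rat) powi k)" using gen by blast
    then obtain j :: int where j: "r = of_int n powi j" using rD by auto
    have "of_int n \<in> ?D" unfolding n(2) by (rule range_eqI[of _ _ 1]) simp
    then obtain i :: int where i: "of_int n = r powi i" by auto
    have e: "r powi (i * j) = r" using i j by (simp add: power_int_mult)
    show "r \<in> \<int> \<or> inverse r \<in> \<int>"
    proof (cases "\<bar>r\<bar> = 1")
      case True
      then have "r = 1 \<or> r = -1" by linarith
      then show ?thesis by auto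
    next
      case False
      have "i * j = 1"
      proof -
        have "\<bar>r\<bar> powi (i * j) = \<bar>r\<bar> powi 1" using e by (simp flip: power_int_abs)
        then show ?thesis
          using power_int_strict_increasing[of "i * j" 1 "\<bar>r\<bar>"] power_int_strict_increasing[of 1 "i * j" "\<bar>r\<bar>"]
            power_int_strict_decreasing[of "i * j" 1 "\<bar>r\<bar>"] power_int_strict_decreasing[of 1 "i * j" "\<bar>r\<bar>"]
            False r0 by (cases "i * j" "1 :: int" rule: linorder_cases; cases "\<bar>r\<bar> < 1") auto
      qed
      then have "j = 1 \<or> j = -1" by (metis mult.commute pos_zmult_eq_1_iff_lemma zmult_eq_1_iff)
      then show ?thesis using j by (auto simp: power_int_minus)
    qed
  next
    assume "r \<in> \<int> \<or> inverse r \<in> \<int>"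
    then show "generated_by_integer ?D"
    proof
      assume "r \<in> \<int>"
      then obtain n where "r = of_int n" by (auto elim: Ints_cases)
      then show ?thesis using r0 gen by auto
    next
      assume "inverse r \<in> \<int>"
      then obtain n where n: "inverse r = of_int n" by (auto elim: Ints_cases)
      have "?D = range (\<lambda>k :: int. (of_int n :: rat) powi k)"
      proof -
        have "r powi k = of_int n powi (- k)" for k
          using n[symmetric] by (simp add: power_int_minus power_int_inverse)
        then have "?D = range ((\<lambda>k. (of_int n :: rat) powi k) \<circ> uminus)" by (simp add: comp_def)
        also have "\<dots> = range (\<lambda>k :: int. (of_int n :: rat) powi k)"
          by (metis image_comp surj_uminus)
        finally show ?thesis .
      qed
      moreover have "n \<noteq> 0" using n r0 by auto
      ultimately show ?thesis using gen by blast
    qed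
  qed
  show ?thesis using D1 D2 by blast
qed

lemma (in gbs) modular_pow:
  assumes t: "t \<in> carrier G"
  shows "\<Delta> (t [^] (k :: int)) = \<Delta> t powi k"
proof (induction k rule: int_induct[of _ 0])
  case base
  then show ?case using modular_one by simp
next
  case (step1 k)
  have "\<Delta> (t [^] (k + 1)) = \<Delta> (t [^] k) * \<Delta> t" using t by (simp add: int_pow_mult modular_mult)
  then show ?case using step1 modular_nonzero[OF t] by (simp add: power_int_add)
next
  case (step2 k)
  have "\<Delta> (t [^] (k - 1)) = \<Delta> (t [^] k) * inverse (\<Delta> t)" using t by (simp add: int_pow_diff modular_mult modular_inv)
  then show ?case using step2 modular_nonzero[OF t] by (simp add: power_int_diff field_simps)
qed

context fundamental_subtree
begin

text \<open>
  If there is only one loop, the translates of \<open>S\<close> under powers of \<open>t\<close> form a tree in which every arc of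
  \<open>T\<close> starting there can be rotated: it either stays in its translate of \<open>S\<close>, or is one of the two arcs at
  this translate that cover the loop.
\<close>

lemma loop_lift:
  fixes k :: int
  assumes loop: "loop u t u'"
    and single: "\<And>x y. (x, y) \<in> parcs T \<Longrightarrow> inner x y \<or> edge_orbit {x, y} = edge_orbit {u, act t u'}"
    and x: "x \<in> act (t [^] k) ` S" and xy: "(x, y) \<in> parcs T"
  obtains g where "g \<in> Stab x"
    "act g y \<in> act (t [^] k) ` S \<or> (x = act (t [^] k) u \<and> act g y = act (t [^] (k + 1)) u') \<or>
     (x = act (t [^] k) u' \<and> act g y = act (t [^] (k - 1)) u)"
proof -
  have l: "u \<in> S" "u' \<in> S" "t \<in> carrier G" using loop unfolding loop_def by auto
  let ?t = "t [^] k"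
  have tC: "?t \<in> carrier G" using l by simp
  obtain s where s: "s \<in> S" "x = act ?t s" using x by blast
  have yV: "y \<in> V" using arc_verts xy by blast
  define z where "z = act (inv ?t) y"
  have z: "z \<in> V" "y = act ?t z" using yV tC by (auto simp: z_def)
  have sz: "(s, z) \<in> parcs T" using xy s z act_arc_iff[OF tC, of s z] by simp
  have tk: "act ?t (act t u') = act (t [^] (k + 1)) u'" "act ?t (act (inv t) u) = act (t [^] (k - 1)) u"
    using l by (simp_all add: int_pow_mult int_pow_diff act_mult)
  have "\<exists>h \<in> Stab s. act h z \<in> S \<or> (s = u \<and> act h z = act t u') \<or> (s = u' \<and> act h z = act (inv t) u)"
    using single[OF sz]
  proof
    assume "inner s z"
    then show ?thesis using inner_lift s by blast
  next
    assume "edge_orbit {s, z} = edge_orbit {u, act t u'}"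
    then obtain g where g: "g \<in> carrier G" "(act g s = u \<and> act g z = act t u') \<or> (act g s = act t u' \<and> act g z = u)"
      using edge_orbit_pair[of s z u "act t u'"] s z l by auto
    from g(2) show ?thesis
    proof
      assume a: "act g s = u \<and> act g z = act t u'"
      then have "act g s = s" using S_unique[OF g(1) s(1)] l(1) by metis
      then show ?thesis using a g by (auto simp: Stab_iff)
    next
      assume a: "act g s = act t u' \<and> act g z = u"
      then have b: "act (inv t \<otimes> g) s = u'" "act (inv t \<otimes> g) z = act (inv t) u"
        using g l s z by (simp_all add: act_mult)
      then have "act (inv t \<otimes> g) s = s" using S_unique[of "inv t \<otimes> g" s] g s l by simp
      then show ?thesis using b g l by (intro bexI[of _ "inv t \<otimes> g"]) (auto simp: Stab_iff)
    qed
  qed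
  then obtain h where h: "h \<in> Stab s"
    "act h z \<in> S \<or> (s = u \<and> act h z = act t u') \<or> (s = u' \<and> act h z = act (inv t) u)" by blast
  have hC: "h \<in> carrier G" using h Stab_closed by blast
  have "conj ?t h \<in> Stab x" using conj_Stab_iff[OF tC, of s h] h s hC by simp
  moreover have "act (conj ?t h) y = act ?t (act h z)" using tC hC z yV by (simp add: conj_def act_mult)
  ultimately show ?thesis using that[of "conj ?t h"] h(2) s tk by auto
qed

text \<open>
  The kernel of \<open>\<Delta>\<close> contains all vertex stabilisers, so modulo this kernel every orbit has representatives
  in the translates of \<open>S\<close> under powers of \<open>t\<close>. Applied to \<open>g v0\<close>, this writes \<open>g\<close> as a power of \<open>t\<close> up to
  the kernel.
\<close>

lemma modular_image_loop:
  assumes loop: "loop u t u'"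
    and single: "\<And>x y. (x, y) \<in> parcs T \<Longrightarrow> inner x y \<or> edge_orbit {x, y} = edge_orbit {u, act t u'}"
  shows "modular_image G T act = range (\<lambda>k :: int. \<Delta> t powi k)"
proof
  have l: "u \<in> S" "u' \<in> S" "t \<in> carrier G" using loop unfolding loop_def by auto
  show "range (\<lambda>k :: int. \<Delta> t powi k) \<subseteq> modular_image G T act"
    unfolding modular_image_def using l modular_pow[OF l(3)]
    by (auto intro!: image_eqI[of _ _ "t [^] _"])
  show "modular_image G T act \<subseteq> range (\<lambda>k :: int. \<Delta> t powi k)"
    unfolding modular_image_def
  proof
    fix r assume "r \<in> \<Delta> ` carrier G"
    then obtain g where g: "g \<in> carrier G" "r = \<Delta> g" by blast
    define K where "K = {g \<in> carrier G. \<Delta> g = 1}"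
    define X where "X = (\<Union>k :: int. act (t [^] k) ` S)"
    have K: "subgroup K G"
      by (rule subgroup.intro) (auto simp: K_def modular_mult modular_one modular_inv)
    have "\<exists>h \<in> K. act h (act g v0) \<in> X"
    proof (rule orbit_representatives[OF convex_verts v0_V _ K])
      show "Stab y \<subseteq> K" if "y \<in> V" for y using modular_Stab[OF that] by (auto simp: K_def Stab_iff)
      show "v0 \<in> X" unfolding X_def using v0_S by (intro UN_I[of 0]) (auto intro!: image_eqI[of _ _ v0])
      show "\<exists>k \<in> Stab x. act k y \<in> X" if xX: "x \<in> X" and xy: "(x, y) \<in> parcs T" for x y
      proof -
        obtain k :: int where "x \<in> act (t [^] k) ` S" using xX unfolding X_def by blast
        then obtain g where g: "g \<in> Stab x" "act g y \<in> act (t [^] k) ` S \<or>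
            (x = act (t [^] k) u \<and> act g y = act (t [^] (k + 1)) u') \<or>
            (x = act (t [^] k) u' \<and> act g y = act (t [^] (k - 1)) u)"
          using loop_lift[OF loop single _ xy] by blast
        have "act (t [^] i) s \<in> X" if "s \<in> S" for i :: int and s using that unfolding X_def by blast
        then have "act g y \<in> X" using g(2) l(1,2) by auto
        then show ?thesis using g(1) by blast
      qed
    qed (use g K_def in auto)
    then obtain h k s where h: "h \<in> K" "s \<in> S" "act h (act g v0) = act (t [^] (k :: int)) s"
      unfolding X_def by blast
    have hC: "h \<in> carrier G" using h by (simp add: K_def)
    let ?e = "inv (t [^] k) \<otimes> (h \<otimes> g)"
    have e: "?e \<in> carrier G" "act ?e v0 = s" using h hC g l by (auto simp: act_mult)
    then have "?e \<in> Stab v0" using S_unique[OF e(1) v0_S] h by (simp add: Stab_iff)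
    then have "\<Delta> ?e = 1" using modular_Stab[OF v0_V] by blast
    moreover have "\<Delta> ?e = inverse (\<Delta> (t [^] k)) * (1 * \<Delta> g)"
      using h hC g l by (simp add: modular_mult modular_inv K_def)
    ultimately have "\<Delta> g = \<Delta> (t [^] k)"
      using modular_nonzero[of "t [^] k"] l by (simp add: field_simps)
    then show "r \<in> range (\<lambda>k :: int. \<Delta> t powi k)" using modular_pow[OF l(3)] g by auto
  qed
qed

end

section \<open>Quotient graphs with at most one loop\<close>

locale equivariant_fundamental_subtree =
  equivariant G T act f \<phi> + fundamental_subtree G T act v0 S
  for G :: "('g, 'm) monoid_scheme" (structure) and T :: "'v pair_pre_digraph"
    and act :: "'g \<Rightarrow> 'v \<Rightarrow> 'v" and f \<phi> v0 S +
  assumes v0_fixed: "f v0 = v0" and phi_gen_v0: "\<phi> (gen v0) = gen v0"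
begin

lemma v0_Tf: "v0 \<in> Tf"
  using v0_fixed by simp

lemma Stab_H: "y \<in> Tf \<Longrightarrow> Stab y \<subseteq> H"
  using Stab_Tf_subset_H[OF v0_Tf phi_gen_v0] by blast

lemma Tf_representatives:
  assumes "v0 \<in> X" "\<And>x y. \<lbrakk>x \<in> X; x \<in> Tf; y \<in> Tf; (x, y) \<in> parcs T\<rbrakk> \<Longrightarrow> \<exists>k \<in> Stab x. act k y \<in> X" "y \<in> Tf"
  shows "\<exists>h \<in> H. act h y \<in> X"
  using orbit_representatives[OF convex_fixed v0_Tf H_act_Tf H_subgroup Stab_H assms] .

lemma finitely_generated_H_if:
  "\<lbrakk>finite F; F \<subseteq> V; \<And>y. y \<in> Tf \<Longrightarrow> \<exists>h \<in> H. act h y \<in> F\<rbrakk> \<Longrightarrow> finitely_generated G H"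
  using finitely_generated_if_cofinite[OF H_subgroup convex_fixed _ H_act_Tf] v0_Tf by blast

lemma finitely_generated_betti_0:
  assumes "betti G T act = 0"
  shows "finitely_generated G H"
proof (rule finitely_generated_H_if[OF S_finite S_verts])
  fix y assume y: "y \<in> Tf"
  show "\<exists>h \<in> H. act h y \<in> S"
    using betti_0_inner[OF assms] inner_lift by (intro Tf_representatives[OF v0_S _ y]) blast
qed

text \<open>
  The defect \<open>z\<close> of \<open>t\<close> fixes all vertices \<open>t\<^sup>j w\<close>, so conjugating it by \<open>t\<^sup>-\<^sup>j\<close> gives elements of \<open>Stab w\<close>. Their
  exponents form a geometric progression of integers with ratio \<open>\<Delta> t\<close>. If the ratio is \<open>-1\<close>, then \<open>t\<close>
  inverts \<open>z\<close>, and \<open>\<phi>(t\<^sup>2) = t z t z = t\<^sup>2\<close>.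
\<close>

lemma fixed_ray:
  assumes t: "t \<in> carrier G" and w: "\<And>j :: nat. act (t [^] j) w \<in> Tf" and wV: "w \<in> V"
  shows "t \<in> H \<or> (\<Delta> t \<in> \<int> \<and> (\<Delta> t = -1 \<longrightarrow> t \<otimes> t \<in> H))"
proof -
  have wT: "w \<in> Tf" using w[of 0] wV by simp
  have phi_gen_w: "\<phi> (gen w) = gen w" using Stab_H[OF wT] gen_pow_Stab[OF wV, of 1] wV by (auto simp: H_iff)
  define z where "z = defect t"
  have zC: "z \<in> carrier G" "\<phi> t = t \<otimes> z" using t by (auto simp: z_def defect_def)
  have zfix: "z \<in> Stab (act (t [^] j) w)" for j :: nat
  proof -
    let ?y = "act (t [^] j) w"
    have y: "?y \<in> Tf" using w by blast
    have "act t ?y = act (t [^] Suc j) w" unfolding nat_pow_Suc2[OF t] using t wV by (simp add: act_mult)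
    then have "act t ?y \<in> Tf" using w[of "Suc j"] by simp
    then show ?thesis unfolding z_def using defect_Stab_iff[OF y t] by blast
  qed
  have conj_z: "conj (inv (t [^] j)) z \<in> Stab w" for j :: nat
    using conj_inv_Stab_iff[of "t [^] j" w z] zfix t wV zC by simp
  have "\<forall>j :: nat. \<exists>i :: int. conj (inv (t [^] j)) z = gen w [^] i" using conj_z Stab_eq[OF wV] by auto
  then obtain m where m: "\<And>j :: nat. conj (inv (t [^] j)) z = gen w [^] (m j :: int)" by metis
  have m0: "z = gen w [^] m 0" using m[of 0] zC by simp
  have mSuc: "conj (inv t) (gen w [^] m j) = gen w [^] m (Suc j)" for j
    using t zC by (simp add: conj_conj inv_mult_group flip: m)
  have rec: "of_int (m (Suc j)) = \<Delta> t * of_int (m j)" for j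
  proof (cases "m j = 0")
    case True
    then have "gen w [^] m (Suc j) = \<one>" using mSuc[of j] t by simp
    then show ?thesis using True wV by simp
  next
    case False
    have c: "conj t (gen w [^] m (Suc j)) = gen w [^] m j" using mSuc[of j] t wV by (simp add: conj_inv_left)
    moreover have "m (Suc j) \<noteq> 0" using c False t wV by (metis conj_one_right gen_pow_one int_pow_0)
    ultimately have "\<Delta> t = of_int (m (Suc j)) / of_int (m j)" using False t wV by (intro modular_gen_eqI) auto
    then show ?thesis using False by simp
  qed
  show ?thesis
  proof (cases "m 0 = 0")
    case True
    then have "z = \<one>" using m0 by simp
    then show ?thesis using zC t by (simp add: H_iff)
  next
    case False
    have "\<Delta> t \<in> \<int>" using rat_integer_if_orbit_integral[of m] False rec by blast
    moreover have "t \<otimes> t \<in> H" if "\<Delta> t = -1"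
    proof -
      have "(of_int (m 1) :: rat) = of_int (- m 0)" using rec[of 0] that by simp
      then have m1: "m 1 = - m 0" by (simp only: of_int_eq_iff)
      have cz: "conj (inv t) z = inv z" using mSuc[of 0] m1 m0 wV by (simp add: int_pow_neg)
      have "z \<otimes> t = t \<otimes> conj (inv t) z" using t zC by (simp add: conj_def m_assoc)
      then have zt: "z \<otimes> t = t \<otimes> inv z" using cz by simp
      have "\<phi> (t \<otimes> t) = t \<otimes> (z \<otimes> t) \<otimes> z" using t zC by (simp add: m_assoc)
      also have "\<dots> = t \<otimes> (t \<otimes> inv z) \<otimes> z" unfolding zt ..
      also have "\<dots> = t \<otimes> t" using t zC by (simp add: m_assoc)
      finally show ?thesis using t by (simp add: H_iff)
    qed
    ultimately show ?thesis by blast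
  qed
qed

text \<open>
  Either \<open>Tf\<close> misses an arc over the loop in both directions, so that finitely many translates of \<open>S\<close>
  suffice, or it contains a ray to which \<open>fixed_ray\<close> applies, for \<open>t\<close> or for its inverse. The hypothesis on
  \<open>\<Delta>\<close> then only leaves cases with \<open>t\<^sup>2 \<in> H\<close>, in which two translates of \<open>S\<close> suffice.
\<close>

lemma finitely_generated_betti_1:
  assumes betti: "betti G T act = 1"
    and mod: "modular_image G T act = {1, -1} \<or> \<not> generated_by_integer (modular_image G T act)"
  shows "finitely_generated G H"
proof -
  obtain u t u' where loop: "loop u t u'" and
    single: "\<And>x y. (x, y) \<in> parcs T \<Longrightarrow> inner x y \<or> edge_orbit {x, y} = edge_orbit {u, act t u'}"
    using betti_1_loop[OF betti] by blast
  have l: "u \<in> S" "u' \<in> S" "t \<in> carrier G" using loop unfolding loop_def by auto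
  define tr where "tr k = act (t [^] (k :: int)) ` S" for k
  have trV: "finite (tr k)" "tr k \<subseteq> V" for k using S_finite l by (auto simp: tr_def)
  have v0_tr: "v0 \<in> tr 0" unfolding tr_def using v0_S by (auto intro!: image_eqI[of _ _ v0])
  have u_tr: "act (t [^] k) u \<in> tr k" "act (t [^] k) u' \<in> tr k" for k using l by (auto simp: tr_def)
  \<comment> \<open>The fixed subtree contains the arc over the loop that leads from the \<open>k\<close>-th translate of \<open>S\<close> to
    the next one.\<close>
  define edge where "edge k \<longleftrightarrow> act (t [^] k) u \<in> Tf \<and> act (t [^] (k + 1)) u' \<in> Tf" for k :: int
  have lift: "\<exists>g \<in> Stab x. act g y \<in> tr k \<or> (act g y \<in> tr (k + 1) \<and> edge k) \<or> (act g y \<in> tr (k - 1) \<and> edge (k - 1))"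
    if x: "x \<in> tr k" "x \<in> Tf" and y: "y \<in> Tf" and xy: "(x, y) \<in> parcs T" for x y k
  proof -
    obtain g where g: "g \<in> Stab x"
      "act g y \<in> act (t [^] k) ` S \<or> (x = act (t [^] k) u \<and> act g y = act (t [^] (k + 1)) u') \<or>
       (x = act (t [^] k) u' \<and> act g y = act (t [^] (k - 1)) u)"
      using loop_lift[OF loop single x(1)[unfolded tr_def] xy] by blast
    have "act g y \<in> Tf" using H_act_Tf Stab_H x(2) g(1) y by blast
    then have "act g y \<in> tr k \<or> (act g y \<in> tr (k + 1) \<and> edge k) \<or> (act g y \<in> tr (k - 1) \<and> edge (k - 1))"
      using g(2) x(2) u_tr unfolding edge_def tr_def[symmetric] by auto
    then show ?thesis using g(1) by blast
  qed
  show ?thesis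
  proof (cases "\<exists>i j. i < 0 \<and> 0 \<le> j \<and> \<not> edge i \<and> \<not> edge j")
    case True
    \<comment> \<open>The fixed subtree does not run through all translates in either direction.\<close>
    then obtain i j where ij: "i < 0" "0 \<le> j" "\<not> edge i" "\<not> edge j" by blast
    define X where "X = (\<Union>k \<in> {i + 1..j}. tr k)"
    show ?thesis
    proof (rule finitely_generated_H_if)
      show "finite X" "X \<subseteq> V" using trV unfolding X_def by auto
      show "\<exists>h \<in> H. act h y \<in> X" if "y \<in> Tf" for y
        using that
      proof (rule Tf_representatives[rotated 2])
        show "v0 \<in> X" using v0_tr ij unfolding X_def by (intro UN_I[of 0]) auto
        fix x y assume x: "x \<in> X" "x \<in> Tf" and y: "y \<in> Tf" and xy: "(x, y) \<in> parcs T"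
        obtain k where k: "i + 1 \<le> k" "k \<le> j" "x \<in> tr k" using x unfolding X_def by auto
        obtain g where g: "g \<in> Stab x"
          "act g y \<in> tr k \<or> (act g y \<in> tr (k + 1) \<and> edge k) \<or> (act g y \<in> tr (k - 1) \<and> edge (k - 1))"
          using lift[OF k(3) x(2) y xy] by blast
        from g(2) have "\<exists>k' \<in> {i + 1..j}. act g y \<in> tr k'"
        proof (elim disjE conjE)
          assume "act g y \<in> tr k" then show ?thesis using k by auto
        next
          assume a: "act g y \<in> tr (k + 1)" "edge k"
          then have "k \<noteq> j" using ij by auto
          then show ?thesis using a k by (intro bexI[of _ "k + 1"]) auto
        next
          assume a: "act g y \<in> tr (k - 1)" "edge (k - 1)"
          then have "k - 1 \<noteq> i" using ij by auto
          then show ?thesis using a k by (intro bexI[of _ "k - 1"]) auto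
        qed
        then show "\<exists>k \<in> Stab x. act k y \<in> X" using g(1) unfolding X_def by blast
      qed
    qed
  next
    case False
    have image: "modular_image G T act = range (\<lambda>k :: int. \<Delta> t powi k)"
      using modular_image_loop[OF loop single] .
    have not_int: "\<not> ((\<Delta> t \<in> \<int> \<or> inverse (\<Delta> t) \<in> \<int>) \<and> \<Delta> t \<noteq> -1)"
      using mod powi_range_integer_condition[OF modular_nonzero[OF l(3)]] unfolding image by blast
    have ttH: "t \<otimes> t \<in> H"
    proof -
      consider "\<And>j. 0 \<le> j \<Longrightarrow> edge j" | "\<And>i. i < 0 \<Longrightarrow> edge i" using False by blast
      then show ?thesis
      proof cases
        case 1
        have "act (t [^] j) u \<in> Tf" for j :: nat using 1[of "int j"] by (simp add: edge_def int_pow_int)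
        from fixed_ray[OF l(3) this] have "t \<in> H \<or> \<Delta> t \<in> \<int> \<and> (\<Delta> t = - 1 \<longrightarrow> t \<otimes> t \<in> H)" using l by simp
        then show ?thesis using not_int subgroup.m_closed[OF H_subgroup] by blast
      next
        case 2
        have "act (inv t [^] j) u' \<in> Tf" for j :: nat
        proof -
          have "inv t [^] j = t [^] (- int j)" using l by (simp add: int_pow_neg int_pow_int nat_pow_inv)
          moreover have "edge (- int j - 1)" using 2 by simp
          ultimately show ?thesis by (simp add: edge_def)
        qed
        from fixed_ray[OF inv_closed[OF l(3)] this]
        have "inv t \<in> H \<or> \<Delta> (inv t) \<in> \<int> \<and> (\<Delta> (inv t) = - 1 \<longrightarrow> inv t \<otimes> inv t \<in> H)" using l by simp
        moreover have "\<Delta> (inv t) = -1 \<longleftrightarrow> \<Delta> t = -1"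
          using modular_inv[OF l(3)] by (metis inverse_inverse_eq inverse_minus_eq inverse_1)
        ultimately have "inv t \<in> H \<or> inv t \<otimes> inv t \<in> H" using not_int modular_inv[OF l(3)] by auto
        then have "inv t \<otimes> inv t \<in> H" using subgroup.m_closed[OF H_subgroup] by blast
        then have "inv (inv t \<otimes> inv t) \<in> H" using subgroup.m_inv_closed[OF H_subgroup] by blast
        then show ?thesis using l by (simp add: inv_mult_group)
      qed
    qed
    show ?thesis
    proof (rule finitely_generated_H_if)
      show "finite (tr 0 \<union> tr 1)" "tr 0 \<union> tr 1 \<subseteq> V" using trV by auto
      fix y assume y: "y \<in> Tf"
      have "\<exists>h \<in> H. act h y \<in> (\<Union>k. tr k)"
      proof (rule Tf_representatives[OF _ _ y])
        show "v0 \<in> (\<Union>k. tr k)" using v0_tr by blast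
        fix x y assume "x \<in> (\<Union>k. tr k)" and xy: "x \<in> Tf" "y \<in> Tf" "(x, y) \<in> parcs T"
        then obtain k where "x \<in> tr k" by blast
        from lift[OF this xy] show "\<exists>g \<in> Stab x. act g y \<in> (\<Union>k. tr k)" by auto
      qed
      then obtain h k where h: "h \<in> H" "act h y \<in> tr k" by blast
      obtain s where s: "s \<in> S" "act h y = act (t [^] k) s" using h unfolding tr_def by blast
      have hC: "h \<in> carrier G" "y \<in> V" using h y H_iff by auto
      define e where "e = (t \<otimes> t) [^] (- (k div 2))"
      have eH: "e \<in> H" unfolding e_def by (rule pow_in_subgroup[OF H_subgroup ttH])
      have "t \<otimes> t = t [^] (2 :: int)" using l int_pow_mult[of t 1 1] by simp
      then have e: "e = t [^] (2 * - (k div 2))" unfolding e_def using l by (simp only: int_pow_pow)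
      have eC: "e \<in> carrier G" using e l by simp
      have "act (e \<otimes> h) y = act e (act (t [^] k) s)" using eC hC s by (simp add: act_mult)
      also have "\<dots> = act (t [^] (2 * - (k div 2) + k)) s"
        unfolding e int_pow_mult[OF l(3)] using l s by (subst act_mult) auto
      also have "2 * - (k div 2) + k = k mod 2" by (simp add: minus_mult_div_eq_mod)
      finally have "act (e \<otimes> h) y \<in> tr (k mod 2)" using s by (simp add: tr_def)
      moreover have "k mod 2 = 0 \<or> k mod 2 = 1" by linarith
      ultimately have "act (e \<otimes> h) y \<in> tr 0 \<union> tr 1" by auto
      then show "\<exists>h \<in> H. act h y \<in> tr 0 \<union> tr 1" using subgroup.m_closed[OF H_subgroup eH h(1)] by blast
    qed
  qed
qed

end

section \<open>Twists\<close>

text \<open>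
  A Dehn twist without a presentation of \<open>G\<close>: every arc carries an element of its stabiliser, equivariantly
  and with inverse elements on inverse arcs. The product of these elements along a walk only depends
  on the ends of the walk, because backtracking cancels.
\<close>

locale twist = one_free_gbs G T act
  for G :: "('g, 'm) monoid_scheme" (structure) and T :: "'v pair_pre_digraph"
    and act :: "'g \<Rightarrow> 'v \<Rightarrow> 'v" +
  fixes v0 :: 'v and \<zeta> :: "'v \<Rightarrow> 'v \<Rightarrow> 'g"
  assumes v0_verts: "v0 \<in> V"
    and zeta_Stab: "(x, y) \<in> parcs T \<Longrightarrow> \<zeta> x y \<in> Stab x"
    and zeta_reverse: "(x, y) \<in> parcs T \<Longrightarrow> \<zeta> y x = inv (\<zeta> x y)"
    and zeta_act: "\<lbrakk>g \<in> carrier G; (x, y) \<in> parcs T\<rbrakk> \<Longrightarrow> \<zeta> (act g x) (act g y) = conj g (\<zeta> x y)"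
begin

lemma zeta_closed: "(x, y) \<in> parcs T \<Longrightarrow> \<zeta> x y \<in> carrier G"
  using zeta_Stab Stab_closed by blast

lemma zeta_Stab2:
  assumes "(x, y) \<in> parcs T"
  shows "\<zeta> x y \<in> Stab y"
proof -
  have "\<zeta> y x \<in> Stab y" using zeta_Stab arcs_symmetric assms by blast
  then have "inv (\<zeta> y x) \<in> Stab y" using subgroup.m_inv_closed[OF Stab_subgroup] arc_verts assms by blast
  then show ?thesis using zeta_reverse[OF arcs_symmetric[OF assms]] by simp
qed

text \<open>
  Only used for \<open>n\<close> the distance from \<open>v\<close> to \<open>v0\<close>, on which the recursion along the geodesic runs.
\<close>

primrec walk_product :: "nat \<Rightarrow> 'v \<Rightarrow> 'g" where
  "walk_product 0 v = \<one>"
| "walk_product (Suc n) v = walk_product n (toward T v v0) \<otimes> \<zeta> (toward T v v0) v"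

definition \<tau> :: "'v \<Rightarrow> 'g" where
  "\<tau> v = walk_product (tdist T v v0) v"

lemma tau_base [simp]: "\<tau> v0 = \<one>"
  by (simp add: \<tau>_def)

lemma tau_toward: "\<lbrakk>y \<in> V; y \<noteq> v0\<rbrakk> \<Longrightarrow> \<tau> y = \<tau> (toward T y v0) \<otimes> \<zeta> (toward T y v0) y"
  using toward_dist[of y v0] v0_verts by (simp add: \<tau>_def)

lemma tau_closed [simp]:
  assumes "y \<in> V"
  shows "\<tau> y \<in> carrier G"
  using assms v0_verts
proof (induction rule: toward_induct)
  case (step y)
  then show ?case
    using zeta_closed[of "toward T y v0" y] arcs_symmetric[OF toward_arc[of y v0]] v0_verts by (simp add: tau_toward)
qed simp

lemma tau_arc:
  assumes xy: "(x, y) \<in> parcs T"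
  shows "\<tau> y = \<tau> x \<otimes> \<zeta> x y"
  using xy v0_verts
proof (cases rule: arc_cases)
  case 1
  have V: "x \<in> V" "y \<in> V" using arc_verts xy by auto
  have "\<tau> x = \<tau> y \<otimes> \<zeta> y x" using tau_toward[OF V(1)] 1 by simp
  moreover have "\<zeta> x y = inv (\<zeta> y x)" "\<zeta> y x \<in> carrier G"
    using zeta_reverse zeta_closed arcs_symmetric[OF xy] by blast+
  ultimately show ?thesis using V by (simp add: m_assoc)
next
  case 2
  then show ?thesis using tau_toward arc_verts xy by simp
qed

text \<open>
  The cocycle rule: go from \<open>v0\<close> to \<open>g v0\<close>, then along the translate by \<open>g\<close> of the walk from \<open>v0\<close> to \<open>w\<close>. It
  makes \<open>twist_hom\<close> multiplicative and \<open>twist_map\<close> equivariant.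
\<close>

lemma tau_act:
  assumes g: "g \<in> carrier G" and w: "w \<in> V"
  shows "\<tau> (act g w) = \<tau> (act g v0) \<otimes> conj g (\<tau> w)"
  using w v0_verts
proof (induction rule: tree_induct)
  case base
  then show ?case using g v0_verts by simp
next
  case (step x y)
  have V: "x \<in> V" "y \<in> V" using arc_verts step by auto
  have z: "\<zeta> x y \<in> carrier G" using zeta_closed step by blast
  have "\<tau> (act g y) = \<tau> (act g x) \<otimes> conj g (\<zeta> x y)"
    using tau_arc[OF act_arc[OF g step(2)]] zeta_act[OF g step(2)] by simp
  also have "\<dots> = \<tau> (act g v0) \<otimes> (conj g (\<tau> x) \<otimes> conj g (\<zeta> x y))"
    using step.IH g V z v0_verts by (simp add: m_assoc)
  also have "conj g (\<tau> x) \<otimes> conj g (\<zeta> x y) = conj g (\<tau> y)"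
    using tau_arc[OF step(2)] g V z by (simp add: conj_mult)
  finally show ?case .
qed

definition twist_hom :: "'g \<Rightarrow> 'g" where
  "twist_hom = (\<lambda>g \<in> carrier G. \<tau> (act g v0) \<otimes> g)"

definition twist_map :: "'v \<Rightarrow> 'v" where
  "twist_map w = act (\<tau> w) w"

lemma twist_hom_closed [simp]: "g \<in> carrier G \<Longrightarrow> twist_hom g \<in> carrier G"
  using v0_verts by (simp add: twist_hom_def)

lemma twist_hom_at:
  assumes g: "g \<in> carrier G" and w: "w \<in> V"
  shows "twist_hom g = \<tau> (act g w) \<otimes> g \<otimes> inv (\<tau> w)"
  using tau_act[OF g w] g w v0_verts by (simp add: twist_hom_def conj_def m_assoc)

lemma twist_hom_mult:
  assumes g: "g \<in> carrier G" and h: "h \<in> carrier G"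
  shows "twist_hom (g \<otimes> h) = twist_hom g \<otimes> twist_hom h"
proof -
  have "twist_hom (g \<otimes> h) = \<tau> (act g (act h v0)) \<otimes> (g \<otimes> h)"
    using g h v0_verts by (simp add: twist_hom_def act_mult)
  also have "\<dots> = \<tau> (act g v0) \<otimes> conj g (\<tau> (act h v0)) \<otimes> (g \<otimes> h)"
    using tau_act[OF g, of "act h v0"] h v0_verts by simp
  also have "\<dots> = twist_hom g \<otimes> twist_hom h"
    using g h v0_verts by (simp add: twist_hom_def conj_def m_assoc)
  finally show ?thesis .
qed

lemma twist_map_verts: "w \<in> V \<Longrightarrow> twist_map w \<in> V"
  by (simp add: twist_map_def)

lemma twist_map_act:
  assumes g: "g \<in> carrier G" and w: "w \<in> V"
  shows "twist_map (act g w) = act (twist_hom g) (twist_map w)"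
  using twist_hom_at[OF g w] g w by (simp add: twist_map_def act_mult)

lemma twist_map_arc:
  assumes xy: "(x, y) \<in> parcs T"
  shows "(twist_map x, twist_map y) \<in> parcs T"
proof -
  have V: "x \<in> V" "y \<in> V" using arc_verts xy by auto
  have "act (\<tau> y) y = act (\<tau> x) (act (\<zeta> x y) y)"
    using tau_arc[OF xy] zeta_closed[OF xy] V by (simp add: act_mult)
  also have "act (\<zeta> x y) y = y" using zeta_Stab2[OF xy] by (simp add: Stab_iff)
  finally show ?thesis using act_arc[OF tau_closed[OF V(1)] xy] by (simp add: twist_map_def)
qed

text \<open>
  Crossing one more arc multiplies the two products by mutually inverse elements. Both lie in the
  stabiliser of the vertex reached so far, on which \<open>twist_hom\<close> is conjugation by the product.
\<close>

lemma inverse_twist: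
  assumes tw': "twist G T act v0 \<zeta>'" and inv: "\<And>x y. (x, y) \<in> parcs T \<Longrightarrow> \<zeta>' x y = inv (\<zeta> x y)"
  shows "g \<in> carrier G \<Longrightarrow> twist.twist_hom G T act v0 \<zeta>' (twist_hom g) = g"
    and "w \<in> V \<Longrightarrow> twist.twist_map G T act v0 \<zeta>' (twist_map w) = w"
proof -
  interpret I: twist G T act v0 \<zeta>' by (rule tw')
  have cancel: "I.twist_hom (\<tau> w) \<otimes> I.\<tau> w = \<one>" if "w \<in> V" for w
    using that v0_verts
  proof (induction rule: tree_induct)
    case base
    then show ?case using v0_verts by (simp add: I.twist_hom_def)
  next
    case (step x y)
    have V: "x \<in> V" "y \<in> V" using arc_verts step by auto
    let ?z = "\<zeta> x y"
    have z: "?z \<in> carrier G" "act ?z x = x" using zeta_Stab[OF step(2)] by (auto simp: Stab_iff)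
    have "I.twist_hom (\<tau> y) \<otimes> I.\<tau> y = I.twist_hom (\<tau> x) \<otimes> I.twist_hom ?z \<otimes> (I.\<tau> x \<otimes> inv ?z)"
      using tau_arc[OF step(2)] I.tau_arc[OF step(2)] inv[OF step(2)] V z by (simp add: I.twist_hom_mult)
    also have "I.twist_hom ?z = I.\<tau> x \<otimes> ?z \<otimes> inv (I.\<tau> x)" using I.twist_hom_at[OF z(1) V(1)] z by simp
    also have "I.twist_hom (\<tau> x) \<otimes> (I.\<tau> x \<otimes> ?z \<otimes> inv (I.\<tau> x)) \<otimes> (I.\<tau> x \<otimes> inv ?z) = I.twist_hom (\<tau> x) \<otimes> I.\<tau> x"
      using V z by (simp add: m_assoc)
    finally show ?case using step.IH by simp
  qed
  show "I.twist_hom (twist_hom g) = g" if g: "g \<in> carrier G"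
  proof -
    have "I.twist_hom (twist_hom g) = I.twist_hom (\<tau> (act g v0)) \<otimes> (I.\<tau> (act g v0) \<otimes> g)"
      using g v0_verts by (simp add: twist_hom_def I.twist_hom_mult) (simp add: I.twist_hom_def)
    also have "\<dots> = I.twist_hom (\<tau> (act g v0)) \<otimes> I.\<tau> (act g v0) \<otimes> g" using g v0_verts by (simp add: m_assoc)
    finally show ?thesis using cancel g v0_verts by simp
  qed
  show "I.twist_map (twist_map w) = w" if w: "w \<in> V"
  proof -
    have "I.twist_map (twist_map w) = act (I.twist_hom (\<tau> w)) (act (I.\<tau> w) w)"
      using I.twist_map_act[OF tau_closed[OF w] w] by (simp add: twist_map_def I.twist_map_def)
    also have "\<dots> = act (I.twist_hom (\<tau> w) \<otimes> I.\<tau> w) w" using w by (simp add: act_mult)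
    finally show ?thesis using cancel[OF w] w by simp
  qed
qed

lemma twist_inverse: "twist G T act v0 (\<lambda>x y. inv (\<zeta> x y))"
proof
  show "v0 \<in> V" by (rule v0_verts)
  show "inv (\<zeta> x y) \<in> Stab x" if "(x, y) \<in> parcs T" for x y
    using subgroup.m_inv_closed[OF Stab_subgroup zeta_Stab[OF that]] arc_verts that by blast
  show "inv (\<zeta> y x) = inv (inv (\<zeta> x y))" if "(x, y) \<in> parcs T" for x y
    using zeta_reverse that by simp
  show "inv (\<zeta> (act g x) (act g y)) = conj g (inv (\<zeta> x y))" if "g \<in> carrier G" "(x, y) \<in> parcs T" for g x y
    using zeta_act that zeta_closed by (simp add: conj_inv)
qed

lemma twist_equivariant: "equivariant G T act twist_map twist_hom"
proof -
  interpret I: twist G T act v0 "\<lambda>x y. inv (\<zeta> x y)" by (rule twist_inverse)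
  note inv1 = inverse_twist[OF twist_inverse refl]
  have inv2: "g \<in> carrier G \<Longrightarrow> twist_hom (I.twist_hom g) = g" "w \<in> V \<Longrightarrow> twist_map (I.twist_map w) = w" for g w
    using I.inverse_twist[OF twist_axioms] zeta_closed by simp_all
  show ?thesis
  proof (intro equivariant.intro tree_automorphism.intro equivariant_axioms.intro tree_automorphism_axioms.intro)
    show "one_free_gbs G T act" "simplicial_tree T" by unfold_locales
    show "bij_betw twist_map V V"
      by (rule bij_betw_byWitness[where f' = I.twist_map]) (auto simp: inv1 inv2 twist_map_verts I.twist_map_verts)
    show "(twist_map x, twist_map y) \<in> parcs T" if "(x, y) \<in> parcs T" for x y
      using twist_map_arc that .
    show "(x, y) \<in> parcs T" if "x \<in> V" "y \<in> V" "(twist_map x, twist_map y) \<in> parcs T" for x y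
      using I.twist_map_arc[OF that(3)] inv1 that by simp
    have "bij_betw twist_hom (carrier G) (carrier G)"
      by (rule bij_betw_byWitness[where f' = I.twist_hom]) (auto simp: inv1 inv2)
    moreover have "twist_hom \<in> extensional (carrier G)" by (simp add: twist_hom_def)
    ultimately show "twist_hom \<in> auto G" by (simp add: auto_def Bij_def hom_def twist_hom_mult)
    show "twist_map (act g x) = act (twist_hom g) (twist_map x)" if "g \<in> carrier G" "x \<in> V" for g x
      using twist_map_act that .
  qed
qed

end

text \<open>
  The element \<open>z\<close> is transported along the orbit of the arc. This is well defined as \<open>Stab u\<close> is abelian.
\<close>

lemma (in one_free_gbs) edge_twist:
  assumes uw: "(u, w) \<in> parcs T" and z: "z \<in> Stab u" "z \<in> Stab w" and v0: "v0 \<in> V"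
  obtains \<zeta> where "twist G T act v0 \<zeta>" "\<zeta> u w = z"
    "\<And>x y. \<lbrakk>(x, y) \<in> parcs T; orbit G (edge_action act) {x, y} \<noteq> orbit G (edge_action act) {u, w}\<rbrakk> \<Longrightarrow> \<zeta> x y = \<one>"
proof -
  have V: "u \<in> V" "w \<in> V" using arc_verts uw by auto
  have zC: "z \<in> carrier G" using z Stab_closed by blast
  define over where "over g x y \<longleftrightarrow> g \<in> carrier G \<and> act g u = x \<and> act g w = y" for g x y
  define c where "c x y = conj (SOME g. over g x y) z" for x y
  have c: "c x y = conj g z" if g: "over g x y" for g x y
  proof -
    define h where "h = (SOME g. over g x y)"
    have h: "over h x y" unfolding h_def using g by (rule someI)
    have C: "g \<in> carrier G" "h \<in> carrier G" "act g u = act h u" using g h unfolding over_def by auto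
    then have "inv h \<otimes> g \<in> Stab u" using V act_inv(1)[OF C(2) V(1)] by (simp add: Stab_iff act_mult)
    then have "conj (inv h \<otimes> g) z = z"
      using Stab_commute[OF V(1) _ z(1), of "inv h \<otimes> g"] C zC by (simp add: conj_eq_self)
    then have "conj (h \<otimes> (inv h \<otimes> g)) z = conj h z" using C zC by (metis conj_conj inv_closed m_closed)
    then show ?thesis using C unfolding c_def h_def[symmetric] by simp
  qed
  \<comment> \<open>No element reverses the edge, so the two cases exclude each other.\<close>
  have excl: "\<not> over h y x" if "over g x y" for g h x y
  proof
    assume h: "over h y x"
    have C: "g \<in> carrier G" "h \<in> carrier G" "act g u = x" "act g w = y" "act h u = y" "act h w = x"
      using that h unfolding over_def by auto
    have "act (inv g \<otimes> h) u = w" "act (inv g \<otimes> h) w = u"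
      using C(1,2) V C(3-6)[symmetric] by (simp_all add: act_mult)
    then show False using no_inversion[OF _ uw, of "inv g \<otimes> h"] C by simp
  qed
  define \<zeta> where "\<zeta> x y = (if \<exists>g. over g x y then c x y else if \<exists>g. over g y x then inv (c y x) else \<one>)" for x y
  have over_act: "over (h \<otimes> g) (act h x) (act h y)" if "over g x y" "h \<in> carrier G" for g h x y
    using that V unfolding over_def by (auto simp: act_mult)
  have over_act_iff: "(\<exists>g. over g (act h x) (act h y)) \<longleftrightarrow> (\<exists>g. over g x y)"
    if "h \<in> carrier G" "x \<in> V" "y \<in> V" for h x y
    using that over_act[of _ x y h] over_act[of _ "act h x" "act h y" "inv h"] by auto
  have over1: "over \<one> u w" using V by (simp add: over_def)
  have c_Stab: "c x y \<in> Stab x" "c x y \<in> Stab y" if g: "over g x y" for g x y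
    using g z V zC conj_Stab_iff[of g u z] conj_Stab_iff[of g w z] unfolding c[OF g] over_def by auto
  have tw: "twist G T act v0 \<zeta>"
  proof
    show "v0 \<in> V" by (rule v0)
    show "\<zeta> x y \<in> Stab x" if xy: "(x, y) \<in> parcs T" for x y
    proof -
      have sub: "subgroup (Stab x) G" using Stab_subgroup arc_verts xy by blast
      show ?thesis unfolding \<zeta>_def
        using c_Stab subgroup.m_inv_closed[OF sub] subgroup.one_closed[OF sub] by auto
    qed
    show "\<zeta> y x = inv (\<zeta> x y)" if xy: "(x, y) \<in> parcs T" for x y
    proof -
      have cC: "c x y \<in> carrier G" if "over g x y" for g x y using c_Stab[OF that] Stab_closed by blast
      show ?thesis using excl cC unfolding \<zeta>_def by auto
    qed
    show "\<zeta> (act h x) (act h y) = conj h (\<zeta> x y)" if h: "h \<in> carrier G" and xy: "(x, y) \<in> parcs T" for h x y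
    proof -
      have xyV: "x \<in> V" "y \<in> V" using arc_verts xy by auto
      have c_act: "c (act h a) (act h b) = conj h (c a b)" "c a b \<in> carrier G" if g: "over g a b" for a b g
        using c[OF g] c[OF over_act[OF g h]] g h zC by (auto simp: over_def conj_conj)
      show ?thesis
        using over_act_iff[OF h xyV] over_act_iff[OF h xyV(2,1)] c_act h
        unfolding \<zeta>_def by (auto simp: conj_inv)
    qed
  qed
  have "\<zeta> u w = z" using over1 c[OF over1] zC unfolding \<zeta>_def by auto
  moreover have "\<zeta> x y = \<one>"
    if xy: "(x, y) \<in> parcs T" "orbit G (edge_action act) {x, y} \<noteq> orbit G (edge_action act) {u, w}" for x y
  proof -
    have "x \<in> V" "y \<in> V" using arc_verts xy by auto
    then have "\<not> over g x y" "\<not> over g y x" for g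
      using xy(2) edge_orbit_pair[of u w x y, symmetric] V unfolding over_def by auto
    then show ?thesis unfolding \<zeta>_def by simp
  qed
  ultimately show ?thesis using tw that by blast
qed

section \<open>Fixed subgroups that are not finitely generated\<close>

text \<open>
  The sum of the powers of \<open>a\<close> with exponents from 1 to \<open>k\<close>.
\<close>

fun geometric :: "int \<Rightarrow> nat \<Rightarrow> int" where
  "geometric a 0 = 0"
| "geometric a (Suc k) = a * (geometric a k + 1)"

text \<open>
  By cancellation, a coincidence leads back to \<open>geometric a k = -1\<close>, which makes \<open>a\<close> a divisor of 1; for
  \<open>a = 1\<close> the sums are nonnegative.
\<close>

lemma inj_geometric:
  assumes a: "a \<noteq> 0" "a \<noteq> -1"
  shows "inj (geometric a)"
proof -
  have ne: "geometric a k \<noteq> -1" for k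
  proof (cases k)
    case (Suc m)
    show ?thesis
    proof
      assume "geometric a k = -1"
      then have "a * (geometric a m + 1) = -1" using Suc by simp
      moreover from this have "a dvd 1" by (metis dvd_minus_iff dvd_triv_left)
      ultimately have "a = 1" using a by auto
      moreover have "geometric 1 n = int n" for n by (induction n) auto
      ultimately show False using \<open>geometric a k = -1\<close> by simp
    qed
  qed simp
  have "geometric a j = geometric a k \<Longrightarrow> j = k" for j k
  proof (induction j arbitrary: k)
    case 0
    then show ?case using a ne[of "k - 1"] by (cases k) (auto simp: add_eq_0_iff)
  next
    case (Suc j)
    then show ?case using a ne[of j] by (cases k) (auto simp: add_eq_0_iff)
  qed
  then show ?thesis by (auto intro: injI)
qed

text \<open>
  The defect of \<open>g\<^sup>k\<close> is the product of the conjugates by \<open>g\<^sup>-\<^sup>1, \<dots>, g\<^sup>-\<^sup>k\<close> of the twisting element, whose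
  exponent is a multiple of a geometric sum.
\<close>

lemma (in equivariant) not_finitely_generated_if_left_twist:
  fixes M a :: int
  assumes x: "x \<in> Tf" "\<phi> (gen x) = gen x" and g: "g \<in> carrier G"
    and phi_g: "\<phi> g = gen x [^] M \<otimes> g" and M: "M \<noteq> 0"
    and conj: "conj (inv g) (gen x [^] M) = gen x [^] (M * a)" and a: "a \<noteq> 0" "a \<noteq> -1"
  shows "\<not> finitely_generated G H"
proof (rule not_finitely_generated_if_many_defects[OF x])
  have V: "x \<in> V" using x by simp
  have d: "defect (g [^] k) = gen x [^] (M * geometric a k)" for k :: nat
  proof (induction k)
    case 0
    then show ?case by (simp add: defect_def)
  next
    case (Suc k)
    have "defect (g [^] Suc k) = conj (inv g) (gen x [^] (M * geometric a k) \<otimes> gen x [^] M)"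
      using g V Suc by (simp add: defect_mult phi_g conj_def m_assoc)
    also have "gen x [^] (M * geometric a k) \<otimes> gen x [^] M = (gen x [^] M) [^] (geometric a k + 1)"
      using V by (simp add: int_pow_pow algebra_simps flip: int_pow_mult)
    also have "conj (inv g) \<dots> = (gen x [^] (M * a)) [^] (geometric a k + 1)"
      using g V by (simp add: conj_pow[of "inv g"] conj)
    finally show ?case using V by (simp add: int_pow_pow mult.assoc)
  qed
  show "g [^] k \<in> carrier G" for k :: nat using g by simp
  show "defect (g [^] k) \<in> Stab x" for k :: nat using d V by simp
  show "inj (\<lambda>k :: nat. defect (g [^] k))"
    unfolding d using inj_geometric[OF a] V M by (auto simp: inj_def)
qed

context fundamental_subtree
begin

text \<open>
  The arcs within \<open>S\<close> are not twisted, so the products along walks in \<open>S\<close> are trivial, and a walk from \<open>S\<close> to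
  \<open>t S\<close> across the loop has product \<open>z\<close>.
\<close>

lemma loop_twist:
  assumes loop: "loop u t u'" and z: "z \<in> Stab u" "z \<in> Stab (act t u')"
  obtains f \<phi> where "equivariant G T act f \<phi>" "f u = u" "\<phi> (gen u) = gen u" "\<phi> t = z \<otimes> t"
    "\<forall>w s w'. loop w s w' \<longrightarrow> edge_orbit {w, act s w'} \<noteq> edge_orbit {u, act t u'} \<longrightarrow> \<phi> s = s"
proof -
  have l: "u \<in> S" "u' \<in> S" "t \<in> carrier G" "(u, act t u') \<in> parcs T" "\<not> inner u (act t u')"
    using loop unfolding loop_def by auto
  obtain \<zeta> where \<zeta>: "twist G T act v0 \<zeta>" "\<zeta> u (act t u') = z"
    "\<And>x y. \<lbrakk>(x, y) \<in> parcs T; edge_orbit {x, y} \<noteq> edge_orbit {u, act t u'}\<rbrakk> \<Longrightarrow> \<zeta> x y = \<one>"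
    using edge_twist[OF l(4) z v0_V] by metis
  interpret W: twist G T act v0 \<zeta> by (rule \<zeta>(1))
  have zC: "z \<in> carrier G" using z Stab_closed by blast
  have tau_S: "W.\<tau> s = \<one>" if "s \<in> S" for s
    using that
  proof (induction rule: S_induct)
    case base
    show ?case by simp
  next
    case (step s)
    let ?p = "toward T s v0"
    have arc: "(?p, s) \<in> parcs T" using toward_arc[of s v0] step arcs_symmetric by simp
    have "inner ?p s" using step unfolding inner_def by (intro bexI[of _ \<one>]) auto
    then have "edge_orbit {?p, s} \<noteq> edge_orbit {u, act t u'}"
      using inner_edge_orbit[of ?p s u "act t u'"] l step by auto
    then show ?case using W.tau_arc[OF arc] \<zeta>(3)[OF arc] step by simp
  qed
  have "W.twist_map u = u" using tau_S[OF l(1)] l by (simp add: W.twist_map_def)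
  moreover have "W.twist_hom (gen u) = gen u"
  proof -
    have "act (gen u) u = u" using gen_pow_Stab[of u 1] l by (simp add: Stab_iff)
    then show ?thesis using W.twist_hom_at[of "gen u" u] tau_S[OF l(1)] l by simp
  qed
  moreover have "W.twist_hom t = z \<otimes> t"
    using W.twist_hom_at[of t u'] W.tau_arc[OF l(4)] tau_S l \<zeta>(2) zC by simp
  moreover have "W.twist_hom s = s"
    if w: "loop w s w'" "edge_orbit {w, act s w'} \<noteq> edge_orbit {u, act t u'}" for w s w'
  proof -
    have lw: "w \<in> S" "w' \<in> S" "s \<in> carrier G" "(w, act s w') \<in> parcs T" using w unfolding loop_def by auto
    then show ?thesis
      using W.twist_hom_at[of s w'] W.tau_arc[OF lw(4)] \<zeta>(3)[OF lw(4) w(2)] tau_S by simp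
  qed
  ultimately show ?thesis using that[OF W.twist_equivariant] by blast
qed

lemma tree_auto_equivariant:
  assumes "equivariant G T act f \<phi>"
  shows "\<phi> \<in> tree_auto G T act"
proof -
  interpret equivariant G T act f \<phi> by (rule assms)
  have "tree_isometry T f" unfolding tree_isometry_iff by unfold_locales
  then show ?thesis using phi_auto equivariant unfolding tree_auto_def by blast
qed

text \<open>
  The twisting element \<open>z\<close> must lie in the stabiliser of the edge, and conjugation by the inverse of \<open>t\<close> must
  raise it to the power \<open>\<Delta> t\<close>. Both hold for suitable powers of the generator of \<open>Stab u\<close>.
\<close>

lemma not_finitely_generated_integral_loop:
  assumes loop: "loop u t u'" and int: "\<Delta> t \<in> \<int>" "\<Delta> t \<noteq> -1"
  shows "\<exists>\<phi> \<in> tree_auto G T act. \<not> finitely_generated G (fixed_subgroup G \<phi>)"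
proof -
  have l: "u \<in> S" "u' \<in> S" "t \<in> carrier G" "(u, act t u') \<in> parcs T" using loop unfolding loop_def by auto
  obtain a where a: "\<Delta> t = of_int a" using int by (auto elim: Ints_cases)
  have a0: "a \<noteq> 0" "a \<noteq> -1" using modular_nonzero[OF l(3)] int a by auto
  obtain K :: int where K: "K \<noteq> 0" "conj t (gen u [^] (a * K)) = gen u [^] K"
    using modular_rep[OF l(3), of u a 1] a a0 l by auto
  obtain n :: int where n: "n \<noteq> 0" "gen u [^] n \<in> Stab (act t u')" using arc_common_power[OF l(4)] by blast
  define N where "N = n * K"
  have z: "gen u [^] N \<in> Stab u" "gen u [^] N \<in> Stab (act t u')"
    using Stab_pow[OF _ n(2), of K] l by (auto simp: N_def int_pow_pow)
  have "gen u [^] (N * a) = (gen u [^] (a * K)) [^] n" using l by (simp add: N_def int_pow_pow mult_ac)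
  then have "conj t (gen u [^] (N * a)) = conj t ((gen u [^] (a * K)) [^] n)" by simp
  also have "\<dots> = (gen u [^] K) [^] n" using conj_pow[OF l(3), of "gen u [^] (a * K)" n] l by (simp add: K(2))
  also have "\<dots> = gen u [^] N" using l by (simp add: int_pow_pow N_def mult.commute)
  finally have "conj t (gen u [^] (N * a)) = gen u [^] N" .
  then have c: "conj (inv t) (gen u [^] N) = gen u [^] (N * a)" using l by (simp add: conj_inv_left)
  obtain f \<phi> where f: "equivariant G T act f \<phi>" "f u = u" "\<phi> (gen u) = gen u" "\<phi> t = gen u [^] N \<otimes> t"
    using loop_twist[OF loop z] by metis
  have "\<not> finitely_generated G (fixed_subgroup G \<phi>)"
    using equivariant.not_finitely_generated_if_left_twist[OF f(1), of u t N a] f l c a0 n K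
    by (simp add: N_def)
  then show ?thesis using tree_auto_equivariant[OF f(1)] by blast
qed

text \<open>
  Twist along the first loop only, and let \<open>g\<close> be the commutator of \<open>t\<close> and \<open>s\<close>. Then \<open>\<phi>(g) = y g\<close>, where \<open>y\<close>
  is the quotient of \<open>z\<close> by its conjugate under \<open>c = t s t\<^sup>-\<^sup>1\<close>. It is nontrivial since \<open>\<Delta> c = \<Delta> s \<noteq> 1\<close>, and it
  commutes with \<open>g\<close> for suitable \<open>z\<close> since \<open>\<Delta> g = 1\<close>.
\<close>

lemma not_finitely_generated_two_loops:
  assumes loops: "loop u t u'" "loop w s w'" "edge_orbit {w, act s w'} \<noteq> edge_orbit {u, act t u'}"
    and s: "\<Delta> s \<noteq> 1"
  shows "\<exists>\<phi> \<in> tree_auto G T act. \<not> finitely_generated G (fixed_subgroup G \<phi>)"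
proof -
  have l: "u \<in> S" "u' \<in> S" "t \<in> carrier G" "(u, act t u') \<in> parcs T" using loops(1) unfolding loop_def by auto
  have sC: "s \<in> carrier G" using loops(2) unfolding loop_def by auto
  define c where "c = conj t s"
  define g where "g = c \<otimes> inv s"
  have C: "c \<in> carrier G" "g \<in> carrier G" using l sC by (auto simp: c_def g_def)
  have \<Delta>c: "\<Delta> c = \<Delta> s" using l sC modular_nonzero[OF l(3)]
    by (simp add: c_def conj_def modular_mult modular_inv)
  have \<Delta>g: "\<Delta> g = 1" using C sC modular_nonzero[OF sC] by (simp add: g_def modular_mult modular_inv \<Delta>c)
  obtain p q :: int where pq: "p \<noteq> 0" "q \<noteq> 0" "conj c (gen u [^] p) = gen u [^] q"
    using conj_gen_ex C l by (metis S_V)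
  have "\<Delta> c = of_int p / of_int q" using modular_gen_eqI[OF C(1) _ pq] l by simp
  then have pq_ne: "p \<noteq> q" using s \<Delta>c pq(1) by auto
  obtain K :: int where K: "K \<noteq> 0" "conj g (gen u [^] K) = gen u [^] K"
    using modular_rep[OF C(2), of u 1 1] \<Delta>g l by auto
  obtain n :: int where n: "n \<noteq> 0" "gen u [^] n \<in> Stab (act t u')" using arc_common_power[OF l(4)] by blast
  \<comment> \<open>The factors make \<open>z\<close> have a conjugate under \<open>c\<close> in \<open>Stab u\<close>, fix the edge, and give an element \<open>y\<close>
    that commutes with \<open>g\<close>.\<close>
  define N where "N = p * (n * K)"
  define M where "M = (p - q) * (n * K)"
  have z: "gen u [^] N \<in> Stab u" "gen u [^] N \<in> Stab (act t u')"
    using Stab_pow[OF _ n(2), of "p * K"] l by (auto simp: N_def int_pow_pow mult_ac)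
  let ?z = "gen u [^] N"
  have uC: "gen u \<in> carrier G" using l by simp
  have cz: "conj c ?z = gen u [^] (q * (n * K))"
    using conj_pow[OF C(1), of "gen u [^] p" "n * K"] uC by (simp add: N_def pq(3) int_pow_pow)
  have y: "gen u [^] M = ?z \<otimes> inv (conj c ?z)"
    unfolding cz using uC by (simp add: M_def N_def left_diff_distrib int_pow_diff)
  have "conj g (gen u [^] M) = gen u [^] M"
    using conj_pow[OF C(2), of "gen u [^] K" "(p - q) * n"] uC by (simp add: K(2) M_def int_pow_pow mult_ac)
  then have cM: "conj (inv g) (gen u [^] M) = gen u [^] (M * 1)" using C uC by (simp add: conj_inv_left)
  obtain f \<phi> where f: "equivariant G T act f \<phi>" "f u = u" "\<phi> (gen u) = gen u" "\<phi> t = ?z \<otimes> t"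
    and other: "\<forall>w s w'. loop w s w' \<longrightarrow> edge_orbit {w, act s w'} \<noteq> edge_orbit {u, act t u'} \<longrightarrow> \<phi> s = s"
    by (rule loop_twist[OF loops(1) z])
  have phi_s: "\<phi> s = s" using other loops(2,3) by blast
  interpret E: equivariant G T act f \<phi> by (rule f(1))
  have "\<phi> g = conj (?z \<otimes> t) s \<otimes> inv s"
    using l sC f(4) phi_s by (simp add: g_def c_def conj_def)
  also have "\<dots> = gen u [^] M \<otimes> g"
    unfolding y g_def c_def using l sC uC by (simp add: conj_def inv_mult_group m_assoc)
  finally have "\<phi> g = gen u [^] M \<otimes> g" .
  moreover have "M \<noteq> 0" using pq_ne n K by (simp add: M_def)
  ultimately have "\<not> finitely_generated G (fixed_subgroup G \<phi>)"
    using E.not_finitely_generated_if_left_twist[of u g M 1] f l C cM by simp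
  then show ?thesis using tree_auto_equivariant[OF f(1)] by blast
qed

lemma not_finitely_generated_exists:
  assumes "betti G T act \<noteq> 0"
    and "betti G T act = 1 \<Longrightarrow>
      \<not> (modular_image G T act = {1, -1} \<or> \<not> generated_by_integer (modular_image G T act))"
  shows "\<exists>\<phi> \<in> tree_auto G T act. \<not> finitely_generated G (fixed_subgroup G \<phi>)"
proof (cases "betti G T act = 1")
  case True
  obtain u t u' where loop: "loop u t u'" and
    single: "\<And>x y. (x, y) \<in> parcs T \<Longrightarrow> inner x y \<or> edge_orbit {x, y} = edge_orbit {u, act t u'}"
    using betti_1_loop[OF True] by blast
  have t: "t \<in> carrier G" using loop unfolding loop_def by auto
  have image: "modular_image G T act = range (\<lambda>k :: int. \<Delta> t powi k)"
    using modular_image_loop[OF loop single] .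
  have "(\<Delta> t \<in> \<int> \<or> inverse (\<Delta> t) \<in> \<int>) \<and> \<Delta> t \<noteq> -1"
    using assms(2)[OF True] powi_range_integer_condition[OF modular_nonzero[OF t]] unfolding image by satx
  then show ?thesis
  proof (elim conjE disjE)
    assume "\<Delta> t \<in> \<int>" "\<Delta> t \<noteq> -1"
    then show ?thesis by (rule not_finitely_generated_integral_loop[OF loop])
  next
    assume "inverse (\<Delta> t) \<in> \<int>" "\<Delta> t \<noteq> -1"
    moreover have "inverse (\<Delta> t) = -1 \<longleftrightarrow> \<Delta> t = -1"
      by (metis inverse_inverse_eq inverse_minus_eq inverse_1)
    ultimately show ?thesis
      using not_finitely_generated_integral_loop[OF loop_reverse(1)[OF loop]] modular_inv[OF t] by simp
  qed
next
  case False
  obtain u t u' w s w' where loops: "loop u t u'" "loop w s w'" "edge_orbit {u, act t u'} \<noteq> edge_orbit {w, act s w'}"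
    using betti_2_loops[OF assms(1) False] by blast
  show ?thesis
  proof (cases "\<Delta> s = 1")
    case True
    then show ?thesis using not_finitely_generated_integral_loop[OF loops(2)] by simp
  next
    case False
    then show ?thesis using not_finitely_generated_two_loops[OF loops(1,2)] loops(3) by simp
  qed
qed

end

theorem theoremB:
  fixes G :: "('g, 'm) monoid_scheme"
    and T :: "'v pair_pre_digraph"
    and act :: "'g \<Rightarrow> 'v \<Rightarrow> 'v"
  assumes "gbs_system G T act"
    and "non_elementary G"
    and "one_free G T act"
  shows "(\<forall>\<phi> \<in> tree_auto G T act. finitely_generated G (fixed_subgroup G \<phi>)) \<longleftrightarrow>
    betti G T act = 0 \<or>
    (betti G T act = 1 \<and>
      (modular_image G T act = {1, -1} \<or> \<not> generated_by_integer (modular_image G T act)))"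
    (is "?L \<longleftrightarrow> ?R")
proof -
  interpret one_free_gbs G T act
    using assms by (intro one_free_gbs.intro gbs.intro one_free_gbs_axioms.intro)
  show ?thesis
  proof
    assume L: ?L
    obtain v where "v \<in> pverts T" using pverts_nonempty by blast
    then obtain S where "fundamental_subtree G T act v S" using fundamental_subtree_exists by blast
    then interpret fundamental_subtree G T act v S .
    show ?R
    proof (rule ccontr)
      assume "\<not> ?R"
      then have "\<exists>\<phi> \<in> tree_auto G T act. \<not> finitely_generated G (fixed_subgroup G \<phi>)"
        by (intro not_finitely_generated_exists) auto
      then show False using L by blast
    qed
  next
    assume R: ?R
    show ?L
    proof
      fix \<phi> assume "\<phi> \<in> tree_auto G T act"
      then obtain f where \<phi>: "\<phi> \<in> auto G" "tree_isometry T f"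
        "\<And>g x. \<lbrakk>g \<in> carrier G; x \<in> pverts T\<rbrakk> \<Longrightarrow> f (act g x) = act (\<phi> g) (f x)"
        unfolding tree_auto_def by blast
      then have "tree_automorphism T f" using tree_isometry_iff by blast
      then interpret equivariant G T act f \<phi>
        using \<phi> one_free_gbs_axioms by (intro equivariant.intro equivariant_axioms.intro)
      consider "Tf = {}" | v where "v \<in> Tf" "\<phi> (gen v) = gen v"
        | "Tf \<noteq> {}" "\<And>x. x \<in> Tf \<Longrightarrow> \<phi> (gen x) = inv\<^bsub>G\<^esub> (gen x)" using phi_gen by blast
      then show "finitely_generated G (fixed_subgroup G \<phi>)"
      proof cases
        case 1
        then show ?thesis by (rule finitely_generated_no_fixed_vertex)
      next
        case 2
        then obtain S where S: "fundamental_subtree G T act v S" using fundamental_subtree_exists by blast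
        interpret equivariant_fundamental_subtree G T act f \<phi> v S
          using S equivariant_axioms 2
          by (intro equivariant_fundamental_subtree.intro equivariant_fundamental_subtree_axioms.intro) auto
        show ?thesis using R finitely_generated_betti_0 finitely_generated_betti_1 by blast
      next
        case 3
        then show ?thesis by (rule finitely_generated_inverting)
      qed
    qed
  qed
qed

end
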